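(* Let $X=\{(X_1(t),\dots,X_d(t)):t\in\mathbb{R}^n\}$ be a Gaussian random field in $\mathbb{R}^d$ such that $X_1,\dots,X_d$ are independent, centered Gaussian random fields with almost surely continuous sample paths. Let $f\colon\mathbb{R}^n\to\mathbb{R}^d$ be a Borel map and let $A\subset\mathbb{R}^n$ be an analytic set on which $X$ is regular. If $Z=X+f$ or $Z=(X+f)^*$ then, almost surely, $\dim_P Z(A)\le\dim_{P,Z}A$.
   Context: $\dim_P$ denotes packing dimension; $h^*(t)=(t,h(t))$. $\mathcal{P}_c(A)$: Borel probability measures with compact support in $A$; $\mu_Z=\mu\circ Z^{-1}$; $B(x,r)$ closed Euclidean ball. For a jointly measurable random map $Z$ and $\mu\in\mathcal{P}_c(\mathbb{R}^n)$, $\dim_{P,Z}\mu=\sup\{\gamma: \liminf_{r\to0+}r^{-\gamma}\mathbb{E}(\mu_Z(B(Z(t),r)))=0 \text{ for }\mu\text{-a.e. } t\}$ and $\dim_{P,Z}A=\sup\{\dim_{P,Z}\mu:\mu\in\mathcal{P}_c(A)\}$. $\rho_i(t,s)=\sqrt{\mathbb{E}(X_i(t)-X_i(s))^2}$. $X$ is regular on $A$ if $A=\bigcup_k A_k$ where for all $k,N\in\mathbb{N}^+$ there is $c>0$ with $\rho_i(t,s)\le c\log^{-N}(1/|t-s|)$ for all $t,s\in A_k$ and $1\le i\le d$. *)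

theory Defs
  imports "HOL-Probability.Probability"
begin

definition covnum :: "'a::metric_space set \<Rightarrow> real \<Rightarrow> nat" where
  "covnum E r = Inf {card C | C. finite C \<and> E \<subseteq> (\<Union>c\<in>C. cball c r)}"

definition upper_box_dim :: "'a::metric_space set \<Rightarrow> ereal" where
  "upper_box_dim E = Limsup (at_right 0) (\<lambda>r. ereal (ln (real (covnum E r)) / (- ln r)))"

text \<open>Packing dimension as the modified upper box dimension (Tricot / Falconer).\<close>
definition dimP :: "'a::metric_space set \<Rightarrow> ereal" where
  "dimP E = (INF \<E> \<in> {\<E>. countable \<E> \<and> (\<forall>F\<in>\<E>. bounded F) \<and> E \<subseteq> \<Union>\<E>}.
               SUP F \<in> \<E>. upper_box_dim F)"

definition msupport :: "'a::metric_space measure \<Rightarrow> 'a set" where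
  "msupport \<mu> = {x. \<forall>e>0. emeasure \<mu> (ball x e) > 0}"

definition Pc :: "'a::metric_space set \<Rightarrow> 'a measure set" where
  "Pc A = {\<mu>. sets \<mu> = sets borel \<and> prob_space \<mu> \<and> compact (msupport \<mu>) \<and> msupport \<mu> \<subseteq> A}"

definition exp_ball_mass ::
  "'w measure \<Rightarrow> ('w \<Rightarrow> 'a \<Rightarrow> 'b::metric_space) \<Rightarrow> 'a measure \<Rightarrow> 'a \<Rightarrow> real \<Rightarrow> ennreal" where
  "exp_ball_mass M Z \<mu> t r =
     (\<integral>\<^sup>+ \<omega>. emeasure \<mu> {s \<in> space \<mu>. Z \<omega> s \<in> cball (Z \<omega> t) r} \<partial>M)"

definition dimPZ_measure ::
  "'w measure \<Rightarrow> ('w \<Rightarrow> 'a \<Rightarrow> 'b::metric_space) \<Rightarrow> 'a measure \<Rightarrow> ereal" where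
  "dimPZ_measure M Z \<mu> = Sup {ereal \<gamma> | \<gamma>. AE t in \<mu>.
      Liminf (at_right 0) (\<lambda>r. ennreal (r powr (- \<gamma>)) * exp_ball_mass M Z \<mu> t r) = 0}"

definition dimPZ ::
  "'w measure \<Rightarrow> ('w \<Rightarrow> 'a::metric_space \<Rightarrow> 'b::metric_space) \<Rightarrow> 'a set \<Rightarrow> ereal" where
  "dimPZ M Z A = Sup (dimPZ_measure M Z ` Pc A)"

text \<open>A subset of a Polish space is analytic iff it is empty or a continuous image of the
  Baire space nat => nat (product topology, nat discrete).\<close>
definition analytic :: "'a::topological_space set \<Rightarrow> bool" where
  "analytic A \<longleftrightarrow> A = {} \<or> (\<exists>g :: (nat \<Rightarrow> nat) \<Rightarrow> 'a. continuous_on UNIV g \<and> range g = A)"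

definition centered_gaussian_rv :: "'w measure \<Rightarrow> ('w \<Rightarrow> real) \<Rightarrow> bool" where
  "centered_gaussian_rv M Y \<longleftrightarrow> Y \<in> borel_measurable M \<and>
     ((AE \<omega> in M. Y \<omega> = 0) \<or> (\<exists>\<sigma>>0. distributed M lborel Y (normal_density 0 \<sigma>)))"

definition centered_gaussian_field :: "'w measure \<Rightarrow> ('w \<Rightarrow> 'a \<Rightarrow> real) \<Rightarrow> bool" where
  "centered_gaussian_field M Y \<longleftrightarrow>
     (\<forall>(k::nat) (a::nat \<Rightarrow> real) (t::nat \<Rightarrow> 'a).
        centered_gaussian_rv M (\<lambda>\<omega>. \<Sum>j<k. a j * Y \<omega> (t j)))"

definition rho :: "'w measure \<Rightarrow> ('w \<Rightarrow> real^'n \<Rightarrow> real^'d) \<Rightarrow> 'd \<Rightarrow> real^'n \<Rightarrow> real^'n \<Rightarrow> real" where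
  "rho M X i t s = sqrt (\<integral>\<omega>. (X \<omega> t $ i - X \<omega> s $ i)\<^sup>2 \<partial>M)"

definition regular_on :: "'w measure \<Rightarrow> ('w \<Rightarrow> real^'n \<Rightarrow> real^'d) \<Rightarrow> (real^'n) set \<Rightarrow> bool" where
  "regular_on M X A \<longleftrightarrow> (\<exists>Ak :: nat \<Rightarrow> (real^'n) set. A = (\<Union>k. Ak k) \<and>
     (\<forall>k (N::nat). N \<ge> 1 \<longrightarrow> (\<exists>c>0. \<forall>t\<in>Ak k. \<forall>s\<in>Ak k. \<forall>i.
        rho M X i t s \<le> c / (ln (1 / dist t s)) ^ N)))"

end

theory Submission
  imports Defs "HOL-Real_Asymp.Real_Asymp"
begin

text \<open>
  Almost surely the following holds simultaneously for all measures on \<open>A\<close>, so that a measure may be chosen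
  after the path. Chaining and the logarithmic modulus of \<open>X\<close> give
  \<open>\<bar>X\<^sub>i t - X\<^sub>i s\<bar> \<le> 2 * 2 powr (\<epsilon> k) * \<rho>\<^sub>i t s + 1/2^k\<close> for all \<open>t, s\<close> in a piece of \<open>A\<close> and all large \<open>k\<close>.
  Comparing with the Gaussian density coordinatewise, the probability of \<open>dist (Z t) (Z s) \<le> 1/2^k\<close> is, up to
  \<open>2 powr (\<epsilon> k)\<close>, at most the product over the coordinates of \<open>min 1 (1/2^k / \<bar>Z\<^sub>i t - Z\<^sub>i s\<bar>)\<close> evaluated along the fixed
  path. For any finite measure on a bounded set, integrating this kernel gives almost everywhere no more than
  \<open>2 powr (\<epsilon> k)\<close> times the mass of the ball of radius \<open>1/2^k\<close>. Hence a measure on \<open>A\<close> whose image under the path has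
  small balls of small mass witnesses a large value of \<open>dim\<^bsub>P,Z\<^esub> A\<close>. If the packing dimension
  of the image of \<open>A\<close> exceeds \<open>\<gamma>\<close>, such a measure arises from a Cantor scheme: after refining a parametrization of \<open>A\<close>
  by the Baire space so that the path is continuous along it, one removes all cylinders with image of packing dimension at most \<open>\<gamma>\<close>, and
  every remaining cylinder contains, at arbitrarily small scales \<open>r\<close>, at least \<open>r powr (-\<gamma>)\<close> points with \<open>r\<close>-separated images.
\<close>

section \<open>Packing dimension\<close>

text \<open>The measure that witnesses a large packing dimension of the image depends on the path,
  whereas \<open>dimPZ\<close> averages over all paths, so Fubini for one fixed measure cannot help.
  Hence the two-point probabilities are bounded by a kernel of the observed path, uniformly in
  \<open>t\<close> and \<open>s\<close>. Packing dimension provides small ball masses only along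
  sparse scales, so contributions of dyadic annuli cannot be summed; the kernel at scale
  \<open>r\<close> must be compared with the mass of a ball of the same radius. This succeeds
  because \<open>min 1 (r / \<bar>u\<bar>)\<close> is a borderline case: its sum over a grid of mesh
  \<open>r\<close> is only logarithmic, and powers of \<open>k\<close> are absorbed by
  \<open>2 powr (\<epsilon> * k)\<close>. The path estimate must lose no more than
  \<open>2 powr (\<epsilon> * k)\<close> for every \<epsilon>. Paying for this in the chaining takes
  a power of the logarithm of order \<open>1 / \<epsilon>\<close>, which is where regularity for all
  exponents enters. The losses are finally charged to the gap between two exponents
  \<open>g' < g\<close>.\<close>

lemma dimP_le_upper_box_dim:
  assumes "bounded F" shows "dimP F \<le> upper_box_dim F"
  unfolding dimP_def using assms by (intro INF_lower2[of "{F}"]) auto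

lemma dimP_mono:
  assumes "E \<subseteq> F" shows "dimP E \<le> dimP F"
  unfolding dimP_def using assms by (intro INF_superset_mono) auto

text \<open>Countable covers of the pieces merge into one countable cover, and a supremum over the
  merged cover is the largest of the separate suprema. The slack \<open>y\<close> is there because
  the infimum in \<open>dimP\<close> need not be attained.\<close>

lemma dimP_UN_le:
  fixes S :: "'i \<Rightarrow> 'a::metric_space set"
  assumes "countable I" and le: "\<And>i. i \<in> I \<Longrightarrow> dimP (S i) \<le> g"
  shows "dimP (\<Union>i\<in>I. S i) \<le> g"
proof (rule dense_ge)
  fix y :: ereal assume "g < y"
  have "\<exists>\<E>. countable \<E> \<and> (\<forall>F\<in>\<E>. bounded F) \<and> S i \<subseteq> \<Union>\<E> \<and> (SUP F\<in>\<E>. upper_box_dim F) < y"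
    if "i \<in> I" for i
  proof -
    have "dimP (S i) < y" using le[OF that] \<open>g < y\<close> by order
    then show ?thesis unfolding dimP_def by (subst (asm) INF_less_iff) auto
  qed
  then obtain \<E> where \<E>: "\<And>i. i \<in> I \<Longrightarrow> countable (\<E> i)" "\<And>i F. i \<in> I \<Longrightarrow> F \<in> \<E> i \<Longrightarrow> bounded F"
    "\<And>i. i \<in> I \<Longrightarrow> S i \<subseteq> \<Union>(\<E> i)" "\<And>i. i \<in> I \<Longrightarrow> (SUP F\<in>\<E> i. upper_box_dim F) < y"
    by metis
  have "dimP (\<Union>i\<in>I. S i) \<le> (SUP F \<in> (\<Union>i\<in>I. \<E> i). upper_box_dim F)"
    unfolding dimP_def
  proof (rule INF_lower, safe)
    show "countable (\<Union>i\<in>I. \<E> i)" using \<E>(1) \<open>countable I\<close> by auto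
  next
    fix F i assume "i \<in> I" "F \<in> \<E> i" then show "bounded F" by (rule \<E>(2))
  next
    fix x i assume "i \<in> I" "x \<in> S i" then show "x \<in> \<Union>(\<Union>i\<in>I. \<E> i)" using \<E>(3)[of i] by blast
  qed
  also have "\<dots> \<le> y"
  proof (rule SUP_least)
    fix F assume "F \<in> (\<Union>i\<in>I. \<E> i)"
    then obtain i where i: "i \<in> I" "F \<in> \<E> i" by auto
    have "upper_box_dim F \<le> (SUP F\<in>\<E> i. upper_box_dim F)" using i(2) by (rule SUP_upper)
    with \<E>(4)[OF i(1)] show "upper_box_dim F \<le> y" by order
  qed
  finally show "dimP (\<Union>i\<in>I. S i) \<le> y" .
qed

lemma covnum_le_card:
  assumes "finite C" "E \<subseteq> (\<Union>c\<in>C. cball c r)" shows "covnum E r \<le> card C"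
  unfolding covnum_def using assms by (intro wellorder_Inf_le1) auto

text \<open>Greedy choice: fewer than \<open>covnum F r\<close> balls do not cover \<open>F\<close>,
  so a point far from all chosen ones remains.\<close>

lemma separated_subset_card_covnum:
  assumes "0 \<le> r" and "N \<le> covnum F r"
  shows "\<exists>S\<subseteq>F. finite S \<and> card S = N \<and> pairwise (\<lambda>x y. r < dist x y) S"
  using assms(2)
proof (induction N)
  case 0 show ?case by (intro exI[of _ "{}"]) (auto simp: pairwise_def)
next
  case (Suc N)
  then obtain S where S: "S \<subseteq> F" "finite S" "card S = N" "pairwise (\<lambda>x y. r < dist x y) S" by auto
  have "\<not> F \<subseteq> (\<Union>c\<in>S. cball c r)"
    using covnum_le_card[OF S(2), of F r] Suc.prems S(3) by auto
  then obtain x where x: "x \<in> F" "\<And>c. c \<in> S \<Longrightarrow> r < dist c x" by fastforce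
  then have "x \<notin> S" using \<open>0 \<le> r\<close> by force
  then show ?case using S x
    by (intro exI[of _ "insert x S"]) (auto simp: pairwise_insert dist_commute)
qed

text \<open>A limsup above \<gamma> speaks only about some scales tending to 0, which is why one
  radius below \<open>e\<close> is produced and not all of them.\<close>

lemma separated_subset_of_upper_box_dim:
  assumes dim: "ereal \<gamma> < upper_box_dim F" and "F \<noteq> {}" and "0 < e"
  shows "\<exists>r S. 0 < r \<and> r < e \<and> S \<subseteq> F \<and> finite S \<and> S \<noteq> {}
    \<and> pairwise (\<lambda>x y. r < dist x y) S \<and> r powr - \<gamma> \<le> card S"
proof -
  let ?q = "\<lambda>r. ln (real (covnum F r)) / - ln r"
  have "\<exists>\<^sub>F r in at_right 0. \<gamma> < ?q r"
  proof (rule ccontr)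
    assume "\<not> ?thesis"
    then have "\<forall>\<^sub>F r in at_right 0. ereal (?q r) \<le> ereal \<gamma>"
      by (simp add: not_frequently not_less)
    then have "upper_box_dim F \<le> ereal \<gamma>"
      unfolding upper_box_dim_def by (rule Limsup_bounded)
    with dim show False by simp
  qed
  moreover have "\<forall>\<^sub>F r in at_right 0. r \<in> {0<..<min e 1}"
    using \<open>0 < e\<close> by (intro eventually_at_right_real) auto
  ultimately have "\<exists>\<^sub>F r in at_right 0. \<gamma> < ?q r \<and> r \<in> {0<..<min e 1}"
    by (rule frequently_eventually_frequently)
  then obtain r where r: "\<gamma> < ?q r" "0 < r" "r < e" "r < 1"
    by (auto dest: frequently_ex)
  obtain x where "x \<in> F" using \<open>F \<noteq> {}\<close> by auto
  \<comment> \<open>Since \<open>ln 0 = 0 = ln 1\<close>, a covering number 0 may be replaced by 1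
    without changing the quotient \<open>?q r\<close>; a single point then serves.\<close>
  have "\<exists>S\<subseteq>F. finite S \<and> card S = max 1 (covnum F r) \<and> pairwise (\<lambda>x y. r < dist x y) S"
  proof (cases "covnum F r = 0")
    case True
    then show ?thesis using \<open>x \<in> F\<close> by (intro exI[of _ "{x}"]) (auto simp: pairwise_def)
  next
    case False
    then show ?thesis using separated_subset_card_covnum[of r "covnum F r" F] r(2) by (auto simp: max_def)
  qed
  then obtain S where S: "S \<subseteq> F" "finite S" "card S = max 1 (covnum F r)"
    "pairwise (\<lambda>x y. r < dist x y) S" by auto
  have lncard: "ln (real (card S)) = ln (real (covnum F r))"
    unfolding S(3) by (cases "covnum F r") (auto simp: max_def)
  have "\<gamma> * - ln r < ln (real (card S))"
    using r(1) ln_less_zero[OF r(2,4)] unfolding lncard by (subst (asm) pos_less_divide_eq) auto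
  then have "exp (\<gamma> * - ln r) < real (card S)"
    using S(3) by (subst (asm) exp_less_cancel_iff[symmetric]) (auto simp: max_def split: if_splits)
  then have "r powr - \<gamma> \<le> card S" using r(2) by (simp add: powr_def)
  moreover have "S \<noteq> {}" using S(3) by auto
  ultimately show ?thesis using S r by blast
qed

section \<open>Souslin parametrizations\<close>

text \<open>Prefix agreement plays the part of a metric on the Baire space:
  \<open>cyl_closed\<close> and \<open>cyl_cont\<close> express closedness and relative continuity
  for the product topology in the form that tree constructions use.\<close>

definition agree :: "nat \<Rightarrow> (nat \<Rightarrow> nat) \<Rightarrow> (nat \<Rightarrow> nat) \<Rightarrow> bool" where
  "agree n x y \<longleftrightarrow> (\<forall>i<n. x i = y i)"

definition cyl_closed :: "(nat \<Rightarrow> nat) set \<Rightarrow> bool" where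
  "cyl_closed F \<longleftrightarrow> (\<forall>x. (\<forall>n. \<exists>y\<in>F. agree n x y) \<longrightarrow> x \<in> F)"

definition cyl_cont :: "(nat \<Rightarrow> nat) set \<Rightarrow> ((nat \<Rightarrow> nat) \<Rightarrow> 'a::metric_space) \<Rightarrow> bool" where
  "cyl_cont F h \<longleftrightarrow> (\<forall>x\<in>F. \<forall>e>0. \<exists>n. \<forall>y\<in>F. agree n x y \<longrightarrow> dist (h x) (h y) < e)"

lemma agree_refl [simp]: "agree n x x" by (simp add: agree_def)
lemma agree_sym: "agree n x y \<Longrightarrow> agree n y x" by (simp add: agree_def)
lemma agree_trans: "agree n x y \<Longrightarrow> agree n y z \<Longrightarrow> agree n x z" by (simp add: agree_def)
lemma agree_mono: "agree n x y \<Longrightarrow> m \<le> n \<Longrightarrow> agree m x y" by (auto simp: agree_def)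

lemma open_agree: "open {y. agree n x y}"
proof -
  have "open ((\<lambda>y. y i) -` {x i})" for i
    by (rule open_vimage[OF discrete_topology_class.open_discrete]) (rule continuous_on_product_coordinates)
  then have "open (\<Inter>i\<in>{..<n}. (\<lambda>y. y i) -` {x i})" by (intro open_INT) auto
  moreover have "{y. agree n x y} = (\<Inter>i\<in>{..<n}. (\<lambda>y. y i) -` {x i})"
    by (auto simp: agree_def)
  ultimately show ?thesis by simp
qed

text \<open>A basic open set of the product topology restricts finitely many coordinates, and a long
  enough prefix fixes all of them.\<close>

lemma agree_neighbourhood:
  fixes U :: "(nat \<Rightarrow> nat) set"
  assumes "open U" "x \<in> U" shows "\<exists>n. {y. agree n x y} \<subseteq> U"
proof -
  have "openin (product_topology (\<lambda>_. euclidean) UNIV) U" using assms(1) by (simp add: open_fun_def)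
  from product_topology_open_contains_basis[OF this assms(2)]
  obtain X where X: "x \<in> Pi\<^sub>E UNIV X" "finite {i. X i \<noteq> UNIV}" "Pi\<^sub>E UNIV X \<subseteq> U"
    by auto
  obtain n where n: "\<forall>i\<in>{i. X i \<noteq> UNIV}. i < n" using X(2) finite_nat_set_iff_bounded by auto
  have "{y. agree n x y} \<subseteq> Pi\<^sub>E UNIV X"
  proof (rule subsetI)
    fix y assume "y \<in> {y. agree n x y}"
    then have y: "agree n x y" by simp
    have "y i \<in> X i" for i
    proof (cases "i < n")
      case True
      then have "y i = x i" using y by (simp add: agree_def)
      then show ?thesis using PiE_mem[OF X(1), of i] by simp
    qed (use n in auto)
    then show "y \<in> Pi\<^sub>E UNIV X" by (simp add: PiE_UNIV_domain)
  qed
  then show ?thesis using X(3) by blast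
qed

lemma continuous_on_imp_cyl_cont:
  fixes h :: "(nat \<Rightarrow> nat) \<Rightarrow> 'a::metric_space"
  assumes "continuous_on UNIV h" shows "cyl_cont F h"
  unfolding cyl_cont_def
proof safe
  fix x and e :: real assume "e > 0"
  have "open (h -` ball (h x) e)" using assms by (intro open_vimage) auto
  then obtain n where "{y. agree n x y} \<subseteq> h -` ball (h x) e"
    using agree_neighbourhood[of "h -` ball (h x) e" x] \<open>e > 0\<close> by auto
  then show "\<exists>n. \<forall>y\<in>F. agree n x y \<longrightarrow> dist (h x) (h y) < e" by (intro exI[of _ n]) auto
qed

lemma cyl_cont_imp_continuous_on:
  assumes "cyl_cont F h" shows "continuous_on F h"
  unfolding continuous_on_topological
proof safe
  fix x B assume "x \<in> F" "open B" "h x \<in> B"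
  then obtain e where e: "e > 0" "ball (h x) e \<subseteq> B" using openE by blast
  then obtain n where n: "\<forall>y\<in>F. agree n x y \<longrightarrow> dist (h x) (h y) < e"
    using assms \<open>x \<in> F\<close> unfolding cyl_cont_def by blast
  then show "\<exists>A. open A \<and> x \<in> A \<and> (\<forall>y\<in>F. y \<in> A \<longrightarrow> h y \<in> B)"
    using e(2) by (intro exI[of _ "{y. agree n x y}"]) (auto simp: open_agree)
qed

lemma cyl_cont_subset: "cyl_cont F h \<Longrightarrow> F' \<subseteq> F \<Longrightarrow> cyl_cont F' h"
  unfolding cyl_cont_def by (meson subsetD)

lemma cyl_cont_compose:
  assumes "cyl_cont F h" and "continuous_on UNIV g" shows "cyl_cont F (\<lambda>x. g (h x))"
  unfolding cyl_cont_def
proof safe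
  fix x and e :: real assume x: "x \<in> F" and "e > 0"
  then obtain d where d: "d > 0" "\<And>y. dist y (h x) < d \<Longrightarrow> dist (g y) (g (h x)) < e"
    using assms(2) unfolding continuous_on_iff by (metis UNIV_I)
  then obtain n where "\<forall>y\<in>F. agree n x y \<longrightarrow> dist (h x) (h y) < d"
    using assms(1) x unfolding cyl_cont_def by blast
  then show "\<exists>n. \<forall>y\<in>F. agree n x y \<longrightarrow> dist (g (h x)) (g (h y)) < e"
    using d by (metis dist_commute)
qed

lemma cyl_cont_Pair:
  assumes "cyl_cont F h" and "cyl_cont F g" shows "cyl_cont F (\<lambda>x. (h x, g x))"
  unfolding cyl_cont_def
proof safe
  fix x and e :: real assume x: "x \<in> F" and "e > 0"
  obtain n where n: "\<forall>y\<in>F. agree n x y \<longrightarrow> dist (h x) (h y) < e/2"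
    using assms(1) x \<open>e > 0\<close> unfolding cyl_cont_def by (meson half_gt_zero)
  obtain m where m: "\<forall>y\<in>F. agree m x y \<longrightarrow> dist (g x) (g y) < e/2"
    using assms(2) x \<open>e > 0\<close> unfolding cyl_cont_def by (meson half_gt_zero)
  have "dist (h x, g x) (h y, g y) < e" if "y \<in> F" "agree (max n m) x y" for y
  proof -
    have "dist (h x) (h y) < e/2" "dist (g x) (g y) < e/2"
      using n m that agree_mono[OF that(2)] by (meson max.cobounded1 max.cobounded2)+
    then show ?thesis using sqrt_sum_squares_le_sum_abs[of "dist (h x) (h y)" "dist (g x) (g y)"]
      by (simp add: dist_Pair_Pair)
  qed
  then show "\<exists>n. \<forall>y\<in>F. agree n x y \<longrightarrow> dist (h x, g x) (h y, g y) < e" by blast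
qed

text \<open>Closed subsets of the Baire space are allowed as parameter spaces, since they arise as fibre products.\<close>

definition souslin :: "'a::metric_space set \<Rightarrow> bool" where
  "souslin S \<longleftrightarrow> (\<exists>F g. cyl_closed F \<and> cyl_cont F g \<and> g ` F = S)"

definition tail :: "(nat \<Rightarrow> nat) \<Rightarrow> nat \<Rightarrow> nat" where "tail x = (\<lambda>n. x (Suc n))"

lemma agree_tail: "agree (Suc n) x y \<Longrightarrow> agree n (tail x) (tail y)"
  by (auto simp: agree_def tail_def)

text \<open>The first entry selects the set and the remaining entries are its parameter. Agreement
  on one entry already fixes the selection, so closedness and continuity are inherited from the
  selected piece.\<close>

lemma union_parametrization:
  fixes g :: "nat \<Rightarrow> (nat \<Rightarrow> nat) \<Rightarrow> 'a::metric_space"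
  assumes F: "\<And>i. cyl_closed (F i)" and g: "\<And>i. cyl_cont (F i) (g i)"
  defines "U \<equiv> {x. tail x \<in> F (x 0)}" and "h \<equiv> \<lambda>x. g (x 0) (tail x)"
  shows "cyl_closed U" "cyl_cont U h" "h ` U = (\<Union>i. g i ` F i)"
proof -
  show "cyl_closed U"
    unfolding cyl_closed_def
  proof safe
    fix x assume x: "\<forall>n. \<exists>y\<in>U. agree n x y"
    have "\<exists>z\<in>F (x 0). agree n (tail x) z" for n
    proof -
      obtain y where y: "y \<in> U" "agree (Suc n) x y" using x by blast
      then have "x 0 = y 0" by (simp add: agree_def)
      then show ?thesis using y agree_tail[OF y(2)] by (auto simp: U_def)
    qed
    then show "x \<in> U" using F[of "x 0"] unfolding cyl_closed_def U_def by auto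
  qed
  show "cyl_cont U h"
    unfolding cyl_cont_def
  proof safe
    fix x and e :: real assume x: "x \<in> U" and "e > 0"
    then obtain n where n: "\<forall>y\<in>F (x 0). agree n (tail x) y \<longrightarrow> dist (g (x 0) (tail x)) (g (x 0) y) < e"
      using g[of "x 0"] unfolding cyl_cont_def U_def by blast
    have "dist (h x) (h y) < e" if y: "y \<in> U" "agree (Suc n) x y" for y
    proof -
      have "x 0 = y 0" using y(2) by (simp add: agree_def)
      then show ?thesis using n y agree_tail[OF y(2)] by (auto simp: U_def h_def)
    qed
    then show "\<exists>n. \<forall>y\<in>U. agree n x y \<longrightarrow> dist (h x) (h y) < e" by blast
  qed
  show "h ` U = (\<Union>i. g i ` F i)"
  proof safe
    fix i x assume "x \<in> F i"
    then have "case_nat i x \<in> U" "h (case_nat i x) = g i x" by (auto simp: U_def h_def tail_def)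
    then show "g i x \<in> h ` U" by (metis imageI)
  qed (auto simp: U_def h_def)
qed

text \<open>Row \<open>i\<close> of the sequence read as an infinite matrix through the pairing
  function, so that one sequence codes countably many.\<close>

definition strand :: "nat \<Rightarrow> (nat \<Rightarrow> nat) \<Rightarrow> nat \<Rightarrow> nat" where
  "strand i x = (\<lambda>n. x (prod_encode (i, n)))"

lemma ex_agree_strand: "\<exists>m. \<forall>x y. agree m x y \<longrightarrow> agree n (strand i x) (strand i y)"
proof -
  obtain m where "\<forall>k\<in>(\<lambda>n. prod_encode (i, n)) ` {..<n}. k < m"
    using finite_nat_set_iff_bounded by blast
  then show ?thesis by (intro exI[of _ m]) (auto simp: agree_def strand_def)
qed

text \<open>A fibre product: the rows of one sequence carry a parameter for every set, subject to
  all of them naming the same point. Coincidence of continuous maps is a closed condition, so the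
  parameter space remains closed.\<close>

lemma inter_parametrization:
  fixes g :: "nat \<Rightarrow> (nat \<Rightarrow> nat) \<Rightarrow> 'a::metric_space"
  assumes F: "\<And>i. cyl_closed (F i)" and g: "\<And>i. cyl_cont (F i) (g i)"
  defines "V \<equiv> {x. \<forall>i. strand i x \<in> F i \<and> g i (strand i x) = g 0 (strand 0 x)}"
  shows "cyl_closed V" "cyl_cont V (\<lambda>x. g 0 (strand 0 x))" "(\<lambda>x. g 0 (strand 0 x)) ` V = (\<Inter>i. g i ` F i)"
proof -
  have near: "\<exists>m. \<forall>y\<in>V. agree m x y \<longrightarrow> dist (g i (strand i x)) (g i (strand i y)) < e"
    if hyp: "strand i x \<in> F i" "e > 0" for x i e
  proof -
    obtain n where "\<forall>z\<in>F i. agree n (strand i x) z \<longrightarrow> dist (g i (strand i x)) (g i z) < e"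
      using g[of i] hyp unfolding cyl_cont_def by blast
    moreover obtain m where "\<forall>x y. agree m x y \<longrightarrow> agree n (strand i x) (strand i y)" using ex_agree_strand by blast
    ultimately show ?thesis by (intro exI[of _ m]) (auto simp: V_def)
  qed
  show "cyl_closed V"
    unfolding cyl_closed_def
  proof safe
    fix x assume x: "\<forall>n. \<exists>y\<in>V. agree n x y"
    have rF: "strand i x \<in> F i" for i
    proof -
      have "\<exists>z\<in>F i. agree n (strand i x) z" for n
      proof -
        obtain m where m: "\<forall>x y. agree m x y \<longrightarrow> agree n (strand i x) (strand i y)" using ex_agree_strand by blast
        obtain y where "y \<in> V" "agree m x y" using x by blast
        then show ?thesis using m by (auto simp: V_def)
      qed
      then show ?thesis using F[of i] unfolding cyl_closed_def by auto
    qed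
    have "g i (strand i x) = g 0 (strand 0 x)" for i
    proof (rule ccontr)
      assume ne: "g i (strand i x) \<noteq> g 0 (strand 0 x)"
      define e where "e = dist (g i (strand i x)) (g 0 (strand 0 x)) / 2"
      have "e > 0" using ne by (simp add: e_def)
      obtain m where m: "\<forall>y\<in>V. agree m x y \<longrightarrow> dist (g i (strand i x)) (g i (strand i y)) < e"
        using near[OF rF \<open>e > 0\<close>] by blast
      obtain m' where m': "\<forall>y\<in>V. agree m' x y \<longrightarrow> dist (g 0 (strand 0 x)) (g 0 (strand 0 y)) < e"
        using near[OF rF \<open>e > 0\<close>] by blast
      obtain y where y: "y \<in> V" "agree (max m m') x y" using x by blast
      then have "dist (g i (strand i x)) (g i (strand i y)) < e" "dist (g 0 (strand 0 x)) (g 0 (strand 0 y)) < e"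
        using m m' agree_mono by (metis max.cobounded1 max.cobounded2)+
      moreover have "g i (strand i y) = g 0 (strand 0 y)" using y(1) by (simp add: V_def)
      ultimately show False unfolding e_def by metric
    qed
    then show "x \<in> V" using rF by (auto simp: V_def)
  qed
  show "cyl_cont V (\<lambda>x. g 0 (strand 0 x))"
    unfolding cyl_cont_def using near by (auto simp: V_def)
  show "(\<lambda>x. g 0 (strand 0 x)) ` V = (\<Inter>i. g i ` F i)"
  proof safe
    fix x i assume "x \<in> V"
    then show "g 0 (strand 0 x) \<in> g i ` F i" by (intro image_eqI[of _ _ "strand i x"]) (simp_all add: V_def, metis)
  next
    fix t assume t: "t \<in> (\<Inter>i. g i ` F i)"
    then have "\<forall>i. \<exists>z. z \<in> F i \<and> t = g i z" by blast
    then obtain z where z: "\<And>i. z i \<in> F i" "\<And>i. t = g i (z i)" by metis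
    define x where "x = (\<lambda>m. z (fst (prod_decode m)) (snd (prod_decode m)))"
    have "strand i x = z i" for i by (auto simp: strand_def x_def)
    then have "x \<in> V" "g 0 (strand 0 x) = t" using z by (auto simp: V_def)
    then show "t \<in> (\<lambda>x. g 0 (strand 0 x)) ` V" by blast
  qed
qed

lemma souslin_UN:
  fixes S :: "nat \<Rightarrow> 'a::metric_space set"
  assumes "\<And>i. souslin (S i)" shows "souslin (\<Union>i. S i)"
proof -
  obtain F g where "\<And>i. cyl_closed (F i)" "\<And>i. cyl_cont (F i) (g i)" "\<And>i. g i ` F i = S i"
    using assms unfolding souslin_def by metis
  then show ?thesis using union_parametrization[of F g] unfolding souslin_def by auto
qed

lemma souslin_INT:
  fixes S :: "nat \<Rightarrow> 'a::metric_space set"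
  assumes "\<And>i. souslin (S i)" shows "souslin (\<Inter>i. S i)"
proof -
  obtain F g where "\<And>i. cyl_closed (F i)" "\<And>i. cyl_cont (F i) (g i)" "\<And>i. g i ` F i = S i"
    using assms unfolding souslin_def by metis
  then show ?thesis using inter_parametrization[of F g] unfolding souslin_def by (intro exI conjI) auto
qed

section \<open>Closed, open and Borel sets as Souslin sets\<close>

lemma cyl_closed_preimage:
  assumes "cyl_closed F" "cyl_cont F g" "closed C" shows "cyl_closed {x\<in>F. g x \<in> C}"
  unfolding cyl_closed_def
proof safe
  fix x assume x: "\<forall>n. \<exists>y\<in>{x\<in>F. g x \<in> C}. agree n x y"
  then show "x \<in> F" using assms(1) unfolding cyl_closed_def by blast
  show "g x \<in> C"
  proof (rule closure_approachable[THEN iffD2, of C "g x", unfolded closure_closed[OF assms(3)], rule_format])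
    fix e :: real assume "e > 0"
    then obtain n where n: "\<forall>y\<in>F. agree n x y \<longrightarrow> dist (g x) (g y) < e"
      using assms(2) \<open>x \<in> F\<close> unfolding cyl_cont_def by blast
    obtain y where "y \<in> F" "g y \<in> C" "agree n x y" using x by blast
    then show "\<exists>y\<in>C. dist y (g x) < e" using n by (auto simp: dist_commute)
  qed
qed

lemma souslin_Int_closed:
  assumes "souslin S" "closed C" shows "souslin (S \<inter> C)"
proof -
  obtain F g where F: "cyl_closed F" "cyl_cont F g" "g ` F = S" using assms(1) unfolding souslin_def by blast
  have "cyl_cont {x\<in>F. g x \<in> C} g" using F(2) by (rule cyl_cont_subset) auto
  moreover have "g ` {x\<in>F. g x \<in> C} = S \<inter> C" using F(3) by auto
  ultimately show ?thesis using cyl_closed_preimage[OF F(1,2) assms(2)] unfolding souslin_def by blast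
qed

text \<open>Points are coded by rapidly convergent sequences from a countable dense set. The rate is
  prescribed, so the limit depends continuously on the code and each constraint involves only two
  neighbouring entries.\<close>

lemma souslin_UNIV: "souslin (UNIV :: 'a::polish_space set)"
proof -
  obtain D :: "'a set" where D: "countable D" "\<And>U. open U \<Longrightarrow> U \<noteq> {} \<Longrightarrow> \<exists>d\<in>D. d \<in> U"
    using countable_dense_setE by blast
  then have "D \<noteq> {}" by (metis open_UNIV UNIV_not_empty empty_iff)
  define q where "q = from_nat_into D"
  have q: "\<exists>n. dist (q n) t < e" if "e > 0" for t e
  proof -
    obtain d where "d \<in> D" "d \<in> ball t e" using D(2)[of "ball t e"] \<open>e > 0\<close> by auto
    then show ?thesis using from_nat_into_surj[OF D(1)] unfolding q_def by (metis mem_ball dist_commute)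
  qed
  define F where "F = {x. \<forall>k. dist (q (x k)) (q (x (Suc k))) \<le> (1/2)^k}"
  have step: "dist (q (x m)) (q (x (m + n))) \<le> 2 * (1/2)^m - 2 * (1/2)^(m+n)" if "x \<in> F" for x m n
  proof (induction n)
    case (Suc n)
    have "dist (q (x (m + n))) (q (x (Suc (m + n)))) \<le> (1/2)^(m+n)" using that by (simp add: F_def)
    then show ?case using Suc dist_triangle[of "q (x m)" "q (x (m + Suc n))" "q (x (m+n))"] by simp
  qed simp
  have step': "dist (q (x m)) (q (x (m + n))) \<le> 2 * (1/2)^m" if "x \<in> F" for x m n
    using step[OF that, of m n] zero_le_power[of "1/2::real" "m+n"] by linarith
  have conv: "convergent (\<lambda>k. q (x k))" if "x \<in> F" for x
  proof (rule Cauchy_convergent, rule metric_CauchyI)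
    fix e :: real assume "e > 0"
    then obtain m where m: "(1/2)^m < e/4" using real_arch_pow_inv[of "e/4" "1/2"] by auto
    have "dist (q (x i)) (q (x j)) < e" if "i \<ge> m" "j \<ge> m" for i j
      using step'[OF \<open>x \<in> F\<close>, of m "i-m"] step'[OF \<open>x \<in> F\<close>, of m "j-m"] that m
        dist_triangle3[of "q (x i)" "q (x j)" "q (x m)"] by simp
    then show "\<exists>M. \<forall>i\<ge>M. \<forall>j\<ge>M. dist (q (x i)) (q (x j)) < e" by blast
  qed
  define g where "g x = lim (\<lambda>k. q (x k))" for x
  have glim: "(\<lambda>k. q (x k)) \<longlonglongrightarrow> g x" if "x \<in> F" for x
    using conv[OF that] unfolding g_def convergent_LIMSEQ_iff .
  have gd: "dist (q (x m)) (g x) \<le> 2 * (1/2)^m" if "x \<in> F" for x m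
  proof (rule LIMSEQ_le_const2)
    show "(\<lambda>n. dist (q (x m)) (q (x n))) \<longlonglongrightarrow> dist (q (x m)) (g x)"
      by (intro tendsto_intros glim that)
    show "\<exists>N. \<forall>n\<ge>N. dist (q (x m)) (q (x n)) \<le> 2 * (1 / 2) ^ m"
      using step'[OF that, of m] by (metis le_Suc_ex)
  qed
  have "cyl_closed F"
    unfolding cyl_closed_def
  proof safe
    fix x assume x: "\<forall>n. \<exists>y\<in>F. agree n x y"
    have "dist (q (x k)) (q (x (Suc k))) \<le> (1/2)^k" for k
    proof -
      obtain y where "y \<in> F" "agree (Suc (Suc k)) x y" using x by blast
      then show ?thesis by (simp add: F_def agree_def)
    qed
    then show "x \<in> F" by (simp add: F_def)
  qed
  moreover have "cyl_cont F g"
    unfolding cyl_cont_def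
  proof safe
    fix x and e :: real assume x: "x \<in> F" "e > 0"
    then obtain m where m: "(1/2)^m < e/4" using real_arch_pow_inv[of "e/4" "1/2"] by auto
    have "dist (g x) (g y) < e" if "y \<in> F" "agree (Suc m) x y" for y
    proof -
      have "x m = y m" using that(2) by (simp add: agree_def)
      then show ?thesis using gd[OF x(1), of m] gd[OF that(1), of m] m
        dist_triangle3[of "g x" "g y" "q (x m)"] by simp
    qed
    then show "\<exists>n. \<forall>y\<in>F. agree n x y \<longrightarrow> dist (g x) (g y) < e" by blast
  qed
  moreover have "t \<in> g ` F" for t
  proof -
    \<comment> \<open>Half of the allowed step: two consecutive approximations of \<open>t\<close>
      are then within \<open>(1/2)^k\<close> of each other, as \<open>F\<close> demands.\<close>
    have "\<exists>n. dist (q n) t < (1/2)^k/2" for k by (rule q) simp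
    then obtain x where x: "\<And>k. dist (q (x k)) t < (1/2)^k/2" by metis
    have "dist (q (x k)) (q (x (Suc k))) \<le> (1/2)^k" for k
    proof -
      have "dist (q (x (Suc k))) t < (1/2)^k/2" using x[of "Suc k"] zero_le_power[of "1/2::real" k]
        by (simp add: field_simps)
      then show ?thesis using x[of k] dist_triangle2[of "q (x k)" "q (x (Suc k))" t] by linarith
    qed
    then have "x \<in> F" by (simp add: F_def)
    have "(\<lambda>k. q (x k)) \<longlonglongrightarrow> t"
    proof (rule tendsto_dist_iff[THEN iffD2], rule tendsto_sandwich[OF _ _ tendsto_const])
      show "(\<lambda>k. (1/2)^k/2 :: real) \<longlonglongrightarrow> 0" by real_asymp
      show "\<forall>\<^sub>F k in sequentially. dist (q (x k)) t \<le> (1/2)^k/2"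
        using x by (intro always_eventually allI less_imp_le)
    qed auto
    then have "g x = t" using glim[OF \<open>x \<in> F\<close>] LIMSEQ_unique by blast
    then show ?thesis using \<open>x \<in> F\<close> by blast
  qed
  ultimately show ?thesis unfolding souslin_def by (intro exI[of _ F] exI[of _ g]) auto
qed

lemma souslin_closed: "closed C \<Longrightarrow> souslin (C :: 'a::polish_space set)"
  using souslin_Int_closed[OF souslin_UNIV, of C] by simp

lemma souslin_open:
  fixes U :: "'a::polish_space set" assumes "open U" shows "souslin U"
\<comment> \<open>The whole space is separate because \<open>infdist\<close> to the empty set is 0,
  which would make every \<open>C n\<close> below empty.\<close>
proof (cases "U = UNIV")
  case False
  define C where "C n = {x. 1 / real (Suc n) \<le> infdist x (-U)}" for n
  have "closed (C n)" for n unfolding C_def by (intro closed_Collect_le continuous_intros)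
  moreover have "U = (\<Union>n. C n)"
  proof safe
    fix x assume "x \<in> U"
    then have "infdist x (-U) > 0"
      using infdist_pos_not_in_closed[of "-U" x] assms False by auto
    then obtain n where "inverse (real (Suc n)) < infdist x (-U)" using reals_Archimedean by blast
    then show "x \<in> (\<Union>n. C n)" by (auto simp: C_def field_simps intro!: exI[of _ n])
  next
    fix x n assume "x \<in> C n"
    then have "1 / real (Suc n) \<le> infdist x (-U)" by (simp add: C_def)
    moreover have "0 < 1 / real (Suc n)" by simp
    ultimately have "infdist x (-U) > 0" by linarith
    then show "x \<in> U" by (metis infdist_zero ComplI less_irrefl)
  qed
  ultimately show ?thesis using souslin_UN[of C] souslin_closed by metis
qed (auto intro: souslin_closed)

text \<open>Souslin sets are not closed under complement, so the induction over the sigma algebra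
  carries a set together with its complement; unions and intersections then exchange roles.\<close>

lemma souslin_borel:
  fixes S :: "'a::polish_space set" assumes "S \<in> sets borel" shows "souslin S"
proof -
  have "S \<in> sigma_sets UNIV {S. open S}" using assms by (simp add: borel_def)
  then have "souslin S \<and> souslin (- S)"
  proof (induction rule: sigma_sets.induct)
    case (Basic a) then show ?case by (auto intro: souslin_open souslin_closed)
  next
    case Empty show ?case by (auto intro: souslin_closed)
  next
    case (Compl a) then show ?case by (simp add: Compl_eq_Diff_UNIV[symmetric])
  next
    case (Union a)
    have "- (\<Union>i. a i) = (\<Inter>i. - a i)" by auto
    then show ?case using Union.IH souslin_UN[of a] souslin_INT[of "\<lambda>i. - a i"] by auto
  qed
  then show ?thesis ..
qed

text \<open>Refining the parametrization of a Souslin set makes a given Borel map continuous along it: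
  the \<open>k\<close>-th strand records in which ball of radius \<open>1/2^k\<close> the value lies.\<close>

lemma souslin_borel_map_parametrization:
  fixes f :: "'a::polish_space \<Rightarrow> 'b::polish_space"
  assumes S: "souslin S" and f: "f \<in> borel_measurable borel"
  shows "\<exists>F g. cyl_closed F \<and> cyl_cont F g \<and> g ` F = S \<and> cyl_cont F (\<lambda>x. f (g x))"
proof -
  obtain D :: "'b set" where D: "countable D" "\<And>U. open U \<Longrightarrow> U \<noteq> {} \<Longrightarrow> \<exists>d\<in>D. d \<in> U"
    using countable_dense_setE by blast
  define q where "q = from_nat_into D"
  have q: "\<exists>n. dist (q n) t < e" if "e > 0" for t e
  proof -
    obtain d where "d \<in> D" "d \<in> ball t e" using D(2)[of "ball t e"] \<open>e > 0\<close> by auto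
    then show ?thesis using from_nat_into_surj[OF D(1)] unfolding q_def by (metis mem_ball dist_commute)
  qed
  have "\<exists>F g. cyl_closed F \<and> cyl_cont F g \<and> g ` F = UNIV \<and>
      (\<forall>x\<in>F. \<forall>y\<in>F. x 0 = y 0 \<longrightarrow> dist (f (g x)) (f (g y)) < 2 * (1/2)^k)" for k
  proof -
    have "souslin (f -` ball (q i) ((1/2)^k))" for i
      using measurable_sets[OF f, of "ball (q i) ((1/2)^k)"] by (intro souslin_borel) auto
    then obtain F' g' where F': "\<And>i. cyl_closed (F' i)" "\<And>i. cyl_cont (F' i) (g' i)"
      "\<And>i. g' i ` F' i = f -` ball (q i) ((1/2)^k)" unfolding souslin_def by metis
    let ?U = "{x. tail x \<in> F' (x 0)}" and ?h = "\<lambda>x. g' (x 0) (tail x)"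
    have "?h ` ?U = (\<Union>i. f -` ball (q i) ((1/2)^k))" using union_parametrization(3)[of F' g', OF F'(1,2)] F'(3) by simp
    also have "\<dots> = UNIV" using q[of "(1/2)^k"] by auto
    finally have "?h ` ?U = UNIV" .
    moreover have "dist (f (?h x)) (f (?h y)) < 2 * (1/2)^k" if "x \<in> ?U" "y \<in> ?U" "x 0 = y 0" for x y
    proof -
      have "?h x \<in> f -` ball (q (x 0)) ((1/2)^k)" "?h y \<in> f -` ball (q (x 0)) ((1/2)^k)"
        using that unfolding F'(3)[symmetric] by auto
      then show ?thesis using dist_triangle3[of "f (?h x)" "f (?h y)" "q (x 0)"] by simp
    qed
    ultimately show ?thesis using union_parametrization(1,2)[of F' g', OF F'(1,2)]
      by (intro exI[of _ ?U] exI[of _ ?h]) blast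
  qed
  then obtain F1 g1 where 1: "\<And>k. cyl_closed (F1 k)" "\<And>k. cyl_cont (F1 k) (g1 k)" "\<And>k. g1 k ` F1 k = UNIV"
    "\<And>k x y. x \<in> F1 k \<Longrightarrow> y \<in> F1 k \<Longrightarrow> x 0 = y 0 \<Longrightarrow> dist (f (g1 k x)) (f (g1 k y)) < 2 * (1/2)^k"
    by metis
  obtain F0 g0 where 0: "cyl_closed F0" "cyl_cont F0 g0" "g0 ` F0 = S" using S unfolding souslin_def by blast
  \<comment> \<open>Strand 0 parametrizes \<open>S\<close>; strand \<open>Suc k\<close> parametrizes
    the whole space and names a ball of radius \<open>(1/2)^k\<close> in its first entry. Their
    intersection is again \<open>S\<close>.\<close>
  define F g where "F = case_nat F0 F1" and "g = case_nat g0 g1"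
  have Fg: "\<And>i. cyl_closed (F i)" "\<And>i. cyl_cont (F i) (g i)"
    using 0 1 by (auto simp: F_def g_def split: nat.split)
  define V where "V = {x. \<forall>i. strand i x \<in> F i \<and> g i (strand i x) = g 0 (strand 0 x)}"
  define h where "h x = g 0 (strand 0 x)" for x
  have V: "cyl_closed V" "cyl_cont V h" "h ` V = (\<Inter>i. g i ` F i)"
    using inter_parametrization[of F g, OF Fg] unfolding V_def h_def by auto
  have "(\<Inter>i. g i ` F i) = S"
  proof safe
    fix x assume "x \<in> (\<Inter>i. g i ` F i)"
    then have "x \<in> g 0 ` F 0" by blast
    then show "x \<in> S" using 0(3) by (auto simp: F_def g_def)
  next
    fix x i assume "x \<in> S"
    then show "x \<in> g i ` F i" using 0(3) 1(3) by (auto simp: F_def g_def split: nat.split)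
  qed
  moreover have "cyl_cont V (\<lambda>x. f (h x))"
    unfolding cyl_cont_def
  proof safe
    fix x and e :: real assume x: "x \<in> V" "e > 0"
    obtain k where k: "(1/2)^k < e/2" using \<open>e > 0\<close> real_arch_pow_inv[of "e/2" "1/2"] by auto
    obtain m where m: "\<forall>x y. agree m x y \<longrightarrow> agree 1 (strand (Suc k) x) (strand (Suc k) y)"
      using ex_agree_strand by blast
    have "dist (f (h x)) (f (h y)) < e" if "y \<in> V" "agree m x y" for y
    proof -
      have "strand (Suc k) x 0 = strand (Suc k) y 0" using m that(2) by (auto simp: agree_def)
      moreover have "strand (Suc k) z \<in> F1 k" "h z = g1 k (strand (Suc k) z)" if "z \<in> V" for z
        using that unfolding V_def h_def F_def g_def by (auto dest!: spec[of _ "Suc k"])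
      ultimately show ?thesis using 1(4)[of "strand (Suc k) x" k "strand (Suc k) y"] x(1) \<open>y \<in> V\<close> k by simp
    qed
    then show "\<exists>n. \<forall>y\<in>V. agree n x y \<longrightarrow> dist (f (h x)) (f (h y)) < e" by blast
  qed
  ultimately show ?thesis using V by (intro exI[of _ V] exI[of _ h]) auto
qed

lemma analytic_imp_souslin: "analytic A \<Longrightarrow> souslin (A :: 'a::metric_space set)"
proof (cases "A = {}")
  case True
  then show "souslin A" unfolding souslin_def by (intro exI[of _ "{}"]) (auto simp: cyl_closed_def cyl_cont_def)
next
  case False
  assume "analytic A"
  then obtain g :: "(nat \<Rightarrow> nat) \<Rightarrow> 'a" where "continuous_on UNIV g" "range g = A"
    using False unfolding analytic_def by blast
  then show "souslin A" unfolding souslin_def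
    using continuous_on_imp_cyl_cont[of g UNIV] by (intro exI[of _ UNIV] exI[of _ g]) (auto simp: cyl_closed_def)
qed

section \<open>A Cantor scheme inside a set of large packing dimension\<close>

lemma dimP_Un_le:
  assumes "dimP S \<le> g" "dimP T \<le> g" shows "dimP (S \<union> T) \<le> g"
proof -
  have "dimP (\<Union>b\<in>UNIV. if b then S else T) \<le> g" using assms by (intro dimP_UN_le) auto
  also have "(\<Union>b\<in>UNIV. if b then S else T) = S \<union> T" by (auto split: if_splits)
  finally show ?thesis .
qed

lemma agree_iff_map: "agree n x y \<longleftrightarrow> map y [0..<n] = map x [0..<n]"
  by (auto simp: agree_def)

text \<open>A Cantor-Bendixson kernel. There are countably many cylinders, so the deleted part still
  has image of dimension at most \<open>g\<close>, and a piece above \<open>g\<close> stays above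
  \<open>g\<close> after the deletion. This gives largeness of the cylinders of \<open>B\<close>
  itself and not merely of those of \<open>F\<close>.\<close>

lemma dimP_perfect_kernel:
  fixes W :: "(nat \<Rightarrow> nat) \<Rightarrow> 'a::metric_space"
  assumes F: "cyl_closed F" and dim: "g < dimP (W ` F)"
  shows "\<exists>B\<subseteq>F. cyl_closed B \<and> B \<noteq> {} \<and> (\<forall>x\<in>B. \<forall>n. g < dimP (W ` {y\<in>B. agree n x y}))"
proof -
  define B where "B = {x\<in>F. \<forall>n. g < dimP (W ` {y\<in>F. agree n x y})}"
  \<comment> \<open>Indexing cylinders by finite lists makes the family \<open>I\<close>
    countable.\<close>
  define C where "C s = {y\<in>F. map y [0..<length s] = s}" for s :: "nat list"
  define I where "I = {s. dimP (W ` C s) \<le> g}"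
  have cover: "F - B \<subseteq> (\<Union>s\<in>I. C s)"
  proof
    fix x assume x: "x \<in> F - B"
    then obtain n where n: "\<not> g < dimP (W ` {y\<in>F. agree n x y})" by (auto simp: B_def)
    have "{y\<in>F. agree n x y} = C (map x [0..<n])" by (auto simp: C_def agree_iff_map)
    then have "map x [0..<n] \<in> I" using n by (simp add: I_def not_less)
    moreover have "x \<in> C (map x [0..<n])" using x by (simp add: C_def)
    ultimately show "x \<in> (\<Union>s\<in>I. C s)" by blast
  qed
  have small: "dimP (\<Union>s\<in>I. W ` C s) \<le> g" by (rule dimP_UN_le) (auto simp: I_def)
  have big: "g < dimP (W ` {y\<in>B. P y})" if "g < dimP (W ` {y\<in>F. P y})" for P
  proof (rule ccontr)
    assume "\<not> ?thesis"
    then have "dimP (W ` {y\<in>B. P y} \<union> (\<Union>s\<in>I. W ` C s)) \<le> g" using small by (intro dimP_Un_le) auto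
    moreover have "dimP (W ` {y\<in>F. P y}) \<le> dimP (W ` {y\<in>B. P y} \<union> (\<Union>s\<in>I. W ` C s))"
    proof (rule dimP_mono, rule subsetI)
      fix z assume "z \<in> W ` {y\<in>F. P y}"
      then obtain y where "y \<in> F" "P y" "z = W y" by blast
      then show "z \<in> W ` {y\<in>B. P y} \<union> (\<Union>s\<in>I. W ` C s)" using cover by (cases "y \<in> B") blast+
    qed
    ultimately show False using that by simp
  qed
  have "B \<noteq> {}"
  proof
    assume "B = {}"
    then have "dimP (W ` F) \<le> dimP (\<Union>s\<in>I. W ` C s)" using cover by (intro dimP_mono) blast
    then show False using small dim by simp
  qed
  moreover have "cyl_closed B"
    unfolding cyl_closed_def
  proof safe
    fix x assume x: "\<forall>n. \<exists>y\<in>B. agree n x y"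
    then have "x \<in> F" using F unfolding cyl_closed_def B_def by blast
    moreover have "g < dimP (W ` {y\<in>F. agree n x y})" for n
    proof -
      obtain y where y: "y \<in> B" "agree n x y" using x by blast
      have "{z\<in>F. agree n x z} = {z\<in>F. agree n y z}" using y(2) agree_trans agree_sym by blast
      then show ?thesis using y(1) by (simp add: B_def)
    qed
    ultimately show "x \<in> B" by (simp add: B_def)
  qed
  moreover have "B \<subseteq> F" by (auto simp: B_def)
  moreover have "g < dimP (W ` {y\<in>B. agree n x y})" if "x \<in> B" for x n
    using that big[of "agree n x"] unfolding B_def by blast
  ultimately show ?thesis by blast
qed

lemma cyl_cont_finite_uniform:
  assumes "cyl_cont B W" "finite D" "D \<subseteq> B" "e > 0"
  shows "\<exists>n. \<forall>x\<in>D. \<forall>y\<in>B. agree n x y \<longrightarrow> dist (W x) (W y) < e"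
  using assms(2,3)
proof (induction D rule: finite_induct)
  case (insert x D)
  then obtain n where n: "\<forall>x\<in>D. \<forall>y\<in>B. agree n x y \<longrightarrow> dist (W x) (W y) < e" by blast
  obtain m where m: "\<forall>y\<in>B. agree m x y \<longrightarrow> dist (W x) (W y) < e"
    using assms(1,4) insert.prems unfolding cyl_cont_def by blast
  show ?case
  proof (intro exI ballI impI)
    fix z y assume z: "z \<in> insert x D" "y \<in> B" "agree (max n m) z y"
    then have "agree n z y" "agree m z y" by (auto intro: agree_mono)
    then show "dist (W z) (W y) < e" using n m z by blast
  qed
qed auto

text \<open>Every node gets its own scale and number of children; only the length \<open>l'\<close>
  of the next prefixes is common to all. The children are listed periodically in \<open>j\<close>,
  so that an arbitrary natural number is a legitimate choice.\<close>

lemma cantor_step: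
  fixes W :: "(nat \<Rightarrow> nat) \<Rightarrow> 'a::metric_space"
  assumes W: "cyl_cont B W" and big: "\<And>x n. x \<in> B \<Longrightarrow> ereal g < dimP (W ` {y\<in>B. agree n x y})"
    and D: "finite D" "D \<subseteq> B" and bdd: "\<And>x. x \<in> D \<Longrightarrow> bounded (W ` {y\<in>B. agree l x y})"
    and e: "e > 0"
  shows "\<exists>ch m r l'. l < l' \<and>
    (\<forall>x\<in>D. 0 < r x \<and> r x < e \<and> 0 < m x \<and> r x powr - g \<le> real (m x) \<and>
      (\<forall>j. ch x j \<in> B \<and> agree l x (ch x j) \<and> ch x j = ch x (j mod m x) \<and>
         bounded (W ` {y\<in>B. agree l' (ch x j) y})) \<and>
      (\<forall>i<m x. \<forall>j<m x. i \<noteq> j \<longrightarrow> (\<forall>y\<in>B. \<forall>z\<in>B. agree l' (ch x i) y \<longrightarrow> agree l' (ch x j) z \<longrightarrow>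
         r x / 2 < dist (W y) (W z))))"
proof -
  define split where "split x r m ch \<longleftrightarrow> 0 < r \<and> r < e \<and> 0 < m \<and> r powr - g \<le> real m \<and>
      (\<forall>j. ch j \<in> B \<and> agree l x (ch j) \<and> ch j = ch (j mod m)) \<and>
      (\<forall>i<m. \<forall>j<m. i \<noteq> j \<longrightarrow> r < dist (W (ch i)) (W (ch j)))" for x r m ch
  have "\<exists>r m ch. split x r m ch" if "x \<in> D" for x
  proof -
    have "x \<in> B" using that D by blast
    \<comment> \<open>Boundedness of the image enters here: \<open>dimP\<close> admits only covers
      by bounded sets.\<close>
    then have "ereal g < upper_box_dim (W ` {y\<in>B. agree l x y})"
      using less_le_trans[OF big dimP_le_upper_box_dim[OF bdd[OF that]]] by blast
    moreover have "W ` {y\<in>B. agree l x y} \<noteq> {}" using \<open>x \<in> B\<close> by force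
    ultimately obtain r S where S: "0 < r" "r < e" "S \<subseteq> W ` {y\<in>B. agree l x y}" "finite S" "S \<noteq> {}"
      "pairwise (\<lambda>x y. r < dist x y) S" "r powr - g \<le> card S"
      using separated_subset_of_upper_box_dim[of g "W ` {y\<in>B. agree l x y}" e] e by blast
    obtain b where b: "bij_betw b {0..<card S} S" using ex_bij_betw_nat_finite[OF S(4)] by blast
    have "\<forall>s\<in>S. \<exists>y. y \<in> B \<and> agree l x y \<and> W y = s" using S(3) by blast
    then obtain p where p: "\<And>s. s \<in> S \<Longrightarrow> p s \<in> B \<and> agree l x (p s) \<and> W (p s) = s" by metis
    have m: "0 < card S" using S(4,5) by (simp add: card_gt_0_iff)
    have bS: "b (j mod card S) \<in> S" for j using bij_betwE[OF b] m by simp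
    have "r < dist (W (p (b (i mod card S)))) (W (p (b (j mod card S))))" if "i < card S" "j < card S" "i \<noteq> j" for i j
    proof -
      have "b i \<in> S" "b j \<in> S" using bij_betwE[OF b] that by simp_all
      moreover have "b i \<noteq> b j" using inj_onD[OF bij_betw_imp_inj_on[OF b]] that by auto
      ultimately show ?thesis using pairwiseD[OF S(6)] p that by simp
    qed
    then show ?thesis using S m p[OF bS] unfolding split_def
      by (intro exI[of _ r] exI[of _ "card S"] exI[of _ "\<lambda>j. p (b (j mod card S))"]) auto
  qed
  then obtain r m ch where sp: "\<And>x. x \<in> D \<Longrightarrow> split x (r x) (m x) (ch x)" by metis
  note sp' = sp[unfolded split_def]
  have 1: "0 < r x \<and> r x < e \<and> 0 < m x \<and> r x powr - g \<le> real (m x)"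
      "ch x j \<in> B \<and> agree l x (ch x j)" "ch x j = ch x (j mod m x)" if "x \<in> D" for x j
    using sp'[OF that] by meson+
  have 2: "r x < dist (W (ch x i)) (W (ch x j))" if "x \<in> D" "i < m x" "j < m x" "i \<noteq> j" for x i j
    using sp'[OF that(1), THEN conjunct2, THEN conjunct2, THEN conjunct2, THEN conjunct2, THEN conjunct2] that(2-4) by blast
  define D' where "D' = (\<Union>x\<in>D. ch x ` {..<m x})"
  have D': "finite D'" "D' \<subseteq> B" using D 1(2) by (auto simp: D'_def)
  \<comment> \<open>A quarter of the smallest separation: both points of a pair move by less than
    \<open>r x / 4\<close>, which leaves more than \<open>r x / 2\<close>. The 1 covers the case of
    empty \<open>D\<close>.\<close>
  define e' where "e' = Min (insert 1 (r ` D)) / 4"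
  have "e' > 0" unfolding e'_def using D(1) 1(1) by (auto simp: Min_gr_iff)
  have e'r: "e' \<le> r x / 4" if "x \<in> D" for x unfolding e'_def using D(1) that by (auto intro!: Min_le)
  obtain n where n: "\<forall>x\<in>D'. \<forall>y\<in>B. agree n x y \<longrightarrow> dist (W x) (W y) < e'"
    using cyl_cont_finite_uniform[OF W D' \<open>e' > 0\<close>] by blast
  \<comment> \<open>The term \<open>Suc l\<close> forces the prefixes to grow, so that level
    \<open>k\<close> fixes at least \<open>k\<close> entries in the iterated construction.\<close>
  define l' where "l' = max n (Suc l)"
  have near: "dist (W (ch x j)) (W y) < e'" if "x \<in> D" "y \<in> B" "agree l' (ch x j) y" for x j y
  proof -
    have "ch x (j mod m x) \<in> D'" unfolding D'_def using 1(1)[OF that(1)] by (intro UN_I[OF that(1)]) simp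
    then have "ch x j \<in> D'" using 1(3)[OF that(1)] by metis
    then show ?thesis using n that agree_mono[OF that(3), of n] by (auto simp: l'_def)
  qed
  have "bounded (W ` {y\<in>B. agree l' (ch x j) y})" if "x \<in> D" for x j
    unfolding bounded_def using near[OF that] by (force intro: less_imp_le)
  moreover have "r x / 2 < dist (W y) (W z)" if "x \<in> D" "i < m x" "j < m x" "i \<noteq> j" "y \<in> B" "z \<in> B"
     "agree l' (ch x i) y" "agree l' (ch x j) z" for x i j y z
    using near[OF that(1,5,7)] near[OF that(1,6,8)] 2[OF that(1-4)] e'r[OF that(1)]
      dist_triangle[of "W (ch x i)" "W (ch x j)" "W y"] dist_triangle[of "W y" "W (ch x j)" "W z"]
      dist_commute[of "W z" "W (ch x j)"] by linarith
  moreover have "l < l'" by (simp add: l'_def)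
  ultimately show ?thesis using 1
    by (intro exI[of _ ch] exI[of _ m] exI[of _ r] exI[of _ l'] conjI ballI allI impI) blast+
qed

text \<open>Iterating the step turns every sequence of choices \<open>c\<close> into a point
  \<open>H c\<close>. The last clause is what the measure will use: being close to
  \<open>W (H c)\<close> at the scale of its level \<open>k\<close> node determines one choice up to
  a residue. The bound \<open>N k\<close> holds because each level has finitely many nodes.\<close>

lemma cantor_scheme:
  fixes W :: "(nat \<Rightarrow> nat) \<Rightarrow> 'a::metric_space"
  assumes F: "cyl_closed F" and W: "cyl_cont F W" and dim: "ereal g < dimP (W ` F)"
  shows "\<exists>H m r N. (\<forall>c. H c \<in> F) \<and> (\<forall>n c c'. agree n c c' \<longrightarrow> agree n (H c) (H c')) \<and>
    (\<forall>k c. 0 < m k c \<and> m k c \<le> N k \<and> 0 < r k c \<and> r k c < inverse (Suc k) \<and> r k c powr - g \<le> real (m k c) \<and>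
      (\<forall>c'. dist (W (H c')) (W (H c)) \<le> r k c / 4 \<longrightarrow> c' k mod m k c = c k mod m k c))"
proof -
  obtain B where B: "B \<subseteq> F" "cyl_closed B" "B \<noteq> {}" and
    big: "\<And>x n. x \<in> B \<Longrightarrow> ereal g < dimP (W ` {y\<in>B. agree n x y})"
    using dimP_perfect_kernel[OF F dim] by blast
  have WB: "cyl_cont B W" using W B(1) by (rule cyl_cont_subset)
  obtain x0 where x0: "x0 \<in> B" using B(3) by blast
  obtain l0 where "\<forall>x\<in>{x0}. \<forall>y\<in>B. agree l0 x y \<longrightarrow> dist (W x) (W y) < 1"
    using cyl_cont_finite_uniform[OF WB, of "{x0}" 1] x0 by auto
  then have bdd0: "bounded (W ` {y\<in>B. agree l0 x0 y})" unfolding bounded_def by (force intro: less_imp_le)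
  \<comment> \<open>The number \<open>d\<close> is a gap between the images of different cylinders
    of the level. The next radii are kept below \<open>d / 2\<close>, so a ball at the next scale
    cannot meet the images of two nodes.\<close>
  define inv where "inv = (\<lambda>k D l (d::real). finite D \<and> D \<subseteq> B \<and> 0 < d \<and> k \<le> l \<and>
     (\<forall>x\<in>D. bounded (W ` {y\<in>B. agree l x y})) \<and>
     (\<forall>x\<in>D. \<forall>x'\<in>D. x \<noteq> x' \<longrightarrow> (\<forall>y\<in>B. \<forall>y'\<in>B. agree l x y \<longrightarrow> agree l x' y' \<longrightarrow> d \<le> dist (W y) (W y'))))"
  define good where "good = (\<lambda>k D l d l' ch m r. l < l' \<and> (\<forall>x\<in>D. 0 < r x \<and> r x < min (inverse (Suc k)) (d / 2) \<and> 0 < m x \<and>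
      r x powr - g \<le> real (m x) \<and>
      (\<forall>j. ch x j \<in> B \<and> agree l x (ch x j) \<and> ch x j = ch x (j mod m x) \<and>
         bounded (W ` {y\<in>B. agree l' (ch x j) y})) \<and>
      (\<forall>i<m x. \<forall>j<m x. i \<noteq> j \<longrightarrow> (\<forall>y\<in>B. \<forall>z\<in>B. agree l' (ch x i) y \<longrightarrow> agree l' (ch x j) z \<longrightarrow>
         r x / 2 < dist (W y) (W z)))))"
  have goodD: "l < l'"
      "\<And>x. x \<in> D \<Longrightarrow> 0 < r x \<and> r x < inverse (Suc k) \<and> 2 * r x < d \<and> 0 < m x \<and> r x powr - g \<le> real (m x)"
      "\<And>x j. x \<in> D \<Longrightarrow> ch x j \<in> B \<and> agree l x (ch x j) \<and> bounded (W ` {y\<in>B. agree l' (ch x j) y})"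
      "\<And>x j. x \<in> D \<Longrightarrow> ch x j = ch x (j mod m x)"
      "\<And>x i j y z. x \<in> D \<Longrightarrow> i < m x \<Longrightarrow> j < m x \<Longrightarrow> i \<noteq> j \<Longrightarrow> y \<in> B \<Longrightarrow> z \<in> B \<Longrightarrow>
        agree l' (ch x i) y \<Longrightarrow> agree l' (ch x j) z \<Longrightarrow> r x / 2 < dist (W y) (W z)"
    if g: "good k D l d l' ch m r" for k D l d l' ch m r
  proof -
    note g' = g[unfolded good_def]
    show "l < l'" using g' by (rule conjunct1)
    note g2 = bspec[OF conjunct2[OF g']]
    show "0 < r x \<and> r x < inverse (Suc k) \<and> 2 * r x < d \<and> 0 < m x \<and> r x powr - g \<le> real (m x)" if "x \<in> D" for x
    proof -
      have "0 < r x" "r x < min (inverse (Suc k)) (d / 2)" "0 < m x" "r x powr - g \<le> real (m x)"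
        using g2[OF that] by meson+
      then show ?thesis by auto
    qed
    show "ch x j \<in> B \<and> agree l x (ch x j) \<and> bounded (W ` {y\<in>B. agree l' (ch x j) y})" if "x \<in> D" for x j
      using g2[OF that] by meson
    show "ch x j = ch x (j mod m x)" if "x \<in> D" for x j
      using g2[OF that] by meson
    show "r x / 2 < dist (W y) (W z)" if "x \<in> D" "i < m x" "j < m x" "i \<noteq> j" "y \<in> B" "z \<in> B"
        "agree l' (ch x i) y" "agree l' (ch x j) z" for x i j y z
      using g2[OF that(1), THEN conjunct2, THEN conjunct2, THEN conjunct2, THEN conjunct2, THEN conjunct2] that(2-8) by blast
  qed
  have invD: "finite D" "D \<subseteq> B" "0 < d" "k \<le> l" "\<And>x. x \<in> D \<Longrightarrow> bounded (W ` {y\<in>B. agree l x y})"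
      "\<And>x x' y y'. x \<in> D \<Longrightarrow> x' \<in> D \<Longrightarrow> x \<noteq> x' \<Longrightarrow> y \<in> B \<Longrightarrow> y' \<in> B \<Longrightarrow> agree l x y \<Longrightarrow> agree l x' y'
        \<Longrightarrow> d \<le> dist (W y) (W y')"
    if "inv k D l d" for k D l d
    using that unfolding inv_def by auto
  define P where "P = (\<lambda>k (D, l, d). inv k D l d \<and> (k = 0 \<longrightarrow> D = {x0}))"
  define Q where "Q = (\<lambda>k (D, l, d) (D', l', d'::real). \<exists>ch m r. good k D l d l' ch m r \<and> D' = (\<Union>x\<in>D. range (ch x)))"
  have "\<exists>\<sigma>. \<forall>k. P k (\<sigma> k) \<and> Q k (\<sigma> k) (\<sigma> (Suc k))"
  proof (rule dependent_nat_choice)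
    show "\<exists>s. P 0 s" using x0 bdd0
      by (intro exI[of _ "({x0}, l0, 1)"]) (auto simp: P_def inv_def)
  next
    fix s k assume "P k s"
    then obtain D l d where s: "s = (D, l, d)" and inv: "inv k D l d" by (cases s) (auto simp: P_def)
    note D = invD(1-5)[OF inv] and sep = invD(6)[OF inv]
    have "0 < min (inverse (real (Suc k))) (d / 2)" using D(3) by simp
    then have "\<exists>ch m r l'. good k D l d l' ch m r" unfolding good_def
      using cantor_step[of B W g D l "min (inverse (real (Suc k))) (d / 2)", OF WB big D(1,2,5)] by blast
    then obtain ch m r l' where good: "good k D l d l' ch m r" by blast
    note g = goodD[OF good]
    \<comment> \<open>Descendants of different nodes keep the old gap, siblings are separated by
      half their radius.\<close>
    define d' where "d' = Min (insert d ((\<lambda>x. r x / 2) ` D))"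
    have "0 < d'" using D(1,3) g(2) unfolding d'_def by (auto simp: Min_gr_iff)
    have d': "d' \<le> d" "\<And>x. x \<in> D \<Longrightarrow> d' \<le> r x / 2"
      unfolding d'_def by (rule Min_le; use D(1) in blast)+
    define D' where "D' = (\<Union>x\<in>D. range (ch x))"
    have "range (ch x) \<subseteq> ch x ` {..<m x}" if xD: "x \<in> D" for x
    proof
      fix y assume "y \<in> range (ch x)"
      then obtain j where "y = ch x (j mod m x)" using g(4)[OF xD] by blast
      moreover have "j mod m x < m x" using g(2)[OF xD] by simp
      ultimately show "y \<in> ch x ` {..<m x}" by blast
    qed
    then have "finite (range (ch x))" if "x \<in> D" for x using that by (meson finite_imageI finite_lessThan finite_subset)
    then have "finite D'" unfolding D'_def using D(1) by blast
    moreover have "D' \<subseteq> B" "\<forall>x\<in>D'. bounded (W ` {y\<in>B. agree l' x y})" "Suc k \<le> l'"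
      using g(1,3) D(4) unfolding D'_def by auto
    moreover have "d' \<le> dist (W y) (W y')" if z: "z \<in> D'" "z' \<in> D'" "z \<noteq> z'" "y \<in> B" "y' \<in> B"
      "agree l' z y" "agree l' z' y'" for z z' y y'
    proof -
      obtain x j x' j' where x: "x \<in> D" "z = ch x j" "x' \<in> D" "z' = ch x' j'" using z(1,2) by (auto simp: D'_def)
      have "l \<le> l'" "agree l x z" "agree l x' z'" using g(1,3) x by auto
      then have a: "agree l x y" "agree l x' y'" using z(6,7) agree_trans agree_mono by meson+
      show ?thesis
      proof (cases "x = x'")
        case False
        then show ?thesis using sep[OF x(1,3) False z(4,5) a] d'(1) by linarith
      next
        case True
        have c: "ch x j = ch x (j mod m x)" "ch x j' = ch x (j' mod m x)" "0 < m x"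
          using g(2,4)[OF x(1)] by blast+
        then have "j mod m x \<noteq> j' mod m x" using x True z(3) by metis
        moreover have "j mod m x < m x" "j' mod m x < m x" using c(3) by auto
        moreover have "agree l' (ch x (j mod m x)) y" "agree l' (ch x (j' mod m x)) y'" using z(6,7) x True c(1,2) by metis+
        ultimately have "r x / 2 < dist (W y) (W y')" using g(5)[OF x(1)] z(4,5) by blast
        then show ?thesis using d'(2)[OF x(1)] by linarith
      qed
    qed
    ultimately have "inv (Suc k) D' l' d'" using \<open>0 < d'\<close> unfolding inv_def by blast
    then show "\<exists>s'. P (Suc k) s' \<and> Q k s s'"
      using good by (intro exI[of _ "(D', l', d')"]) (auto simp: P_def Q_def s D'_def)
  qed
  then obtain \<sigma> where \<sigma>: "\<And>k. P k (\<sigma> k)" "\<And>k. Q k (\<sigma> k) (\<sigma> (Suc k))" by blast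
  define D l d where "D k = fst (\<sigma> k)" and "l k = fst (snd (\<sigma> k))" and "d k = snd (snd (\<sigma> k))" for k
  have inv: "inv k (D k) (l k) (d k)" and D0: "D 0 = {x0}" for k
    using \<sigma>(1)[of k] \<sigma>(1)[of 0] unfolding D_def l_def d_def P_def by (auto split: prod.splits)
  have "\<exists>ch m r. good k (D k) (l k) (d k) (l (Suc k)) ch m r \<and> D (Suc k) = (\<Union>x\<in>D k. range (ch x))" for k
    using \<sigma>(2)[of k] unfolding Q_def D_def l_def d_def by (auto split: prod.splits)
  then obtain ch m r where good: "\<And>k. good k (D k) (l k) (d k) (l (Suc k)) (ch k) (m k) (r k)"
    and DSuc: "\<And>k. D (Suc k) = (\<Union>x\<in>D k. range (ch k x))" by metis
  define X where "X c = rec_nat x0 (\<lambda>k x. ch k x (c k))" for c :: "nat \<Rightarrow> nat"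
  have X0: "X c 0 = x0" and XS: "X c (Suc k) = ch k (X c k) (c k)" for c k by (simp_all add: X_def)
  have XD: "X c k \<in> D k" for c k by (induction k) (auto simp: X0 XS D0 DSuc)
  have lS: "l k < l (Suc k)" and kl: "k \<le> l k" and DB: "D k \<subseteq> B" and finD: "finite (D k)" for k
    using goodD(1)[OF good[of k]] invD(1,2,4)[OF inv[of k]] by auto
  have lmono: "l j \<le> l k" if "j \<le> k" for j k using lift_Suc_mono_le[of l j k] lS that by (simp add: less_imp_le)
  have Xagree: "agree (l j) (X c j) (X c (j + i))" for c i j
  proof (induction i)
    case (Suc i)
    have "agree (l (j+i)) (X c (j+i)) (X c (Suc (j+i)))"
      using goodD(3)[OF good[of "j+i"] XD[of c "j+i"]] unfolding XS by blast
    then have "agree (l j) (X c (j+i)) (X c (Suc (j+i)))" by (rule agree_mono) (simp add: lmono)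
    then show ?case using agree_trans[OF Suc.IH] by simp
  qed simp
  \<comment> \<open>The branch is read off diagonally: node \<open>Suc i\<close> has a final prefix
    of length \<open>l (Suc i) \<ge> Suc i\<close>, which contains entry \<open>i\<close>.\<close>
  define H where "H c i = X c (Suc i) i" for c i
  have XH: "agree (l k) (X c k) (H c)" for k c
    unfolding agree_def
  proof (intro allI impI)
    fix i assume i: "i < l k"
    show "X c k i = H c i"
    proof (cases "k \<le> Suc i")
      case True
      then show ?thesis using Xagree[of k c "Suc i - k"] i by (simp add: agree_def H_def)
    next
      case False
      then show ?thesis using Xagree[of "Suc i" c "k - Suc i"] kl[of "Suc i"] by (simp add: agree_def H_def)
    qed
  qed
  have HB: "H c \<in> B" for c
  proof -
    have "\<exists>y\<in>B. agree n (H c) y" for n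
      using XD DB XH[of n c] kl agree_mono agree_sym by (metis subsetD)
    then show ?thesis using B(2) unfolding cyl_closed_def by blast
  qed
  have Xcong: "X c k = X c' k" if "agree k c c'" for c c' k
    using that by (induction k) (auto simp: X0 XS agree_def)
  have Hcont: "agree n (H c) (H c')" if "agree n c c'" for n c c'
    using XH[of n c] XH[of n c'] Xcong[OF that] agree_mono[OF _ kl[of n]] agree_trans agree_sym by metis
  have key: "c' k mod m k (X c k) = c k mod m k (X c k)"
    if "dist (W (H c')) (W (H c)) \<le> r k (X c k) / 4" for k c c'
  proof -
    have r: "0 < r k (X c k)" "2 * r k (X c k) < d k" "0 < m k (X c k)"
      using goodD(2)[OF good[of k] XD[of c k]] by auto
    \<comment> \<open>A distance of at most \<open>r / 4\<close> is below the gap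
      \<open>d k\<close>, so both branches pass through the same node; the separation of siblings
      then decides the choice made there.\<close>
    have same: "X c' k = X c k"
    proof (rule ccontr)
      assume "X c' k \<noteq> X c k"
      then have "d k \<le> dist (W (H c')) (W (H c))" using invD(6)[OF inv[of k] XD XD _ HB HB XH XH] by blast
      then show False using r that by linarith
    qed
    show ?thesis
    proof (rule ccontr)
      assume ne: "\<not> ?thesis"
      let ?x = "X c k" and ?m = "m k (X c k)"
      have "agree (l (Suc k)) (ch k ?x (c' k mod ?m)) (H c')" "agree (l (Suc k)) (ch k ?x (c k mod ?m)) (H c)"
        using XH[of "Suc k" c'] XH[of "Suc k" c] goodD(4)[OF good[of k] XD[of c k]] unfolding XS same by metis+
      moreover have "c' k mod ?m < ?m" "c k mod ?m < ?m" using r by auto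
      ultimately have "r k ?x / 2 < dist (W (H c')) (W (H c))"
        using goodD(5)[OF good[of k] XD[of c k] _ _ ne HB HB] by blast
      then show False using that r by linarith
    qed
  qed
  have "m k (X c k) \<le> Max (m k ` D k)" for k c using finD XD by (intro Max_ge) auto
  moreover have "0 < m k (X c k)" "0 < r k (X c k)" "r k (X c k) < inverse (Suc k)"
    "r k (X c k) powr - g \<le> real (m k (X c k))" for k c
    using goodD(2)[OF good[of k] XD[of c k]] by auto
  ultimately show ?thesis using HB B(1) Hcont key
    by (intro exI[of _ H] exI[of _ "\<lambda>k c. m k (X c k)"] exI[of _ "\<lambda>k c. r k (X c k)"] exI[of _ "\<lambda>k. Max (m k ` D k)"]) blast
qed

section \<open>The product measure on sequences of choices\<close>

lemma compact_bounded_sequences: "compact {c :: nat \<Rightarrow> nat. \<forall>k. c k < N k}"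
proof -
  have "compactin (product_topology (\<lambda>_. euclidean) UNIV) (Pi\<^sub>E UNIV (\<lambda>k. {..<N k}))"
    by (auto simp: compactin_PiE compactin_euclidean_iff finite_imp_compact)
  then have "compact (Pi\<^sub>E UNIV (\<lambda>k. {..<N k}))"
    unfolding euclidean_product_topology compactin_euclidean_iff .
  moreover have "Pi\<^sub>E UNIV (\<lambda>k. {..<N k}) = {c. \<forall>k. c k < N k}" by (auto simp: PiE_UNIV_domain)
  ultimately show ?thesis by simp
qed

lemma closed_bounded_sequences: "closed {c :: nat \<Rightarrow> nat. \<forall>k. c k < N k}"
proof -
  have "closed (\<Inter>k. (\<lambda>c :: nat \<Rightarrow> nat. c k) -` {..<N k})"
    by (intro closed_INT ballI closed_vimage continuous_on_product_coordinates)
      (simp add: closed_def discrete_topology_class.open_discrete)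
  moreover have "(\<Inter>k. (\<lambda>c :: nat \<Rightarrow> nat. c k) -` {..<N k}) = {c. \<forall>k. c k < N k}" by auto
  ultimately show ?thesis by simp
qed

lemma card_mod_class_le: "card {i. i < N \<and> i mod m = j} \<le> N div m + 1" if "0 < m" for N m j :: nat
proof -
  have "card {i. i < N \<and> i mod m = j} \<le> card {..N div m}"
  proof (rule card_inj_on_le)
    show "inj_on (\<lambda>i. i div m) {i. i < N \<and> i mod m = j}"
      by (intro inj_onI) (metis (mono_tags) div_mult_mod_eq mem_Collect_eq)
    show "(\<lambda>i. i div m) ` {i. i < N \<and> i mod m = j} \<subseteq> {..N div m}" by (auto intro: div_le_mono)
  qed auto
  then show ?thesis by simp
qed

lemma cyl_cont_compose_agree:
  assumes h: "cyl_cont F h" and H: "\<And>c. H c \<in> F" "\<And>n c c'. agree n c c' \<Longrightarrow> agree n (H c) (H c')"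
  shows "continuous_on UNIV (\<lambda>c. h (H c))"
proof (rule cyl_cont_imp_continuous_on)
  show "cyl_cont UNIV (\<lambda>c. h (H c))" unfolding cyl_cont_def
  proof safe
    fix c and e :: real assume "e > 0"
    then obtain n where "\<forall>y\<in>F. agree n (H c) y \<longrightarrow> dist (h (H c)) (h y) < e"
      using h H(1)[of c] unfolding cyl_cont_def by blast
    then show "\<exists>n. \<forall>y\<in>UNIV. agree n c y \<longrightarrow> dist (h (H c)) (h (H y)) < e" using H by blast
  qed
qed

text \<open>The \<open>k\<close>-th choice is a uniform number taken modulo the number of children of the current node; a whole ball
  at the scale of that node then fixes one residue of a single coordinate, so no product of masses along the tree is needed.\<close>

lemma cantor_measure:
  fixes G :: "(nat \<Rightarrow> nat) \<Rightarrow> 'a::metric_space" and W :: "(nat \<Rightarrow> nat) \<Rightarrow> 'b::metric_space"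
  assumes F: "cyl_closed F" and G: "cyl_cont F G" and W: "cyl_cont F W" and dim: "ereal g < dimP (W ` F)"
  shows "\<exists>(P :: (nat \<Rightarrow> nat) measure) H K. prob_space P \<and> sets P = sets borel \<and> compact K \<and> closed K \<and> (AE c in P. c \<in> K) \<and> (\<forall>c. H c \<in> F) \<and>
    continuous_on UNIV (\<lambda>c. G (H c)) \<and> continuous_on UNIV (\<lambda>c. W (H c)) \<and>
    (\<forall>c. \<forall>e>0. \<exists>r. 0 < r \<and> r < e \<and> measure P {c'. dist (W (H c')) (W (H c)) \<le> r / 4} \<le> 2 * r powr g)"
proof -
  obtain H m r N where H: "\<And>c. H c \<in> F" "\<And>n c c'. agree n c c' \<Longrightarrow> agree n (H c) (H c')"
    and m: "\<And>k c. 0 < m k c" "\<And>k c. m k c \<le> N k" and r: "\<And>k c. 0 < r k c" "\<And>k c. r k c < inverse (Suc k)"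
      "\<And>k c. r k c powr - g \<le> real (m k c)"
    and key: "\<And>k c c'. dist (W (H c')) (W (H c)) \<le> r k c / 4 \<Longrightarrow> c' k mod m k c = c k mod m k c"
    using cantor_scheme[OF F W dim] by metis
  have N: "0 < N k" for k using m(1,2) less_le_trans by blast
  define p where "p k = measure_pmf (pmf_of_set {..<N k})" for k
  define P where "P = Pi\<^sub>M UNIV p"
  interpret product_prob_space p UNIV
    unfolding product_prob_space_def product_prob_space_axioms_def product_sigma_finite_def p_def
    by (auto intro: measure_pmf.prob_space_axioms prob_space_imp_sigma_finite)
  have setsp: "sets (p k) = sets borel" for k unfolding p_def
    by (simp add: sets_borel_eq_count_space)
  have sets: "sets P = sets borel"
    unfolding P_def by (subst sets_PiM_cong[OF refl setsp]) (rule sets_PiM_equal_borel)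
  have "prob_space P" unfolding P_def by (rule P.prob_space_axioms)
  then interpret PP: prob_space P .
  have spaceP: "space P = UNIV" using sets_eq_imp_space_eq[OF sets] by simp
  \<comment> \<open>A compact set that carries \<open>P\<close>; its continuous image will confine
    the support of the image measure.\<close>
  define K where "K = {c :: nat \<Rightarrow> nat. \<forall>k. c k < N k}"
  have "AE c in P. c k < N k" for k
  proof -
    have "AE i in p k. i < N k" unfolding p_def using N[of k] by (subst AE_measure_pmf_iff) (auto simp: set_pmf_of_set lessThan_empty_iff)
    then show ?thesis unfolding P_def by (intro AE_component) auto
  qed
  then have "AE c in P. c \<in> K" unfolding K_def by (simp add: AE_all_countable)
  moreover have "continuous_on UNIV (\<lambda>c. G (H c))" "continuous_on UNIV (\<lambda>c. W (H c))"
    using G W H by (auto intro: cyl_cont_compose_agree)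
  moreover have "\<exists>r. 0 < r \<and> r < e \<and> PP.prob {c'. dist (W (H c')) (W (H c)) \<le> r / 4} \<le> 2 * r powr g"
    if "e > 0" for e c
  proof -
    obtain k where k: "inverse (real (Suc k)) < e" using reals_Archimedean[OF \<open>e > 0\<close>] by blast
    let ?m = "m k c" and ?r = "r k c"
    let ?S = "{i. i mod ?m = c k mod ?m}"
    have ev: "{c'\<in>space P. c' k \<in> ?S} \<in> sets P"
    proof -
      have "(\<lambda>c'. c' k) \<in> measurable P (p k)" unfolding P_def by (rule measurable_component_singleton) simp
      then show ?thesis using measurable_sets[of "\<lambda>c'. c' k" P "p k" ?S] by (simp add: p_def vimage_def Int_def conj_commute)
    qed
    have "PP.prob {c'. dist (W (H c')) (W (H c)) \<le> ?r / 4} \<le> PP.prob {c'\<in>space P. c' k \<in> ?S}"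
      using key[where k=k and c=c] ev by (intro PP.finite_measure_mono) (auto simp: spaceP)
    also have "\<dots> = measure (p k) ?S"
      unfolding P_def measure_def by (subst emeasure_PiM_Collect_single) (auto simp: p_def)
    also have "\<dots> = card ({..<N k} \<inter> ?S) / card {..<N k}"
      unfolding p_def using N[of k] by (subst measure_pmf_of_set) (auto simp: lessThan_empty_iff Int_commute)
    also have "{..<N k} \<inter> ?S = {i. i < N k \<and> i mod ?m = c k mod ?m}" by auto
    also have "real (card {i. i < N k \<and> i mod ?m = c k mod ?m}) / card {..<N k} \<le> (2 * real (N k) / ?m) / N k"
    proof -
      have "real (card {i. i < N k \<and> i mod ?m = c k mod ?m}) \<le> real (N k div ?m) + 1"
        using card_mod_class_le[OF m(1)[of k c], of "N k" "c k mod ?m"] by linarith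
      \<comment> \<open>The incomplete last block contributes at most 1, which
        \<open>m k c \<le> N k\<close> absorbs at the price of the factor 2.\<close>
      also have "\<dots> \<le> real (N k) / ?m + real (N k) / ?m"
        using m(1)[of k c] m(2)[of k c] by (intro add_mono of_nat_div_le_of_nat) (auto simp: field_simps)
      finally have "real (card {i. i < N k \<and> i mod ?m = c k mod ?m}) \<le> 2 * real (N k) / ?m" by simp
      from divide_right_mono[OF this, of "real (N k)"] show ?thesis by simp
    qed
    also have "\<dots> = 2 / ?m" using N[of k] by simp
    also have "\<dots> \<le> 2 / (?r powr - g)" using r(1,3)[of k c] by (intro divide_left_mono) (auto intro!: mult_pos_pos simp: m)
    also have "\<dots> = 2 * ?r powr g" by (simp add: powr_minus field_simps)
    finally show ?thesis using r(1,2)[of k c] k by (intro exI[of _ ?r]) auto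
  qed
  moreover have "compact K" "closed K" unfolding K_def
    by (rule compact_bounded_sequences, rule closed_bounded_sequences)
  ultimately show ?thesis using sets \<open>prob_space P\<close> H(1)
    by (intro exI[of _ P] exI[of _ H] exI[of _ K] conjI allI impI) blast+
qed

section \<open>Ball masses and the product kernel\<close>

text \<open>Comparable to the product of \<open>min 1 (r / \<bar>(x - y) \<bullet> b\<bar>)\<close>, but without the junk value of the division
  on the hyperplanes \<open>(x - y) \<bullet> b = 0\<close>.\<close>

definition prod_kernel :: "real \<Rightarrow> 'b::euclidean_space \<Rightarrow> 'b \<Rightarrow> real" where
  "prod_kernel r x y = (\<Prod>b\<in>Basis. r / (r + \<bar>(x - y) \<bullet> b\<bar>))"

lemma harm_le_ln: "harm (Suc n) \<le> 1 + ln (real (Suc n))"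
proof (induction n)
  case (Suc n)
  have "ln (real (Suc n) / real (Suc (Suc n))) \<le> real (Suc n) / real (Suc (Suc n)) - 1"
    by (rule ln_le_minus_one) simp
  also have "\<dots> = - inverse (real (Suc (Suc n)))" by (simp add: field_simps)
  finally have "inverse (real (Suc (Suc n))) \<le> ln (real (Suc (Suc n))) - ln (real (Suc n))"
    by (subst (asm) ln_div) auto
  then show ?case using Suc unfolding harm_Suc[of "Suc n"] by simp
qed (simp add: harm_Suc harm_def)

text \<open>On either side of \<open>a\<close> the distances to the integers are at least 0, 1, 2,
  ..., so each side is dominated by a harmonic number.\<close>

lemma sum_inverse_dist_int_le:
  fixes a :: real and L :: nat
  assumes "\<bar>a\<bar> \<le> L"
  shows "(\<Sum>j\<in>{- int L..int L}. 1 / (1 + \<bar>of_int j - a\<bar>)) \<le> 2 * harm (2 * L + 1)"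
proof -
  let ?j = "\<lfloor>a\<rfloor>" and ?t = "\<lambda>j::int. 1 / (1 + \<bar>of_int j - a\<bar>)"
  have j: "- int L \<le> ?j" "?j \<le> int L" using assms by (auto simp: le_floor_iff floor_le_iff abs_le_iff)
  have harm: "harm (2 * L + 1) = (\<Sum>i<2*L+1. 1 / (1 + real i))" by (simp add: harm_altdef field_simps)
  have low: "(\<Sum>j\<in>{- int L..?j}. ?t j) \<le> harm (2 * L + 1)"
  proof -
    have "(\<Sum>j\<in>{- int L..?j}. ?t j) \<le> (\<Sum>j\<in>{- int L..?j}. 1 / (1 + real (nat (?j - j))))"
      by (intro sum_mono divide_left_mono) (auto, linarith)
    also have "\<dots> = (\<Sum>i\<in>(\<lambda>j. nat (?j - j)) ` {- int L..?j}. 1 / (1 + real i))"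
      by (subst sum.reindex) (auto simp: inj_on_def)
    also have "\<dots> \<le> harm (2 * L + 1)" unfolding harm using j by (intro sum_mono2) auto
    finally show ?thesis .
  qed
  have high: "(\<Sum>j\<in>{?j<..int L}. ?t j) \<le> harm (2 * L + 1)"
  proof -
    \<comment> \<open>To the right, \<open>a\<close> may lie just below \<open>?j + 1\<close>, hence
      the shift by one.\<close>
    have "(\<Sum>j\<in>{?j<..int L}. ?t j) \<le> (\<Sum>j\<in>{?j<..int L}. 1 / (1 + real (nat (j - ?j - 1))))"
      by (intro sum_mono divide_left_mono) (auto, linarith)
    also have "\<dots> = (\<Sum>i\<in>(\<lambda>j. nat (j - ?j - 1)) ` {?j<..int L}. 1 / (1 + real i))"
      by (subst sum.reindex) (auto simp: inj_on_def)
    also have "\<dots> \<le> harm (2 * L + 1)" unfolding harm using j by (intro sum_mono2) auto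
    finally show ?thesis .
  qed
  have "{- int L..int L} = {- int L..?j} \<union> {?j<..int L}" using j by auto
  then have "(\<Sum>j\<in>{- int L..int L}. ?t j) = (\<Sum>j\<in>{- int L..?j}. ?t j) + (\<Sum>j\<in>{?j<..int L}. ?t j)"
    by (simp add: sum.union_disjoint[symmetric] ivl_disj_int)
  then show ?thesis using low high by linarith
qed

lemma prod_kernel_nonneg: "0 < r \<Longrightarrow> 0 \<le> prod_kernel r x y"
  unfolding prod_kernel_def by (intro prod_nonneg) auto

lemma prod_kernel_le_1: "0 < r \<Longrightarrow> prod_kernel r x y \<le> 1"
  unfolding prod_kernel_def by (intro prod_le_1) auto

lemma measurable_prod_kernel [measurable]:
  "f \<in> borel_measurable M \<Longrightarrow> g \<in> borel_measurable M \<Longrightarrow> (\<lambda>c. prod_kernel r (f c) (g c)) \<in> borel_measurable M"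
  unfolding prod_kernel_def by (intro borel_measurable_prod borel_measurable_divide borel_measurable_add borel_measurable_abs borel_measurable_inner borel_measurable_diff) simp_all

text \<open>Every denominator changes by at most \<open>r\<close>, and it is itself at least
  \<open>r\<close>, so it changes by a factor of at most 2.\<close>

lemma prod_kernel_shift:
  fixes x :: "'b::euclidean_space"
  assumes r: "0 < r" and "\<And>b. b \<in> Basis \<Longrightarrow> \<bar>(x - x') \<bullet> b\<bar> \<le> r"
  shows "prod_kernel r x y \<le> 2 ^ DIM('b) * prod_kernel r x' y"
proof -
  have "prod_kernel r x y \<le> (\<Prod>b\<in>(Basis::'b set). 2 * (r / (r + \<bar>(x' - y) \<bullet> b\<bar>)))"
    unfolding prod_kernel_def
  proof (intro prod_mono conjI)
    fix b :: 'b assume "b \<in> Basis"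
    then have "\<bar>(x' - y) \<bullet> b\<bar> \<le> r + \<bar>(x - y) \<bullet> b\<bar>" using assms(2)[of b] by (simp add: inner_diff_left)
    then have "r + \<bar>(x' - y) \<bullet> b\<bar> \<le> 2 * (r + \<bar>(x - y) \<bullet> b\<bar>)"
      using r abs_ge_zero[of "(x - y) \<bullet> b"] unfolding distrib_left mult_2 by linarith
    then have "r * (r + \<bar>(x' - y) \<bullet> b\<bar>) \<le> r * (2 * (r + \<bar>(x - y) \<bullet> b\<bar>))" using r by (intro mult_left_mono) auto
    then show "r / (r + \<bar>(x - y) \<bullet> b\<bar>) \<le> 2 * (r / (r + \<bar>(x' - y) \<bullet> b\<bar>))"
      using r by (simp add: divide_simps add_pos_nonneg)
  qed (use r in auto)
  also have "\<dots> = 2 ^ DIM('b) * prod_kernel r x' y"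
    unfolding prod_kernel_def by (subst prod.distrib) simp
  finally show ?thesis .
qed

text \<open>Kernel and grid are both products over the coordinates, so the sum factorizes into
  one-dimensional harmonic sums. The mesh \<open>r / D\<close> is chosen so that cells have diameter
  at most \<open>r\<close>; it costs the factor \<open>D\<close>.\<close>

lemma sum_prod_kernel_grid_le:
  fixes y :: "'b::euclidean_space" and L :: nat and r :: real
  defines "D \<equiv> real DIM('b)"
  assumes r: "0 < r" and y: "D * norm y \<le> r * L"
  defines "p \<equiv> \<lambda>z. \<Sum>b\<in>(Basis::'b set). (of_int (z b) * (r / D)) *\<^sub>R b"
  shows "(\<Sum>z\<in>Basis \<rightarrow>\<^sub>E {- int L..int L}. prod_kernel r (p z) y) \<le> (2 * D * harm (2 * L + 1)) ^ DIM('b)"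
proof -
  have D: "D \<ge> 1" unfolding D_def using DIM_positive[where 'a='b] by linarith
  have pb: "p z \<bullet> b = of_int (z b) * (r / D)" if "b \<in> Basis" for z b
    unfolding p_def using that by (simp add: inner_sum_left inner_Basis if_distrib cong: if_cong)
  have "(\<Sum>z\<in>Basis \<rightarrow>\<^sub>E {- int L..int L}. prod_kernel r (p z) y) =
    (\<Sum>z\<in>Basis \<rightarrow>\<^sub>E {- int L..int L}. \<Prod>b\<in>Basis. r / (r + \<bar>of_int (z b) * (r / D) - y \<bullet> b\<bar>))"
    unfolding prod_kernel_def by (intro sum.cong prod.cong) (auto simp: inner_diff_left pb)
  also have "\<dots> = (\<Prod>b\<in>Basis. \<Sum>j\<in>{- int L..int L}. r / (r + \<bar>of_int j * (r / D) - y \<bullet> b\<bar>))"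
    by (subst prod_sum_PiE) auto
  also have "\<dots> \<le> (\<Prod>b\<in>(Basis::'b set). 2 * D * harm (2 * L + 1))"
  proof (intro prod_mono conjI sum_nonneg)
    fix b :: 'b assume b: "b \<in> Basis"
    define a where "a = (y \<bullet> b) * D / r"
    have "\<bar>a\<bar> = \<bar>y \<bullet> b\<bar> * D / r" using r D by (simp add: a_def abs_mult)
    also have "\<dots> \<le> norm y * D / r" using Basis_le_norm[OF b, of y] r D by (intro divide_right_mono mult_right_mono) auto
    also have "\<dots> \<le> L" using y r by (simp add: field_simps)
    finally have a: "\<bar>a\<bar> \<le> L" .
    have "r / (r + \<bar>of_int j * (r / D) - y \<bullet> b\<bar>) \<le> D * (1 / (1 + \<bar>of_int j - a\<bar>))" for j :: int
    proof -
      have "of_int j * (r / D) - y \<bullet> b = (r / D) * (of_int j - a)" using r D by (simp add: a_def field_simps)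
      then have "r + \<bar>of_int j * (r / D) - y \<bullet> b\<bar> = r + (r / D) * \<bar>of_int j - a\<bar>" using r D by (simp add: abs_mult)
      also have "\<dots> \<ge> (r / D) * (1 + \<bar>of_int j - a\<bar>)" using r D by (simp add: field_simps)
      finally have "r / (r + \<bar>of_int j * (r / D) - y \<bullet> b\<bar>) \<le> r / ((r / D) * (1 + \<bar>of_int j - a\<bar>))"
        using r D by (intro divide_left_mono) (auto intro!: mult_pos_pos add_pos_nonneg)
      also have "\<dots> = D * (1 / (1 + \<bar>of_int j - a\<bar>))" using r D by simp
      finally show ?thesis .
    qed
    then have "(\<Sum>j\<in>{- int L..int L}. r / (r + \<bar>of_int j * (r / D) - y \<bullet> b\<bar>)) \<le>
      (\<Sum>j\<in>{- int L..int L}. D * (1 / (1 + \<bar>of_int j - a\<bar>)))" by (intro sum_mono)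
    also have "\<dots> \<le> D * (2 * harm (2 * L + 1))"
      unfolding sum_distrib_left[symmetric] using sum_inverse_dist_int_le[OF a] D by (intro mult_left_mono) auto
    finally show "(\<Sum>j\<in>{- int L..int L}. r / (r + \<bar>of_int j * (r / D) - y \<bullet> b\<bar>)) \<le> 2 * D * harm (2 * L + 1)" by simp
  qed (use r in auto)
  finally show ?thesis by simp
qed

text \<open>A counting estimate: up to a constant the kernel integral does not vary within a cell of
  the grid, and its values at the grid points add up to at most a polynomial in \<open>k\<close>.
  Cells with mass below \<open>2 powr (- \<epsilon> * k)\<close> times this value thus have summable
  total mass, and Borel-Cantelli discards them.\<close>

lemma prod_kernel_integral_le_ball_mass_AE:
  fixes V :: "'c \<Rightarrow> 'b::euclidean_space" and \<epsilon> :: real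
  assumes "prob_space P" and V [measurable]: "V \<in> borel_measurable P"
    and R: "\<And>c. c \<in> space P \<Longrightarrow> norm (V c) \<le> R" and \<epsilon>: "\<epsilon> > 0"
  shows "AE c in P. \<forall>\<^sub>F k in sequentially. (\<integral>c'. prod_kernel ((1/2)^k) (V c) (V c') \<partial>P)
    \<le> 2 powr (\<epsilon> * k) * measure P {c'\<in>space P. dist (V c') (V c) \<le> (1/2)^k}"
proof -
  interpret prob_space P by fact
  define D where "D = real DIM('b)"
  have D: "D \<ge> 1" unfolding D_def using DIM_positive[where 'a='b] by linarith
  obtain c0 where "c0 \<in> space P" using not_empty by blast
  then have R0: "0 \<le> R" using R norm_ge_zero order_trans by blast
  \<comment> \<open>With this side length the l1-diameter of a cell is at most
    \<open>D * h k = (1/2)^k\<close>, so a cell lies in the ball around any of its points.\<close>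
  define h where "h k = (1/2)^k / D" for k :: nat
  \<comment> \<open>The extra 1 leaves room for the floor of negative coordinates.\<close>
  define L where "L k = nat \<lceil>R * D * 2^k\<rceil> + 1" for k :: nat
  define p where "p k z = (\<Sum>b\<in>(Basis::'b set). (of_int (z b) * h k) *\<^sub>R b)" for k z
  define cell where "cell k c = (\<lambda>b\<in>(Basis::'b set). \<lfloor>(V c \<bullet> b) / h k\<rfloor>)" for k c
  define Zs where "Zs k = ((Basis::'b set) \<rightarrow>\<^sub>E {- int (L k)..int (L k)})" for k
  define cs where "cs k z = {c\<in>space P. \<forall>b\<in>(Basis::'b set). \<lfloor>(V c \<bullet> b) / h k\<rfloor> = z b}" for k z
  define I where "I k x = (\<integral>c'. prod_kernel ((1/2)^k) x (V c') \<partial>P)" for k x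
  have h: "h k > 0" for k using D by (simp add: h_def)
  have Lk: "R * D * 2^k \<le> real (L k) - 1" for k using R0 D unfolding L_def by (simp add: of_nat_nat)
  have int [simp]: "integrable P (\<lambda>c'. prod_kernel ((1/2)^k) x (V c'))" for k x
    by (rule integrable_const_bound[of _ 1]) (auto simp: prod_kernel_nonneg prod_kernel_le_1)
  have cs_sets [measurable]: "cs k z \<in> sets P" for k z unfolding cs_def by measurable
  have finZ: "finite (Zs k)" for k unfolding Zs_def by (auto intro: finite_PiE)
  \<comment> \<open>The factor \<open>2 ^ DIM('b)\<close> pays for moving the base point from
    \<open>V c\<close> to the corner \<open>p k z\<close> of its cell.\<close>
  define Bad where "Bad k = {z\<in>Zs k. prob (cs k z) \<le> 2 powr (- \<epsilon> * k) * (2 ^ DIM('b) * I k (p k z))}" for k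
  have Ipos: "0 \<le> I k x" for k x unfolding I_def by (intro integral_nonneg_AE) (auto simp: prod_kernel_nonneg)
  define S where "S k = (2 * D * harm (2 * L k + 1)) ^ DIM('b)" for k
  have sumI: "(\<Sum>z\<in>Zs k. I k (p k z)) \<le> S k" for k
  proof -
    have "(\<Sum>z\<in>Zs k. I k (p k z)) = (\<integral>c'. (\<Sum>z\<in>Zs k. prod_kernel ((1/2)^k) (p k z) (V c')) \<partial>P)"
      unfolding I_def by (subst Bochner_Integration.integral_sum) auto
    also have "\<dots> \<le> (\<integral>c'. S k \<partial>P)"
    proof (rule integral_mono)
      fix c assume c: "c \<in> space P"
      have "D * norm (V c) \<le> D * R" using R[OF c] D by (intro mult_left_mono) auto
      also have "\<dots> = (1/2)^k * (R * D * 2^k)" by (simp add: power_divide)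
      also have "\<dots> \<le> (1/2)^k * real (L k)" using Lk[of k] by (intro mult_left_mono) auto
      finally show "(\<Sum>z\<in>Zs k. prod_kernel ((1/2)^k) (p k z) (V c)) \<le> S k"
        unfolding Zs_def S_def p_def h_def D_def by (rule sum_prod_kernel_grid_le[rotated]) simp
    qed auto
    finally show ?thesis by (simp add: prob_space)
  qed
  define A where "A k = (\<Union>z\<in>Bad k. cs k z)" for k
  have A_sets [measurable]: "A k \<in> sets P" for k
    unfolding A_def using finZ[of k] by (intro sets.finite_UN) (auto simp: Bad_def)
  have A_le: "prob (A k) \<le> 2 powr (- \<epsilon> * k) * (2 ^ DIM('b) * S k)" for k
  proof -
    have fB: "finite (Bad k)" using finZ[of k] by (simp add: Bad_def)
    have "prob (A k) \<le> (\<Sum>z\<in>Bad k. prob (cs k z))"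
      unfolding A_def using fB by (intro finite_measure_subadditive_finite) auto
    also have "\<dots> \<le> (\<Sum>z\<in>Bad k. 2 powr (- \<epsilon> * k) * (2 ^ DIM('b) * I k (p k z)))"
      by (intro sum_mono) (simp add: Bad_def)
    also have "\<dots> \<le> (\<Sum>z\<in>Zs k. 2 powr (- \<epsilon> * k) * (2 ^ DIM('b) * I k (p k z)))"
      using finZ[of k] Ipos by (intro sum_mono2) (auto simp: Bad_def)
    also have "\<dots> \<le> 2 powr (- \<epsilon> * k) * (2 ^ DIM('b) * S k)"
      unfolding sum_distrib_left[symmetric] using sumI by (intro mult_left_mono) auto
    finally show ?thesis .
  qed
  have "summable (\<lambda>k. prob (A k))"
  proof (rule summable_comparison_test')
    define a where "a = 2 * (R * D + 2) + 1"
    have a: "a \<ge> 1" using R0 D by (simp add: a_def)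
    \<comment> \<open>\<open>L k\<close> is of order \<open>2^k\<close>, so the harmonic number is
      linear in \<open>k\<close> and \<open>S k\<close> loses against
      \<open>2 powr (- \<epsilon> * k)\<close>.\<close>
    have S_le: "S k \<le> (2 * D * (1 + ln a + k)) ^ DIM('b)" for k
    proof -
      have "real (2 * L k + 1) \<le> a * 2^k"
      proof -
        have "real (L k) \<le> R * D * 2^k + 2" using R0 D unfolding L_def by (simp add: of_nat_nat) linarith
        also have "\<dots> \<le> (R * D + 2) * 2^k" by (simp add: algebra_simps)
        finally have "2 * real (L k) + 1 \<le> 2 * ((R * D + 2) * 2^k) + 2^k" using one_le_power[of "2::real" k, OF one_le_numeral] by linarith
        also have "\<dots> = a * 2^k" by (simp add: a_def algebra_simps)
        finally show ?thesis by simp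
      qed
      then have "ln (real (2 * L k + 1)) \<le> ln (a * 2^k)" by (subst ln_le_cancel_iff) (use a in auto)
      also have "\<dots> = ln a + k * ln 2" using a by (simp add: ln_mult ln_realpow)
      also have "\<dots> \<le> ln a + k" using ln_2_less_1 by (simp add: mult_left_le)
      finally have "harm (2 * L k + 1) \<le> 1 + ln a + k" using harm_le_ln[of "2 * L k"] by simp
      then show ?thesis unfolding S_def using D by (intro power_mono mult_left_mono) (auto simp: harm_nonneg)
    qed
    show "summable (\<lambda>k. 2 powr (- \<epsilon> * k) * (2 ^ DIM('b) * (2 * D * (1 + ln a + k)) ^ DIM('b)))"
    proof -
      have o: "(\<lambda>k. 2 powr (- \<epsilon> * real k) * (2 ^ DIM('b) * (2 * D * (1 + ln a + k)) ^ DIM('b)))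
         \<in> O(\<lambda>k. 2 powr (- \<epsilon> / 2 * real k))" using \<epsilon> D a by real_asymp
      have n: "summable (\<lambda>k. norm ((2 powr (- \<epsilon> / 2)) ^ k))"
        using \<epsilon> powr_less_mono[of "- \<epsilon> / 2" 0 "2::real"] by (simp add: norm_power summable_geometric)
      have eq: "(\<lambda>k. 2 powr (- \<epsilon> / 2 * real k)) = (\<lambda>k. (2 powr (- \<epsilon> / 2)) ^ k)"
      proof
        fix k :: nat
        have "2 powr (- \<epsilon> / 2 * real k) = (2 powr (- \<epsilon> / 2)) powr real k" unfolding powr_powr ..
        also have "\<dots> = (2 powr (- \<epsilon> / 2)) ^ k" by (rule powr_realpow) simp
        finally show "2 powr (- \<epsilon> / 2 * real k) = (2 powr (- \<epsilon> / 2)) ^ k" .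
      qed
      show ?thesis by (rule summable_comparison_test_bigo[OF n o[unfolded eq]])
    qed
    show "norm (prob (A k)) \<le> 2 powr (- \<epsilon> * k) * (2 ^ DIM('b) * (2 * D * (1 + ln a + k)) ^ DIM('b))" if "k \<ge> 0" for k
      using A_le[of k] S_le[of k] by (auto intro: order_trans mult_left_mono)
  qed
  then have AE: "AE c in P. \<forall>\<^sub>F k in sequentially. c \<in> space P - A k"
    by (intro borel_cantelli_AE1) (auto simp: emeasure_eq_measure less_top[symmetric])
  have good: "I k (V c) \<le> 2 powr (\<epsilon> * k) * prob {c'\<in>space P. dist (V c') (V c) \<le> (1/2)^k}"
    if c: "c \<in> space P - A k" for c k
  proof -
    define z where "z = cell k c"
    have zb: "z b = \<lfloor>(V c \<bullet> b) / h k\<rfloor>" if "b \<in> Basis" for b using that by (simp add: z_def cell_def)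
    have fl: "of_int \<lfloor>(V c \<bullet> b) / h k\<rfloor> * h k \<le> V c \<bullet> b" "V c \<bullet> b < (of_int \<lfloor>(V c \<bullet> b) / h k\<rfloor> + 1) * h k" for c b
      by (subst pos_le_divide_eq[OF h, symmetric] pos_divide_less_eq[OF h, symmetric], linarith)+
    have fl_in: "\<lfloor>x\<rfloor> \<in> {- int n..int n}" if "\<bar>x\<bar> \<le> real n - 1" for x :: real and n
      using that by (simp add: le_floor_iff floor_le_iff abs_le_iff)
    have "\<bar>(V c \<bullet> b) / h k\<bar> \<le> real (L k) - 1" if b: "b \<in> Basis" for b
    proof -
      have "\<bar>(V c \<bullet> b) / h k\<bar> = \<bar>V c \<bullet> b\<bar> / h k" using h[of k] by simp
      also have "\<dots> \<le> R / h k" using Basis_le_norm[OF b, of "V c"] R[of c] c h[of k] by (intro divide_right_mono) auto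
      also have "\<dots> = R * D * 2^k" using D by (simp add: h_def power_divide)
      finally show ?thesis using Lk[of k] by linarith
    qed
    then have "z b \<in> {- int (L k)..int (L k)}" if "b \<in> Basis" for b
      using fl_in[of "V c \<bullet> b / h k" "L k"] zb[OF that] that by metis
    then have z: "z \<in> Zs k" unfolding Zs_def by (auto simp: z_def cell_def)
    have c_cs: "c \<in> cs k z" using c zb by (simp add: cs_def)
    then have nb: "z \<notin> Bad k" using c by (auto simp: A_def)
    have pz: "p k z \<bullet> b = of_int (z b) * h k" if "b \<in> Basis" for b
      unfolding p_def using that by (simp add: inner_sum_left inner_Basis if_distrib cong: if_cong)
    have hr: "h k \<le> (1/2)^k" using D by (simp add: h_def field_simps)
    have "I k (V c) \<le> (\<integral>c'. 2 ^ DIM('b) * prod_kernel ((1/2)^k) (p k z) (V c') \<partial>P)"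
      unfolding I_def
    proof (intro integral_mono prod_kernel_shift)
      fix b :: 'b assume b: "b \<in> Basis"
      have "\<bar>(V c - p k z) \<bullet> b\<bar> \<le> h k" using fl[of c b] pz[OF b] zb[OF b] by (simp add: inner_diff_left algebra_simps abs_le_iff)
      then show "\<bar>(V c - p k z) \<bullet> b\<bar> \<le> (1/2)^k" using hr by linarith
    qed auto
    also have "\<dots> = 2 ^ DIM('b) * I k (p k z)" unfolding I_def by simp
    also have "\<dots> = 2 powr (\<epsilon> * k) * (2 powr (- \<epsilon> * k) * (2 ^ DIM('b) * I k (p k z)))"
      by (simp add: powr_minus)
    also have "\<dots> \<le> 2 powr (\<epsilon> * k) * prob (cs k z)" using nb z by (intro mult_left_mono) (auto simp: Bad_def)
    also have "\<dots> \<le> 2 powr (\<epsilon> * k) * prob {c'\<in>space P. dist (V c') (V c) \<le> (1/2)^k}"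
    proof (intro mult_left_mono finite_measure_mono)
      show "cs k z \<subseteq> {c'\<in>space P. dist (V c') (V c) \<le> (1/2)^k}"
      proof safe
        fix c' assume c': "c' \<in> cs k z"
        have "dist (V c') (V c) \<le> (\<Sum>b\<in>Basis. \<bar>(V c' - V c) \<bullet> b\<bar>)" unfolding dist_norm by (rule norm_le_l1)
        also have "\<dots> \<le> (\<Sum>b\<in>(Basis::'b set). h k)"
        proof (rule sum_mono)
          fix b :: 'b assume b: "b \<in> Basis"
          then have "\<lfloor>(V c' \<bullet> b) / h k\<rfloor> = z b" using c' by (simp add: cs_def)
          then show "\<bar>(V c' - V c) \<bullet> b\<bar> \<le> h k"
            using fl[of c b] fl[of c' b] zb[OF b] by (simp add: inner_diff_left algebra_simps abs_le_iff)
        qed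
        also have "\<dots> = (1/2)^k" using D by (simp add: h_def D_def)
        finally show "dist (V c') (V c) \<le> (1/2)^k" .
      qed (simp add: cs_def)
    qed auto
    finally show ?thesis .
  qed
  show ?thesis using AE
  proof (rule AE_mp, intro AE_I2 impI)
    fix c assume "\<forall>\<^sub>F k in sequentially. c \<in> space P - A k"
    then show "\<forall>\<^sub>F k in sequentially. (\<integral>c'. prod_kernel ((1/2)^k) (V c) (V c') \<partial>P)
      \<le> 2 powr (\<epsilon> * k) * measure P {c'\<in>space P. dist (V c') (V c) \<le> (1/2)^k}"
      by (rule eventually_mono) (use good in \<open>simp add: I_def\<close>)
  qed
qed

section \<open>A pathwise criterion\<close>

lemma closed_msupport:
  assumes "sets \<mu> = sets borel" shows "closed (msupport \<mu>)"
proof -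
  have "open (- msupport \<mu>)"
    unfolding open_contains_ball
  proof
    fix x assume "x \<in> - msupport \<mu>"
    then obtain e where e: "e > 0" "emeasure \<mu> (ball x e) = 0" by (auto simp: msupport_def)
    have "y \<in> - msupport \<mu>" if y: "y \<in> ball x (e/2)" for y
    proof -
      have "ball y (e/2) \<subseteq> ball x e"
      proof
        fix z assume "z \<in> ball y (e/2)"
        then show "z \<in> ball x e" using y dist_triangle[of x z y] by (auto simp: dist_commute)
      qed
      then have "emeasure \<mu> (ball y (e/2)) \<le> emeasure \<mu> (ball x e)"
        by (rule emeasure_mono) (simp add: assms)
      then show ?thesis using e by (auto simp: msupport_def intro!: exI[of _ "e/2"])
    qed
    then show "\<exists>e>0. ball x e \<subseteq> - msupport \<mu>" using e(1) by (intro exI[of _ "e/2"]) auto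
  qed
  then show ?thesis by (simp add: closed_def)
qed

lemma distr_mem_Pc:
  fixes h :: "'c::topological_space \<Rightarrow> 'a::metric_space"
  assumes "prob_space P" and P: "sets P = sets borel" and h: "continuous_on UNIV h"
    and K: "compact K" "AE c in P. c \<in> K" and "h ` K \<subseteq> A"
  shows "distr P borel h \<in> Pc A"
proof -
  have m: "h \<in> measurable P borel" using borel_measurable_continuous_onI[OF h] by (simp add: measurable_cong_sets[OF P refl])
  let ?T = "h ` K"
  have T: "compact ?T" using K(1) h by (meson compact_continuous_image continuous_on_subset subset_UNIV)
  have "msupport (distr P borel h) \<subseteq> ?T"
  proof (rule ccontr)
    assume "\<not> ?thesis"
    then obtain x where x: "x \<in> msupport (distr P borel h)" "x \<notin> ?T" by blast
    then obtain e where e: "e > 0" "ball x e \<subseteq> - ?T" using compact_imp_closed[OF T] open_contains_ball[of "- ?T"] by (metis ComplI open_Compl)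
    have "emeasure (distr P borel h) (ball x e) = emeasure P (h -` ball x e \<inter> space P)"
      using m by (rule emeasure_distr) simp
    also have "\<dots> = emeasure P {c\<in>space P. h c \<in> ball x e}" by (intro arg_cong[where f="emeasure P"]) auto
    also have "\<dots> = 0"
    proof (rule emeasure_eq_0_AE)
      show "AE c in P. h c \<notin> ball x e" using K(2) by (rule AE_mp) (use e(2) in \<open>auto intro!: AE_I2\<close>)
    qed
    finally show False using x(1) e(1) by (auto simp: msupport_def)
  qed
  moreover have "compact (msupport (distr P borel h))"
    using compact_Int_closed[OF T closed_msupport[of "distr P borel h"]] calculation by (simp add: Int_absorb1)
  ultimately show ?thesis using assms(6) prob_space.prob_space_distr[OF assms(1) m] unfolding Pc_def by auto
qed

text \<open>Dyadic radii and the tolerances \<open>inverse (Suc j)\<close> already force the liminf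
  to vanish. This countable form makes the set of good points visibly measurable.\<close>

lemma Liminf_at_right_0_eq_0:
  fixes X :: "real \<Rightarrow> ennreal"
  assumes X: "\<And>j n. \<exists>k\<ge>n. X ((1/2)^k) \<le> ennreal (inverse (Suc j))"
  shows "Liminf (at_right 0) X = 0"
proof (rule ccontr)
  assume "Liminf (at_right 0) X \<noteq> 0"
  then have "0 < Liminf (at_right 0) X" by (simp add: zero_less_iff_neq_zero)
  then obtain y where y: "0 < y" "y < Liminf (at_right 0) X" using dense by blast
  then have "\<forall>\<^sub>F r in at_right 0. y < X r" using le_Liminf_iff[of "Liminf (at_right 0) X" "at_right 0" X] by blast
  moreover have "filterlim (\<lambda>k::nat. (1/2)^k :: real) (at_right 0) sequentially" by real_asymp
  ultimately have "\<forall>\<^sub>F k in sequentially. y < X ((1/2)^k)" by (rule eventually_compose_filterlim)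
  then obtain n where n: "\<And>k. k \<ge> n \<Longrightarrow> y < X ((1/2)^k)" by (auto simp: eventually_sequentially)
  obtain j where j: "ennreal (inverse (Suc j)) < y"
  proof -
    have "(\<lambda>j. ennreal (inverse (Suc j))) \<longlonglongrightarrow> ennreal 0" by (intro tendsto_ennrealI LIMSEQ_inverse_real_of_nat)
    then have "\<forall>\<^sub>F j in sequentially. ennreal (inverse (Suc j)) < y" using y(1) by (intro order_tendstoD(2)) auto
    then show ?thesis using that by (auto simp: eventually_sequentially)
  qed
  show False using X[of n j] n j by (meson less_trans not_le)
qed

lemma dyadic_near:
  fixes x :: real assumes "0 < x" "x < (1/2)^j"
  shows "\<exists>k>j. (1/2)^k \<le> x \<and> x < 2 * (1/2)^k"
proof -
  define k where "k = (LEAST k. (1/2)^k \<le> x)"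
  have "\<exists>k. (1/2)^k \<le> x" using real_arch_pow_inv[of x "1/2"] \<open>0 < x\<close> by (auto intro: less_imp_le)
  then have k: "(1/2)^k \<le> x" unfolding k_def by (rule LeastI_ex)
  then have "(1/2::real)^k < (1/2)^j" using assms(2) by linarith
  then have "j < k" by (simp add: power_strict_decreasing_iff)
  moreover have "x < (1/2)^(k-1)" using not_less_Least[of "k-1" "\<lambda>k. (1/2)^k \<le> x"] \<open>j < k\<close> unfolding k_def[symmetric] by simp
  ultimately show ?thesis using k by (intro exI[of _ k]) (cases k; auto)
qed

lemma measurable_random_map_compose:
  assumes "(\<lambda>(\<omega>, t). W \<omega> t) \<in> borel_measurable (M \<Otimes>\<^sub>M borel)"
    and "p \<in> measurable N M" "q \<in> measurable N borel"
  shows "(\<lambda>x. W (p x) (q x)) \<in> borel_measurable N"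
  using measurable_compose[OF measurable_Pair[OF assms(2,3)] assms(1)] by simp

text \<open>Fubini turns the expected mass of a random ball into an integral of two-point
  probabilities, the form in which Gaussian bounds apply. Measurability in \<open>t\<close> serves
  to move almost-everywhere statements to an image measure.\<close>

lemma exp_ball_mass_eq:
  fixes W :: "'w \<Rightarrow> 'a::euclidean_space \<Rightarrow> 'b::euclidean_space"
  assumes "prob_space M" "prob_space \<mu>" and \<mu>: "sets \<mu> = sets borel"
    and joint: "(\<lambda>(\<omega>, t). W \<omega> t) \<in> borel_measurable (M \<Otimes>\<^sub>M borel)"
  shows "exp_ball_mass M W \<mu> t r = (\<integral>\<^sup>+s. emeasure M {\<omega>\<in>space M. dist (W \<omega> t) (W \<omega> s) \<le> r} \<partial>\<mu>)"
    and "(\<lambda>t. exp_ball_mass M W \<mu> t r) \<in> borel_measurable borel"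
proof -
  interpret M: prob_space M by fact
  interpret \<mu>: prob_space \<mu> by fact
  interpret pair_sigma_finite \<mu> M ..
  note W [measurable (raw)] = measurable_random_map_compose[OF joint]
  have id [measurable]: "(\<lambda>x. x) \<in> measurable \<mu> borel" by (simp add: measurable_cong_sets[OF \<mu> refl])
  have snd [measurable]: "snd \<in> measurable (N \<Otimes>\<^sub>M \<mu>) borel" for N :: "'a measure"
    using measurable_snd[of N \<mu>] by (simp add: measurable_cong_sets[OF refl \<mu>])
  have fst [measurable]: "fst \<in> measurable (\<mu> \<Otimes>\<^sub>M M) borel"
    using measurable_fst[of \<mu> M] by (simp add: measurable_cong_sets[OF refl \<mu>])
  show *: "exp_ball_mass M W \<mu> t r = (\<integral>\<^sup>+s. emeasure M {\<omega>\<in>space M. dist (W \<omega> t) (W \<omega> s) \<le> r} \<partial>\<mu>)" for t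
  proof -
    define A where "A = {x\<in>space (\<mu> \<Otimes>\<^sub>M M). dist (W (snd x) t) (W (snd x) (fst x)) \<le> r}"
    have A: "A \<in> sets (\<mu> \<Otimes>\<^sub>M M)" unfolding A_def by measurable
    have "exp_ball_mass M W \<mu> t r = (\<integral>\<^sup>+\<omega>. emeasure \<mu> ((\<lambda>x. (x, \<omega>)) -` A) \<partial>M)"
      unfolding exp_ball_mass_def
      by (intro nn_integral_cong arg_cong[where f="emeasure \<mu>"]) (auto simp: A_def space_pair_measure)
    also have "\<dots> = (\<integral>\<^sup>+s. emeasure M (Pair s -` A) \<partial>\<mu>)"
      using emeasure_pair_measure_alt2[OF A] M.emeasure_pair_measure_alt[OF A] by simp
    also have "\<dots> = (\<integral>\<^sup>+s. emeasure M {\<omega>\<in>space M. dist (W \<omega> t) (W \<omega> s) \<le> r} \<partial>\<mu>)"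
      by (intro nn_integral_cong arg_cong[where f="emeasure M"]) (auto simp: A_def space_pair_measure)
    finally show ?thesis .
  qed
  have "(\<lambda>x. emeasure M {\<omega>\<in>space M. dist (W \<omega> (fst x)) (W \<omega> (snd x)) \<le> r}) \<in> borel_measurable (borel \<Otimes>\<^sub>M \<mu>)"
  proof (rule M.measurable_emeasure)
    have [measurable]: "(\<lambda>x. fst (fst x)) \<in> measurable ((borel \<Otimes>\<^sub>M \<mu>) \<Otimes>\<^sub>M M) borel"
      "(\<lambda>x. snd (fst x)) \<in> measurable ((borel \<Otimes>\<^sub>M \<mu>) \<Otimes>\<^sub>M M) borel"
      by (auto intro: measurable_compose[OF measurable_fst] snd)
    have "{x\<in>space ((borel \<Otimes>\<^sub>M \<mu>) \<Otimes>\<^sub>M M). dist (W (snd x) (fst (fst x))) (W (snd x) (snd (fst x))) \<le> r}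
      \<in> sets ((borel \<Otimes>\<^sub>M \<mu>) \<Otimes>\<^sub>M M)" by measurable
    then show "{x \<in> space ((borel \<Otimes>\<^sub>M \<mu>) \<Otimes>\<^sub>M M). snd x \<in> {\<omega> \<in> space M. dist (W \<omega> (fst (fst x))) (W \<omega> (snd (fst x))) \<le> r}}
      \<in> sets ((borel \<Otimes>\<^sub>M \<mu>) \<Otimes>\<^sub>M M)"
      by (rule back_subst) (auto simp: space_pair_measure)
  qed auto
  then show "(\<lambda>t. exp_ball_mass M W \<mu> t r) \<in> borel_measurable borel"
    unfolding * by (intro \<mu>.borel_measurable_nn_integral) (simp add: split_beta')
qed

text \<open>No randomness is left in \<open>w\<close>: in the application it is one sample path, and
  \<open>ker\<close> is what almost every path satisfies. The image of the Cantor measure under the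
  parametrization is then a competitor in \<open>dimPZ\<close>, since at its sparse good scales the
  expected ball mass is small as well.\<close>

lemma dimP_image_le_dimPZ:
  fixes W :: "'w \<Rightarrow> 'a::euclidean_space \<Rightarrow> 'b::euclidean_space"
  assumes M: "prob_space M" and joint: "(\<lambda>(\<omega>, t). W \<omega> t) \<in> borel_measurable (M \<Otimes>\<^sub>M borel)"
    and F: "cyl_closed F" "cyl_cont F G" "cyl_cont F (\<lambda>x. w (G x))" "G ` F = E" "E \<subseteq> A"
    and ker: "\<And>\<epsilon>. \<epsilon> > 0 \<Longrightarrow> \<exists>C. \<forall>\<^sub>F k in sequentially. \<forall>t\<in>E. \<forall>s\<in>E.
       measure M {\<omega>\<in>space M. dist (W \<omega> t) (W \<omega> s) \<le> (1/2)^k} \<le> C * 2 powr (\<epsilon> * real k) * prod_kernel ((1/2)^k) (w t) (w s)"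
  shows "dimP (w ` E) \<le> dimPZ M W A"
proof (rule ccontr)
  interpret M: prob_space M by fact
  assume "\<not> ?thesis"
  then have "dimPZ M W A < dimP (w ` E)" by simp
  then obtain g' where g': "dimPZ M W A < ereal g'" "ereal g' < dimP (w ` E)" using ereal_dense2 by blast
  then obtain g where g: "ereal g' < ereal g" "ereal g < dimP (w ` E)" using ereal_dense2 by blast
  have "(\<lambda>x. w (G x)) ` F = w ` E" using F(4) by auto
  with g(2) have "ereal g < dimP ((\<lambda>x. w (G x)) ` F)" by simp
  from cantor_measure[OF F(1-3) this]
  obtain P :: "(nat \<Rightarrow> nat) measure" and H K where P: "prob_space P" "sets P = sets borel" and K: "compact K" "AE c in P. c \<in> K" "closed K"
    and H: "\<And>c. H c \<in> F" and cont: "continuous_on UNIV (\<lambda>c. G (H c))" "continuous_on UNIV (\<lambda>c. w (G (H c)))"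
    and mass: "\<And>c e. e > 0 \<Longrightarrow> \<exists>r. 0 < r \<and> r < e \<and> measure P {c'. dist (w (G (H c'))) (w (G (H c))) \<le> r / 4} \<le> 2 * r powr g"
    by (elim exE conjE) blast
  interpret P: prob_space P by fact
  define h V where "h c = G (H c)" and "V c = w (h c)" for c
  have hE: "h c \<in> E" for c using F(4) H[of c] by (auto simp: h_def)
  have spaceP: "space P = UNIV" using sets_eq_imp_space_eq[OF P(2)] by simp
  have mh [measurable]: "h \<in> borel_measurable P" and mV [measurable]: "V \<in> borel_measurable P"
    using cont borel_measurable_continuous_onI unfolding h_def V_def by (auto simp: measurable_cong_sets[OF P(2) refl])
  define \<mu> where "\<mu> = distr P borel h"
  have \<mu>: "\<mu> \<in> Pc A" unfolding \<mu>_def using cont(1) hE F(5)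
    by (intro distr_mem_Pc[OF P _ K(1,2)]) (auto simp: h_def)
  then have \<mu>': "prob_space \<mu>" "sets \<mu> = sets borel" by (auto simp: Pc_def)
  note em = exp_ball_mass_eq[OF M \<mu>' joint]
  \<comment> \<open>The hypothesis \<open>ker\<close> and the kernel integral each lose a factor
    \<open>2 powr (\<epsilon> * k)\<close>; of the gap \<open>4 * \<epsilon>\<close> between
    \<open>g'\<close> and \<open>g\<close>, half remains.\<close>
  define \<epsilon> where "\<epsilon> = (g - g') / 4"
  have \<epsilon>: "\<epsilon> > 0" using g(1) by (simp add: \<epsilon>_def)
  have K_sets [measurable]: "K \<in> sets P" unfolding P(2) by (rule borel_closed[OF K(3)])
  \<comment> \<open>Cutting off outside \<open>K\<close> gives a map that is bounded everywhere and
    almost everywhere equal to \<open>V\<close>.\<close>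
  define V' where "V' c = (if c \<in> K then V c else 0)" for c
  have mV' [measurable]: "V' \<in> borel_measurable P" unfolding V'_def by measurable
  have "compact (V ` K)" using cont(2) K(1) unfolding V_def h_def
    by (meson compact_continuous_image continuous_on_subset subset_UNIV)
  then obtain R0 where R0: "\<And>c. c \<in> K \<Longrightarrow> norm (V c) \<le> R0" using compact_imp_bounded bounded_iff by (metis imageI)
  have bV': "norm (V' c) \<le> max R0 0" for c using R0[of c] by (auto simp: V'_def)
  have AEV: "AE c in P. V' c = V c" using K(2) by (rule AE_mp) (auto simp: V'_def)
  obtain C where C: "\<forall>\<^sub>F k in sequentially. \<forall>t\<in>E. \<forall>s\<in>E.
       measure M {\<omega>\<in>space M. dist (W \<omega> t) (W \<omega> s) \<le> (1/2)^k} \<le> C * 2 powr (\<epsilon> * real k) * prod_kernel ((1/2)^k) (w t) (w s)"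
    using ker[OF \<epsilon>] by blast
  then obtain k0 where k0: "\<And>k t s. k \<ge> k0 \<Longrightarrow> t \<in> E \<Longrightarrow> s \<in> E \<Longrightarrow>
       measure M {\<omega>\<in>space M. dist (W \<omega> t) (W \<omega> s) \<le> (1/2)^k} \<le> C * 2 powr (\<epsilon> * real k) * prod_kernel ((1/2)^k) (w t) (w s)"
    unfolding eventually_sequentially by blast
  define C' where "C' = max C 0"
  define \<Phi> where "\<Phi> t \<longleftrightarrow> (\<forall>j n. \<exists>k\<ge>n. ennreal (((1/2)^k) powr - g') * exp_ball_mass M W \<mu> t ((1/2)^k) \<le> ennreal (inverse (Suc j)))" for t
  have m\<Phi>: "{t\<in>space borel. \<Phi> t} \<in> sets borel" unfolding \<Phi>_def using em(2) by measurable
  have "AE c in P. \<Phi> (h c)"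
    using prod_kernel_integral_le_ball_mass_AE[OF P(1) mV' bV' \<epsilon>] K(2)
  proof eventually_elim
    case (elim c)
    have V'c: "V' c = V c" using elim by (simp add: V'_def)
    obtain k1 where k1: "\<And>k. k \<ge> k1 \<Longrightarrow> (\<integral>c'. prod_kernel ((1/2)^k) (V c) (V' c') \<partial>P)
      \<le> 2 powr (\<epsilon> * k) * P.prob {c'\<in>space P. dist (V' c') (V c) \<le> (1/2)^k}"
      using elim(1) unfolding V'c eventually_sequentially by blast
    have bound: "exp_ball_mass M W \<mu> (h c) ((1/2)^k) \<le> ennreal (C' * 2 powr (2 * \<epsilon> * k) * P.prob {c'. dist (V c') (V c) \<le> (1/2)^k})"
      if k: "k \<ge> k0" "k \<ge> k1" for k
    proof -
      have int: "integrable P (\<lambda>c'. prod_kernel ((1/2)^k) (V c) (V' c'))"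
        by (rule P.integrable_const_bound[of _ 1]) (auto simp: prod_kernel_nonneg prod_kernel_le_1)
      have ball_meas: "(\<lambda>s. emeasure M {\<omega>\<in>space M. dist (W \<omega> (h c)) (W \<omega> s) \<le> (1/2)^k}) \<in> borel_measurable borel"
      proof (rule M.measurable_emeasure)
        note [measurable (raw)] = measurable_random_map_compose[OF joint]
        have "{x\<in>space (borel \<Otimes>\<^sub>M M). dist (W (snd x) (h c)) (W (snd x) (fst x)) \<le> (1/2)^k} \<in> sets (borel \<Otimes>\<^sub>M M)" by measurable
        then show "{x \<in> space (borel \<Otimes>\<^sub>M M). snd x \<in> {\<omega> \<in> space M. dist (W \<omega> (h c)) (W \<omega> (fst x)) \<le> (1/2)^k}} \<in> sets (borel \<Otimes>\<^sub>M M)"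
          by (rule back_subst) (auto simp: space_pair_measure)
      qed auto
      have "exp_ball_mass M W \<mu> (h c) ((1/2)^k) = (\<integral>\<^sup>+s. emeasure M {\<omega>\<in>space M. dist (W \<omega> (h c)) (W \<omega> s) \<le> (1/2)^k} \<partial>\<mu>)"
        by (rule em(1))
      also have "\<dots> = (\<integral>\<^sup>+c'. emeasure M {\<omega>\<in>space M. dist (W \<omega> (h c)) (W \<omega> (h c')) \<le> (1/2)^k} \<partial>P)"
        unfolding \<mu>_def using ball_meas by (intro nn_integral_distr[OF mh]) (simp add: measurable_distr_eq1)
      also have "\<dots> \<le> (\<integral>\<^sup>+c'. ennreal (C' * 2 powr (\<epsilon> * k) * prod_kernel ((1/2)^k) (V c) (V' c')) \<partial>P)"
        using AEV
      proof (intro nn_integral_mono_AE, eventually_elim)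
        case (elim c')
        have "measure M {\<omega>\<in>space M. dist (W \<omega> (h c)) (W \<omega> (h c')) \<le> (1/2)^k} \<le> C * 2 powr (\<epsilon> * k) * prod_kernel ((1/2)^k) (V c) (V c')"
          unfolding V_def using k0[OF k(1) hE hE] .
        also have "\<dots> \<le> C' * 2 powr (\<epsilon> * k) * prod_kernel ((1/2)^k) (V c) (V c')"
          by (intro mult_right_mono prod_kernel_nonneg) (auto simp: C'_def)
        finally show ?case unfolding elim M.emeasure_eq_measure by (rule ennreal_leI)
      qed
      also have "\<dots> = ennreal (\<integral>c'. C' * 2 powr (\<epsilon> * k) * prod_kernel ((1/2)^k) (V c) (V' c') \<partial>P)"
        using int by (intro nn_integral_eq_integral) (auto simp: C'_def prod_kernel_nonneg)
      also have "\<dots> \<le> ennreal (C' * 2 powr (2 * \<epsilon> * k) * P.prob {c'. dist (V c') (V c) \<le> (1/2)^k})"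
      proof (rule ennreal_leI)
        have "(\<integral>c'. C' * 2 powr (\<epsilon> * k) * prod_kernel ((1/2)^k) (V c) (V' c') \<partial>P) = C' * 2 powr (\<epsilon> * k) * (\<integral>c'. prod_kernel ((1/2)^k) (V c) (V' c') \<partial>P)"
          by simp
        also have "\<dots> \<le> C' * 2 powr (\<epsilon> * k) * (2 powr (\<epsilon> * k) * P.prob {c'\<in>space P. dist (V' c') (V c) \<le> (1/2)^k})"
          using k1[OF k(2)] by (intro mult_left_mono) (auto simp: C'_def)
        also have "P.prob {c'\<in>space P. dist (V' c') (V c) \<le> (1/2)^k} = P.prob {c'\<in>space P. dist (V c') (V c) \<le> (1/2)^k}"
          using AEV by (intro P.finite_measure_eq_AE) (auto elim!: AE_mp)
        also have "C' * 2 powr (\<epsilon> * k) * (2 powr (\<epsilon> * k) * P.prob {c'\<in>space P. dist (V c') (V c) \<le> (1/2)^k})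
          = C' * 2 powr (2 * \<epsilon> * k) * P.prob {c'. dist (V c') (V c) \<le> (1/2)^k}"
          by (simp add: spaceP powr_add[symmetric] mult.assoc[symmetric])
        finally show "(\<integral>c'. C' * 2 powr (\<epsilon> * k) * prod_kernel ((1/2)^k) (V c) (V' c') \<partial>P) \<le> \<dots>" .
      qed
      finally show ?thesis .
    qed
    show "\<Phi> (h c)" unfolding \<Phi>_def
    proof (intro allI)
      fix j n :: nat
      \<comment> \<open>The good radius \<open>r / 4\<close> is rounded down to a dyadic \<rho> with
        \<open>r / \<rho> \<le> 8\<close>; the absolute value accounts for an exponent
        \<open>g\<close> of unknown sign.\<close>
      define B where "B = C' * (2 * 8 powr \<bar>g\<bar>)"
      have "(\<lambda>k. B * 2 powr (- 2 * \<epsilon> * real k)) \<longlonglongrightarrow> 0" using \<epsilon> by real_asymp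
      then have "\<forall>\<^sub>F k in sequentially. B * 2 powr (- 2 * \<epsilon> * real k) < inverse (Suc j)"
        by (rule order_tendstoD) simp
      then obtain k2 where k2: "\<And>k. k \<ge> k2 \<Longrightarrow> B * 2 powr (- 2 * \<epsilon> * real k) < inverse (Suc j)"
        unfolding eventually_sequentially by blast
      define N where "N = Max {n, k0, k1, k2}"
      obtain r where r: "0 < r" "r < (1/2)^N" "P.prob {c'. dist (V c') (V c) \<le> r / 4} \<le> 2 * r powr g"
        using mass[of "(1/2)^N" c] unfolding V_def h_def by auto
      obtain k where k: "k > N" "(1/2)^k \<le> r / 4" "r / 4 < 2 * (1/2)^k"
        using dyadic_near[of "r / 4" N] r by auto
      have kk: "k \<ge> n" "k \<ge> k0" "k \<ge> k1" "k \<ge> k2" using k(1) by (auto simp: N_def)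
      define \<rho> :: real where "\<rho> = (1/2)^k"
      have \<rho>: "\<rho> > 0" "\<rho> = 2 powr (- real k)" by (simp_all add: \<rho>_def powr_minus powr_realpow power_divide inverse_eq_divide)
      have "P.prob {c'. dist (V c') (V c) \<le> \<rho>} \<le> P.prob {c'. dist (V c') (V c) \<le> r / 4}"
      proof (rule P.finite_measure_mono)
        have "{c'\<in>space P. dist (V c') (V c) \<le> r / 4} \<in> sets P" by measurable
        then show "{c'. dist (V c') (V c) \<le> r / 4} \<in> sets P" by (simp add: spaceP)
      qed (use k in \<open>auto simp: \<rho>_def\<close>)
      also have "\<dots> \<le> 2 * r powr g" by (rule r(3))
      also have "r powr g \<le> 8 powr \<bar>g\<bar> * \<rho> powr g"
      proof -
        have "r powr g = (r / \<rho>) powr g * \<rho> powr g" using \<rho>(1) r(1) by (simp add: powr_divide)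
        moreover have "(r / \<rho>) powr g \<le> 8 powr \<bar>g\<bar>"
        proof -
          have q: "1 \<le> r / \<rho>" "r / \<rho> \<le> 8" using k(2,3) \<rho>(1) unfolding \<rho>_def[symmetric] by (auto simp: field_simps)
          have "(r / \<rho>) powr g \<le> (r / \<rho>) powr \<bar>g\<bar>" using q(1) by (intro powr_mono) auto
          also have "\<dots> \<le> 8 powr \<bar>g\<bar>" using q by (intro powr_mono2) auto
          finally show ?thesis .
        qed
        ultimately show ?thesis by (simp add: mult_right_mono)
      qed
      finally have pr: "P.prob {c'. dist (V c') (V c) \<le> \<rho>} \<le> 2 * 8 powr \<bar>g\<bar> * \<rho> powr g" by simp
      have "ennreal (\<rho> powr - g') * exp_ball_mass M W \<mu> (h c) \<rho> \<le>
         ennreal (\<rho> powr - g') * ennreal (C' * 2 powr (2 * \<epsilon> * k) * P.prob {c'. dist (V c') (V c) \<le> \<rho>})"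
        unfolding \<rho>_def by (intro mult_left_mono bound kk) auto
      also have "\<dots> = ennreal (\<rho> powr - g' * (C' * 2 powr (2 * \<epsilon> * k) * P.prob {c'. dist (V c') (V c) \<le> \<rho>}))"
        by (rule ennreal_mult'[symmetric]) auto
      also have "\<dots> \<le> ennreal (inverse (Suc j))"
      proof (rule ennreal_leI)
        have "\<rho> powr - g' * (C' * 2 powr (2 * \<epsilon> * k) * P.prob {c'. dist (V c') (V c) \<le> \<rho>})
          \<le> \<rho> powr - g' * (C' * 2 powr (2 * \<epsilon> * k) * (2 * 8 powr \<bar>g\<bar> * \<rho> powr g))"
          using pr by (intro mult_left_mono) (auto simp: C'_def)
        also have "\<dots> = B * (\<rho> powr - g' * 2 powr (2 * \<epsilon> * k) * \<rho> powr g)" by (simp add: B_def)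
        also have "\<rho> powr - g' * 2 powr (2 * \<epsilon> * k) * \<rho> powr g = 2 powr (- 2 * \<epsilon> * k)"
          unfolding \<rho>(2) powr_powr powr_add[symmetric] by (simp add: \<epsilon>_def field_simps)
        also have "B * 2 powr (- 2 * \<epsilon> * k) \<le> inverse (Suc j)" using k2[OF kk(4)] by simp
        finally show "\<rho> powr - g' * (C' * 2 powr (2 * \<epsilon> * k) * P.prob {c'. dist (V c') (V c) \<le> \<rho>}) \<le> inverse (Suc j)" .
      qed
      finally show "\<exists>k\<ge>n. ennreal (((1/2)^k) powr - g') * exp_ball_mass M W \<mu> (h c) ((1/2)^k) \<le> ennreal (inverse (Suc j))"
        using kk(1) unfolding \<rho>_def by blast
    qed
  qed
  then have "AE t in \<mu>. \<Phi> t" unfolding \<mu>_def using mh m\<Phi> by (subst AE_distr_iff) auto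
  then have "AE t in \<mu>. Liminf (at_right 0) (\<lambda>r. ennreal (r powr - g') * exp_ball_mass M W \<mu> t r) = 0"
    by (rule AE_mp) (auto intro!: AE_I2 Liminf_at_right_0_eq_0 simp: \<Phi>_def)
  then have "ereal g' \<le> dimPZ_measure M W \<mu>" unfolding dimPZ_measure_def by (intro Sup_upper) blast
  also have "\<dots> \<le> dimPZ M W A" unfolding dimPZ_def using \<mu> by (intro Sup_upper) blast
  finally show False using g'(1) by simp
qed

section \<open>Gaussian variables\<close>

text \<open>\<open>centered_gaussian_rv\<close> only asserts that some standard deviation exists;
  the second moment identifies it, with 0 for the degenerate case.\<close>

lemma gaussian_square:
  assumes "prob_space M" and Y: "centered_gaussian_rv M Y"
  shows "integrable M (\<lambda>\<omega>. (Y \<omega>)\<^sup>2)"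
    and "\<not> (AE \<omega> in M. Y \<omega> = 0) \<Longrightarrow> 0 < sqrt (\<integral>\<omega>. (Y \<omega>)\<^sup>2 \<partial>M) \<and> distributed M lborel Y (normal_density 0 (sqrt (\<integral>\<omega>. (Y \<omega>)\<^sup>2 \<partial>M)))"
    and "(AE \<omega> in M. Y \<omega> = 0) \<Longrightarrow> (\<integral>\<omega>. (Y \<omega>)\<^sup>2 \<partial>M) = 0"
proof -
  interpret prob_space M by fact
  have [measurable]: "Y \<in> borel_measurable M" using Y by (simp add: centered_gaussian_rv_def)
  have norm: "integrable M (\<lambda>\<omega>. (Y \<omega>)\<^sup>2) \<and> (\<integral>\<omega>. (Y \<omega>)\<^sup>2 \<partial>M) = \<sigma>\<^sup>2"
    if \<sigma>: "0 < \<sigma>" "distributed M lborel Y (normal_density 0 \<sigma>)" for \<sigma>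
  proof
    have "integrable lborel (\<lambda>x. normal_density 0 \<sigma> x * x^2)" using integrable_normal_moment[of \<sigma> 0 2] \<sigma>(1) by simp
    then show "integrable M (\<lambda>\<omega>. (Y \<omega>)\<^sup>2)"
      using distributed_integrable[OF \<sigma>(2), of "\<lambda>x. x^2"] by simp
    show "(\<integral>\<omega>. (Y \<omega>)\<^sup>2 \<partial>M) = \<sigma>\<^sup>2"
      using normal_distributed_variance[OF \<sigma>] normal_distributed_expectation[OF \<sigma>] by simp
  qed
  have zero: "integrable M (\<lambda>\<omega>. (Y \<omega>)\<^sup>2) \<and> (\<integral>\<omega>. (Y \<omega>)\<^sup>2 \<partial>M) = 0" if "AE \<omega> in M. Y \<omega> = 0"
  proof -
    have "AE \<omega> in M. (Y \<omega>)\<^sup>2 = 0" using that by (rule AE_mp) auto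
    then show ?thesis using integrable_cong_AE[of "\<lambda>\<omega>. (Y \<omega>)\<^sup>2" M "\<lambda>_. 0"] integral_cong_AE[of "\<lambda>\<omega>. (Y \<omega>)\<^sup>2" M "\<lambda>_. 0"] by simp
  qed
  show "integrable M (\<lambda>\<omega>. (Y \<omega>)\<^sup>2)" using Y norm zero unfolding centered_gaussian_rv_def by blast
  show "(AE \<omega> in M. Y \<omega> = 0) \<Longrightarrow> (\<integral>\<omega>. (Y \<omega>)\<^sup>2 \<partial>M) = 0" using zero by blast
  assume "\<not> (AE \<omega> in M. Y \<omega> = 0)"
  then obtain \<sigma> where \<sigma>: "0 < \<sigma>" "distributed M lborel Y (normal_density 0 \<sigma>)" using Y unfolding centered_gaussian_rv_def by blast
  then show "0 < sqrt (\<integral>\<omega>. (Y \<omega>)\<^sup>2 \<partial>M) \<and> distributed M lborel Y (normal_density 0 (sqrt (\<integral>\<omega>. (Y \<omega>)\<^sup>2 \<partial>M)))"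
    using norm[OF \<sigma>] by simp
qed

text \<open>Markov's inequality for \<open>exp (\<bar>Y\<bar> / \<sigma>)\<close> with \<sigma> the
  standard deviation, using \<open>2 * exp (1/2) \<le> 4\<close>. Exponential decay suffices, as the
  deviations taken later are themselves exponentially large.\<close>

lemma gaussian_tail:
  assumes "prob_space M" and Y: "centered_gaussian_rv M Y"
  shows "measure M {\<omega>\<in>space M. l * sqrt (\<integral>\<omega>. (Y \<omega>)\<^sup>2 \<partial>M) < \<bar>Y \<omega>\<bar>} \<le> 4 * exp (- l)"
proof (cases "AE \<omega> in M. Y \<omega> = 0")
  case True
  interpret prob_space M by fact
  have "AE \<omega> in M. \<not> l * sqrt (\<integral>\<omega>. (Y \<omega>)\<^sup>2 \<partial>M) < \<bar>Y \<omega>\<bar>"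
    using True gaussian_square(3)[OF assms True] by (auto elim!: AE_mp intro!: AE_I2)
  then have "measure M {\<omega>\<in>space M. l * sqrt (\<integral>\<omega>. (Y \<omega>)\<^sup>2 \<partial>M) < \<bar>Y \<omega>\<bar>} = 0"
    by (simp add: measure_def emeasure_eq_0_AE)
  then show ?thesis by simp
next
  case False
  interpret prob_space M by fact
  have [measurable]: "Y \<in> borel_measurable M" using Y by (simp add: centered_gaussian_rv_def)
  define \<sigma> where "\<sigma> = sqrt (\<integral>\<omega>. (Y \<omega>)\<^sup>2 \<partial>M)"
  have \<sigma>: "0 < \<sigma>" "distributed M lborel Y (normal_density 0 \<sigma>)" using gaussian_square(2)[OF assms False] by (auto simp: \<sigma>_def)
  have D: "distributed M lborel (\<lambda>\<omega>. Y \<omega> / \<sigma>) std_normal_density"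
    using \<sigma> normal_standard_normal_convert[OF \<sigma>(1), of Y 0] by simp
  \<comment> \<open>Completing the square: the exponential factor moves the mean of the density to
    \<open>s\<close>, and \<open>s\<close> has square 1.\<close>
  have mgf: "(\<integral>\<^sup>+\<omega>. ennreal (exp (s * (Y \<omega> / \<sigma>))) \<partial>M) = ennreal (exp (1/2))" if "s = 1 \<or> s = -1" for s
  proof -
    have "(\<integral>\<^sup>+\<omega>. ennreal (exp (s * (Y \<omega> / \<sigma>))) \<partial>M) = (\<integral>\<^sup>+x. ennreal (std_normal_density x) * ennreal (exp (s * x)) \<partial>lborel)"
      by (rule distributed_nn_integral[OF D, symmetric]) simp
    also have "\<dots> = (\<integral>\<^sup>+x. ennreal (exp (1/2)) * ennreal (normal_density s 1 x) \<partial>lborel)"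
    proof (intro nn_integral_cong)
      fix x :: real
      have "std_normal_density x * exp (s * x) = exp (1/2) * normal_density s 1 x"
        using that unfolding normal_density_def by (auto simp: exp_add[symmetric] power2_eq_square field_simps)
      then show "ennreal (std_normal_density x) * ennreal (exp (s * x)) = ennreal (exp (1/2)) * ennreal (normal_density s 1 x)"
        by (simp add: ennreal_mult[symmetric])
    qed
    also have "\<dots> = ennreal (exp (1/2)) * (\<integral>\<^sup>+x. ennreal (normal_density s 1 x) \<partial>lborel)"
      by (rule nn_integral_cmult) simp
    also have "(\<integral>\<^sup>+x. ennreal (normal_density s 1 x) \<partial>lborel) = 1"
      by (subst nn_integral_eq_integral) auto
    finally show ?thesis by simp
  qed
  have "emeasure M {\<omega>\<in>space M. l * \<sigma> < \<bar>Y \<omega>\<bar>} = (\<integral>\<^sup>+\<omega>. indicator {\<omega>\<in>space M. l * \<sigma> < \<bar>Y \<omega>\<bar>} \<omega> \<partial>M)"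
    by simp
  also have "\<dots> \<le> (\<integral>\<^sup>+\<omega>. ennreal (exp (- l)) * (ennreal (exp (1 * (Y \<omega> / \<sigma>))) + ennreal (exp (-1 * (Y \<omega> / \<sigma>)))) \<partial>M)"
  proof (intro nn_integral_mono)
    fix \<omega>
    show "indicator {\<omega>\<in>space M. l * \<sigma> < \<bar>Y \<omega>\<bar>} \<omega> \<le>
      ennreal (exp (- l)) * (ennreal (exp (1 * (Y \<omega> / \<sigma>))) + ennreal (exp (-1 * (Y \<omega> / \<sigma>))))"
    proof (cases "l * \<sigma> < \<bar>Y \<omega>\<bar>")
      case True
      then have "l \<le> \<bar>Y \<omega> / \<sigma>\<bar>" using \<sigma>(1) by (simp add: field_simps)
      then have "exp l \<le> exp (1 * (Y \<omega> / \<sigma>)) + exp (-1 * (Y \<omega> / \<sigma>))"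
        by (smt (verit) exp_gt_zero exp_le_cancel_iff)
      then have "exp (- l) * exp l \<le> exp (- l) * (exp (1 * (Y \<omega> / \<sigma>)) + exp (-1 * (Y \<omega> / \<sigma>)))"
        by (intro mult_left_mono) auto
      then have "1 \<le> exp (- l) * (exp (1 * (Y \<omega> / \<sigma>)) + exp (-1 * (Y \<omega> / \<sigma>)))" by (simp add: exp_minus)
      then have "ennreal 1 \<le> ennreal (exp (- l) * (exp (1 * (Y \<omega> / \<sigma>)) + exp (-1 * (Y \<omega> / \<sigma>))))" by (rule ennreal_leI)
      then show ?thesis by (simp add: ennreal_mult indicator_def)
    qed simp
  qed
  also have "\<dots> = ennreal (exp (- l)) * ((\<integral>\<^sup>+\<omega>. ennreal (exp (1 * (Y \<omega> / \<sigma>))) \<partial>M) + (\<integral>\<^sup>+\<omega>. ennreal (exp (-1 * (Y \<omega> / \<sigma>))) \<partial>M))"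
    by (subst nn_integral_cmult) (simp_all add: nn_integral_add)
  also have "\<dots> = ennreal (exp (- l) * (2 * exp (1/2)))"
    using mgf[of 1] mgf[of "-1"] by (simp add: ennreal_mult flip: ennreal_plus mult_2)
  finally have "measure M {\<omega>\<in>space M. l * \<sigma> < \<bar>Y \<omega>\<bar>} \<le> exp (- l) * (2 * exp (1/2))"
    by (simp add: emeasure_eq_measure)
  also have "exp (1/2 :: real) \<le> 2"
  proof (rule power2_le_imp_le)
    have "(exp (1/2 :: real))\<^sup>2 = exp 1" by (simp add: power2_eq_square exp_add[symmetric])
    then show "(exp (1/2 :: real))\<^sup>2 \<le> 2\<^sup>2" using exp_le by simp
  qed simp
  finally show ?thesis unfolding \<sigma>_def by simp
qed

text \<open>Because \<open>sqrt (2 * pi) \<ge> 2\<close>, the density is at most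
  \<open>1 / (2 * \<sigma>)\<close>, and the interval has length \<open>2 * r\<close> wherever it is
  centred.\<close>

lemma gaussian_small_ball:
  assumes "prob_space M" and Y: "centered_gaussian_rv M Y" and pos: "0 < sqrt (\<integral>\<omega>. (Y \<omega>)\<^sup>2 \<partial>M)" and r: "0 < r"
  shows "measure M {\<omega>\<in>space M. \<bar>Y \<omega> + a\<bar> \<le> r} \<le> r / sqrt (\<integral>\<omega>. (Y \<omega>)\<^sup>2 \<partial>M)"
proof -
  interpret prob_space M by fact
  define \<sigma> where "\<sigma> = sqrt (\<integral>\<omega>. (Y \<omega>)\<^sup>2 \<partial>M)"
  have "\<not> (AE \<omega> in M. Y \<omega> = 0)" using gaussian_square(3)[OF assms(1,2)] pos by auto
  then have \<sigma>: "0 < \<sigma>" "distributed M lborel Y (normal_density 0 \<sigma>)" using gaussian_square(2)[OF assms(1,2)] by (auto simp: \<sigma>_def)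
  have "emeasure M {\<omega>\<in>space M. \<bar>Y \<omega> + a\<bar> \<le> r} = emeasure M (Y -` {-a-r..-a+r} \<inter> space M)"
    by (intro arg_cong[where f="emeasure M"]) auto
  also have "\<dots> = (\<integral>\<^sup>+x. ennreal (normal_density 0 \<sigma> x) * indicator {-a-r..-a+r} x \<partial>lborel)"
    by (rule distributed_emeasure[OF \<sigma>(2)]) simp
  also have "\<dots> \<le> (\<integral>\<^sup>+x. ennreal (1 / (2 * \<sigma>)) * indicator {-a-r..-a+r} x \<partial>lborel)"
  proof (intro nn_integral_mono mult_right_mono ennreal_leI)
    fix x :: real
    have "sqrt (2 * pi * \<sigma>\<^sup>2) \<ge> sqrt (4 * \<sigma>\<^sup>2)" using pi_ge_two by (intro real_sqrt_le_mono mult_right_mono) auto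
    moreover have "sqrt (4 * \<sigma>\<^sup>2) = 2 * \<sigma>" using \<sigma>(1) by (simp add: real_sqrt_mult)
    ultimately have s: "2 * \<sigma> \<le> sqrt (2 * pi * \<sigma>\<^sup>2)" by simp
    have "normal_density 0 \<sigma> x \<le> 1 / sqrt (2 * pi * \<sigma>\<^sup>2)"
      unfolding normal_density_def using \<sigma>(1) by (intro mult_left_le) auto
    also have "\<dots> \<le> 1 / (2 * \<sigma>)" using s \<sigma>(1) by (intro divide_left_mono) auto
    finally show "normal_density 0 \<sigma> x \<le> 1 / (2 * \<sigma>)" .
  qed auto
  also have "\<dots> = ennreal (1 / (2 * \<sigma>)) * ennreal (2 * r)"
    using r by (subst nn_integral_cmult) auto
  also have "\<dots> = ennreal (r / \<sigma>)" using \<sigma>(1) r by (simp add: ennreal_mult[symmetric])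
  finally show ?thesis using \<sigma>(1) r by (simp add: emeasure_eq_measure \<sigma>_def[symmetric])
qed

text \<open>A typical value \<open>y0\<close> of the Gaussian variable determines up to a factor \<open>L\<close> how much mass
  the shifted variable can put near the origin.\<close>

lemma gaussian_shifted_ball:
  assumes M: "prob_space M" and Y: "centered_gaussian_rv M Y"
  defines "\<sigma> \<equiv> sqrt (\<integral>\<omega>. (Y \<omega>)\<^sup>2 \<partial>M)"
  assumes S: "\<sigma> \<le> S" "0 < S" and r: "0 < r" and L: "1 \<le> L" "exp (- L / 2) \<le> r"
    and y0: "\<bar>y0\<bar> \<le> L * \<sigma> + r"
  shows "measure M {\<omega>\<in>space M. \<bar>Y \<omega> + a\<bar> \<le> r} \<le> (5 + 40 * S) * L * (r / (r + \<bar>y0 + a\<bar>))"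
proof -
  interpret prob_space M by fact
  have mY [measurable]: "Y \<in> borel_measurable M" using Y by (simp add: centered_gaussian_rv_def)
  define R where "R = \<bar>y0 + a\<bar>"
  have \<sigma>0: "0 \<le> \<sigma>" unfolding \<sigma>_def by simp
  let ?p = "measure M {\<omega>\<in>space M. \<bar>Y \<omega> + a\<bar> \<le> r}"
  \<comment> \<open>Either the trivial bound 1 suffices, or the deviation is comparable to
    \<open>R\<close> and the density bound applies, or the shift dominates and \<open>Y\<close>
    would need an exceptional deviation of at least \<open>R / 4\<close> to reach the
    origin.\<close>
  consider "R \<le> 4 * r" | "4 * r < R" "R / 4 \<le> L * \<sigma>" | "4 * r < R" "L * \<sigma> < R / 4" by linarith
  then have "\<exists>B\<le>(5 + 40 * S) * L. ?p \<le> B * (r / (r + R))"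
  proof cases
    case 1
    have "?p \<le> 1" by simp
    also have "\<dots> \<le> 5 * (r / (r + R))" using 1 r by (simp add: R_def field_simps)
    finally show ?thesis using L(1) S(2) by (intro exI[of _ 5]) (auto simp: algebra_simps intro: add_increasing2)
  next
    case 2
    have R: "0 < R" using 2 r by linarith
    then have "0 < L * \<sigma>" using 2 by linarith
    then have \<sigma>: "0 < \<sigma>" using \<sigma>0 by (metis less_eq_real_def mult_zero_right)
    have "?p \<le> r / \<sigma>" using gaussian_small_ball[OF M Y _ r, of a] \<sigma> by (simp add: \<sigma>_def)
    also have "\<dots> \<le> 4 * L * (r / R)" using 2(2) \<sigma> R r by (simp add: field_simps)
    also have "\<dots> \<le> 4 * L * (5 / 4 * (r / (r + R)))"
    proof (intro mult_left_mono)
      \<comment> \<open>The inequality \<open>4 * r < R\<close> makes \<open>R\<close> at least four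
        fifths of \<open>r + R\<close>.\<close>
      have "r / R \<le> r / (4 / 5 * (r + R))" using 2(1) r R by (intro divide_left_mono) auto
      then show "r / R \<le> 5 / 4 * (r / (r + R))" by (simp add: mult.commute)
    qed (use L in auto)
    also have "4 * L * (5 / 4 * q) = 5 * L * q" for q by simp
    finally show ?thesis using L(1) S(2) by (intro exI[of _ "5 * L"]) (auto simp: algebra_simps)
  next
    case 3
    have R: "0 < R" using 3 r by linarith
    \<comment> \<open>The exponent has two halves: \<open>L / 2\<close> yields the factor
      \<open>r\<close> through the assumption on \<open>L\<close>, and \<open>R / (8 * S)\<close>
      yields decay like \<open>S / R\<close>.\<close>
    define l where "l = (L + R / (4 * S)) / 2"
    define q where "q = R / (4 * S) * \<sigma>"
    have "q \<le> R / (4 * S) * S" unfolding q_def using S R by (intro mult_left_mono) auto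
    also have "\<dots> = R / 4" using S by simp
    finally have q: "q \<le> R / 4" .
    have "l * \<sigma> = (L * \<sigma> + q) / 2" by (simp add: l_def q_def distrib_right)
    also have "\<dots> \<le> (R / 4 + R / 4) / 2" using q 3(2) by (intro divide_right_mono add_mono) auto
    finally have "l * \<sigma> \<le> R / 4" by simp
    then have "?p \<le> measure M {\<omega>\<in>space M. l * \<sigma> < \<bar>Y \<omega>\<bar>}"
    proof (intro finite_measure_mono)
      show "{\<omega>\<in>space M. \<bar>Y \<omega> + a\<bar> \<le> r} \<subseteq> {\<omega>\<in>space M. l * \<sigma> < \<bar>Y \<omega>\<bar>}"
        using \<open>l * \<sigma> \<le> R / 4\<close> 3 y0 r unfolding R_def by auto
    qed auto
    also have "\<dots> \<le> 4 * exp (- l)" using gaussian_tail[OF M Y, of l] by (simp add: \<sigma>_def)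
    also have "exp (- l) = exp (- L / 2) * exp (- (R / (8 * S)))" by (simp add: l_def exp_add[symmetric] field_simps)
    also have "\<dots> \<le> r * (8 * S / R)"
    proof (intro mult_mono L)
      have "R / (8 * S) \<le> exp (R / (8 * S))" using exp_ge_add_one_self[of "R / (8 * S)"] by linarith
      then have "inverse (exp (R / (8 * S))) \<le> inverse (R / (8 * S))" using R S by (intro le_imp_inverse_le) auto
      then show "exp (- (R / (8 * S))) \<le> 8 * S / R" by (simp add: exp_minus)
    qed (use r in auto)
    also have "4 * (r * (8 * S / R)) = 32 * S * (r / R)" by simp
    also have "\<dots> \<le> 32 * S * (5 / 4 * (r / (r + R)))"
    proof (intro mult_left_mono)
      have "r / R \<le> r / (4 / 5 * (r + R))" using 3(1) r R by (intro divide_left_mono) auto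
      then show "r / R \<le> 5 / 4 * (r / (r + R))" by (simp add: mult.commute)
    qed (use S in auto)
    also have "32 * S * (5 / 4 * q) = 40 * S * q" for q by simp
    finally have *: "?p \<le> 40 * S * (r / (r + R))" by simp
    have "40 * S * 1 \<le> 40 * S * L" using S(2) L(1) by (intro mult_left_mono) auto
    then show ?thesis using * L(1) by (intro exI[of _ "40 * S"]) (auto simp: algebra_simps)
  qed
  then obtain B where B: "B \<le> (5 + 40 * S) * L" "?p \<le> B * (r / (r + R))" by blast
  have "B * (r / (r + R)) \<le> (5 + 40 * S) * L * (r / (r + R))" using B(1) r by (intro mult_right_mono) (auto simp: R_def)
  then show ?thesis using B(2) unfolding R_def by linarith
qed

section \<open>Uniform control of increments\<close>

text \<open>One representative is taken from each grid cell that meets \<open>E\<close>. The net has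
  to lie in \<open>E\<close>, where the modulus of the increments is known, and \<open>a\<close> has
  to be the same for all meshes.\<close>

lemma finite_net:
  fixes E :: "'a::euclidean_space set"
  assumes "bounded E"
  shows "\<exists>a\<ge>1. \<forall>\<delta>. 0 < \<delta> \<longrightarrow> \<delta> \<le> 1 \<longrightarrow>
    (\<exists>D\<subseteq>E. finite D \<and> real (card D) \<le> (a / \<delta>) ^ DIM('a) \<and> (\<forall>t\<in>E. \<exists>u\<in>D. dist t u \<le> \<delta>))"
proof -
  obtain R where R: "R > 0" "\<And>t. t \<in> E \<Longrightarrow> norm t \<le> R" using assms bounded_pos by blast
  define n where "n = real DIM('a)"
  have n: "n \<ge> 1" unfolding n_def using DIM_positive[where 'a='a] by linarith
  define a where "a = 2 * (R * n + 2) + 1"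
  have a: "a \<ge> 1" using R(1) n by (simp add: a_def)
  have "\<exists>D\<subseteq>E. finite D \<and> real (card D) \<le> (a / \<delta>) ^ DIM('a) \<and> (\<forall>t\<in>E. \<exists>u\<in>D. dist t u \<le> \<delta>)"
    if \<delta>: "0 < \<delta>" "\<delta> \<le> 1" for \<delta>
  proof -
    define h where "h = \<delta> / n"
    have h: "0 < h" using \<delta> n by (simp add: h_def)
    define L where "L = nat \<lceil>R / h\<rceil> + 1"
    have L: "R / h \<le> real L - 1" "real L \<le> R / h + 2"
      using R(1) h unfolding L_def by (simp_all add: of_nat_nat) linarith+
    define cell where "cell t = (\<lambda>b\<in>(Basis::'a set). \<lfloor>(t \<bullet> b) / h\<rfloor>)" for t
    let ?Z = "(Basis::'a set) \<rightarrow>\<^sub>E {- int L..int L}"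
    have fl_in: "\<lfloor>x\<rfloor> \<in> {- int n..int n}" if "\<bar>x\<bar> \<le> real n - 1" for x :: real and n
      using that by (simp add: le_floor_iff floor_le_iff abs_le_iff)
    have cellZ: "cell t \<in> ?Z" if "t \<in> E" for t
    proof (unfold cell_def, rule restrict_PiE_iff[THEN iffD2], rule ballI)
      fix b :: 'a assume b: "b \<in> Basis"
      have "\<bar>(t \<bullet> b) / h\<bar> = \<bar>t \<bullet> b\<bar> / h" using h by simp
      also have "\<dots> \<le> R / h" using Basis_le_norm[OF b, of t] R(2)[OF that] h by (intro divide_right_mono) auto
      also have "\<dots> \<le> real L - 1" by (rule L(1))
      finally show "\<lfloor>(t \<bullet> b) / h\<rfloor> \<in> {- int L..int L}" by (rule fl_in)
    qed
    define D where "D = (\<lambda>z. SOME t. t \<in> E \<and> cell t = z) ` (cell ` E)"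
    have rep: "(SOME s. s \<in> E \<and> cell s = cell t) \<in> E \<and> cell (SOME s. s \<in> E \<and> cell s = cell t) = cell t" if "t \<in> E" for t
      using someI[of "\<lambda>s. s \<in> E \<and> cell s = cell t" t] that by blast
    have fin: "finite ?Z" by (intro finite_PiE) auto
    have sub: "cell ` E \<subseteq> ?Z" using cellZ by blast
    have "card D \<le> card (cell ` E)" unfolding D_def using finite_subset[OF sub fin] by (rule card_image_le)
    also have "\<dots> \<le> card ?Z" by (rule card_mono[OF fin sub])
    also have "\<dots> = (2 * L + 1) ^ DIM('a)" by (simp add: card_PiE nat_add_distrib nat_mult_distrib)
    finally have "real (card D) \<le> real (2 * L + 1) ^ DIM('a)" by (metis of_nat_le_iff of_nat_power)
    also have "\<dots> \<le> (a / \<delta>) ^ DIM('a)"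
    proof (rule power_mono)
      have "real (2 * L + 1) \<le> 2 * (R / h + 2) + 1" using L(2) by simp
      also have "R / h = R * n / \<delta>" by (simp add: h_def)
      also have "2 * (R * n / \<delta> + 2) + 1 \<le> 2 * (R * n / \<delta> + 2 / \<delta>) + 1 / \<delta>"
        using \<delta> by (intro add_mono mult_left_mono) (auto simp: field_simps)
      also have "\<dots> = a / \<delta>" using \<delta> by (simp add: a_def field_simps)
      finally show "real (2 * L + 1) \<le> a / \<delta>" .
    qed simp
    finally have card: "real (card D) \<le> (a / \<delta>) ^ DIM('a)" .
    have "\<exists>u\<in>D. dist t u \<le> \<delta>" if t: "t \<in> E" for t
    proof -
      define u where "u = (SOME s. s \<in> E \<and> cell s = cell t)"
      have u: "u \<in> D" "cell u = cell t" using rep[OF t] t by (auto simp: u_def D_def)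
      have fl: "of_int \<lfloor>(t \<bullet> b) / h\<rfloor> * h \<le> t \<bullet> b" "t \<bullet> b < (of_int \<lfloor>(t \<bullet> b) / h\<rfloor> + 1) * h" for t b
        by (subst pos_le_divide_eq[OF h, symmetric] pos_divide_less_eq[OF h, symmetric], linarith)+
      have "dist t u \<le> (\<Sum>b\<in>Basis. \<bar>(t - u) \<bullet> b\<bar>)" unfolding dist_norm by (rule norm_le_l1)
      also have "\<dots> \<le> (\<Sum>b\<in>(Basis::'a set). h)"
      proof (rule sum_mono)
        fix b :: 'a assume b: "b \<in> Basis"
        then have "\<lfloor>(u \<bullet> b) / h\<rfloor> = \<lfloor>(t \<bullet> b) / h\<rfloor>" using fun_cong[OF u(2), of b] by (simp add: cell_def)
        then show "\<bar>(t - u) \<bullet> b\<bar> \<le> h"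
          using fl[of t b] fl[of u b] by (simp add: inner_diff_left algebra_simps abs_le_iff)
      qed
      also have "\<dots> = \<delta>" using n by (simp add: h_def n_def)
      finally show ?thesis using u(1) by blast
    qed
    moreover have "D \<subseteq> E" using rep by (auto simp: D_def)
    moreover have "finite D" unfolding D_def using finite_subset[OF sub fin] by simp
    ultimately show ?thesis using card by blast
  qed
  then show ?thesis using a by blast
qed

section \<open>Increments, their L2 distance and its logarithmic modulus\<close>

lemma increment_gaussian:
  assumes "centered_gaussian_field M Y" shows "centered_gaussian_rv M (\<lambda>\<omega>. Y \<omega> t - Y \<omega> s)"
proof -
  have "centered_gaussian_rv M (\<lambda>\<omega>. \<Sum>j<k. a j * Y \<omega> (p j))" for k :: nat and a p
    using assms unfolding centered_gaussian_field_def by blast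
  from this[of "\<lambda>j. if j = 0 then 1 else - 1" "\<lambda>j. if j = 0 then t else s" 2]
  show ?thesis by (simp add: numeral_2_eq_2)
qed

text \<open>The scalar counterpart of \<open>rho\<close> over an arbitrary parameter space.\<close>

definition l2dist :: "'w measure \<Rightarrow> ('w \<Rightarrow> 'a \<Rightarrow> real) \<Rightarrow> 'a \<Rightarrow> 'a \<Rightarrow> real" where
  "l2dist M Y t s = sqrt (\<integral>\<omega>. (Y \<omega> t - Y \<omega> s)\<^sup>2 \<partial>M)"

lemma l2dist_nonneg: "0 \<le> l2dist M Y t s" by (simp add: l2dist_def)

lemma l2dist_commute: "l2dist M Y t s = l2dist M Y s t"
  unfolding l2dist_def by (simp add: power2_commute)

text \<open>A substitute for Minkowski's inequality: the pointwise bound of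
  \<open>(x + y + z)\<^sup>2\<close> by three times the sum of squares is integrated, and
  \<open>3 \<le> 2\<^sup>2\<close> gives the constant, which is harmless below.\<close>

lemma l2dist_quadrangle:
  assumes "prob_space M" and Y: "centered_gaussian_field M Y"
  shows "l2dist M Y a d \<le> 2 * (l2dist M Y a b + l2dist M Y b c + l2dist M Y c d)"
proof -
  note int = gaussian_square(1)[OF assms(1) increment_gaussian[OF Y]]
  have "(\<integral>\<omega>. (Y \<omega> a - Y \<omega> d)\<^sup>2 \<partial>M) \<le> (\<integral>\<omega>. 3 * ((Y \<omega> a - Y \<omega> b)\<^sup>2 + (Y \<omega> b - Y \<omega> c)\<^sup>2 + (Y \<omega> c - Y \<omega> d)\<^sup>2) \<partial>M)"
  proof (rule integral_mono)
    fix \<omega>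
    have "(x + y + z)\<^sup>2 \<le> 3 * (x\<^sup>2 + y\<^sup>2 + z\<^sup>2)" for x y z :: real
      using sum_squares_ge_zero[of "x - y" "y - z"] zero_le_square[of "x - z"] by (simp add: power2_eq_square algebra_simps)
    from this[of "Y \<omega> a - Y \<omega> b" "Y \<omega> b - Y \<omega> c" "Y \<omega> c - Y \<omega> d"]
    show "(Y \<omega> a - Y \<omega> d)\<^sup>2 \<le> 3 * ((Y \<omega> a - Y \<omega> b)\<^sup>2 + (Y \<omega> b - Y \<omega> c)\<^sup>2 + (Y \<omega> c - Y \<omega> d)\<^sup>2)" by simp
  qed (intro int integrable_mult_right Bochner_Integration.integrable_add)+
  also have "\<dots> = 3 * ((l2dist M Y a b)\<^sup>2 + (l2dist M Y b c)\<^sup>2 + (l2dist M Y c d)\<^sup>2)"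
    unfolding l2dist_def using int by simp
  also have "\<dots> \<le> 4 * (l2dist M Y a b + l2dist M Y b c + l2dist M Y c d)\<^sup>2"
    using l2dist_nonneg[of M Y a b] l2dist_nonneg[of M Y b c] l2dist_nonneg[of M Y c d]
    by (simp add: power2_eq_square algebra_simps add_nonneg_nonneg)
  also have "\<dots> = (2 * (l2dist M Y a b + l2dist M Y b c + l2dist M Y c d))\<^sup>2" by (subst power_mult_distrib) simp
  finally have "sqrt (\<integral>\<omega>. (Y \<omega> a - Y \<omega> d)\<^sup>2 \<partial>M) \<le> sqrt ((2 * (l2dist M Y a b + l2dist M Y b c + l2dist M Y c d))\<^sup>2)"
    by (rule real_sqrt_le_mono)
  then show ?thesis unfolding l2dist_def[of M Y a d] using l2dist_nonneg[of M Y] by simp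
qed

text \<open>The parameter \<open>L\<close> replaces \<open>ln (1 / dist t s)\<close> and so avoids
  its values at distance 0 and at distances of 1 or more. The strict inequality survives small
  perturbations of \<open>t\<close> and \<open>s\<close>, which matters for closures.\<close>

definition log_modulus :: "('a::metric_space \<Rightarrow> 'a \<Rightarrow> real) \<Rightarrow> 'a set \<Rightarrow> bool" where
  "log_modulus \<rho> E \<longleftrightarrow> (\<forall>N\<ge>1. \<exists>c. \<forall>t\<in>E. \<forall>s\<in>E. \<forall>L>0. dist t s < exp (- L) \<longrightarrow> \<rho> t s \<le> c / L ^ N)"

text \<open>Each point is within a fixed L2 distance of a finite net, and the net has only finitely
  many pairs.\<close>

lemma log_modulus_bounded:
  fixes E :: "'a::euclidean_space set"
  assumes "prob_space M" and Y: "centered_gaussian_field M Y" and "bounded E" and mod: "log_modulus (l2dist M Y) E"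
  shows "\<exists>S>0. \<forall>t\<in>E. \<forall>s\<in>E. l2dist M Y t s \<le> S"
proof -
  obtain c where c: "\<And>t s. t \<in> E \<Longrightarrow> s \<in> E \<Longrightarrow> dist t s < exp (- 1) \<Longrightarrow> l2dist M Y t s \<le> c"
    using mod[unfolded log_modulus_def, rule_format, of 1] by (metis div_by_1 power_one order_refl zero_less_one)
  obtain D where D: "D \<subseteq> E" "finite D" "\<And>t. t \<in> E \<Longrightarrow> \<exists>u\<in>D. dist t u \<le> exp (- 2)"
    using finite_net[OF \<open>bounded E\<close>] by (metis exp_gt_zero exp_le_one_iff neg_le_0_iff_le zero_le_numeral)
  define m where "m = Max (insert 0 ((\<lambda>(u, v). l2dist M Y u v) ` (D \<times> D)))"
  have m: "l2dist M Y u v \<le> m" if "u \<in> D" "v \<in> D" for u v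
    unfolding m_def using D(2) that by (intro Max_ge) auto
  have "l2dist M Y t s \<le> 2 * (\<bar>c\<bar> + m + \<bar>c\<bar>) + 1" if ts: "t \<in> E" "s \<in> E" for t s
  proof -
    obtain u v where uv: "u \<in> D" "dist t u \<le> exp (- 2)" "v \<in> D" "dist s v \<le> exp (- 2)" using D(3) ts by blast
    have "exp (- 2) < exp (- 1 :: real)" by simp
    then have "dist t u < exp (- 1)" "dist s v < exp (- 1)" using uv by linarith+
    then have "l2dist M Y t u \<le> c" "l2dist M Y s v \<le> c" using uv ts D(1) by (auto intro!: c)
    then show ?thesis using l2dist_quadrangle[OF assms(1) Y, of t s u v] m[OF uv(1,3)] l2dist_commute[of M Y s v] abs_ge_self[of c]
      by (smt (verit))
  qed
  moreover have "0 \<le> m" unfolding m_def using D(2) by (intro Max_ge) auto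
  then have "0 < 2 * (\<bar>c\<bar> + m + \<bar>c\<bar>) + 1" by (intro add_nonneg_pos mult_nonneg_nonneg add_nonneg_nonneg) auto
  ultimately show ?thesis by blast
qed

text \<open>Chaining over nets of mesh \<open>exp (- 2 powr (\<epsilon>j/2))\<close>: these are still small enough for a union
  bound against a Gaussian deviation by the factor \<open>2 powr (\<epsilon>j)\<close>, and by the logarithmic modulus the increments
  along the chain are \<open>O(1/4^j)\<close>.\<close>

lemma gaussian_uniform_increments:
  fixes Y :: "'w \<Rightarrow> 'a::euclidean_space \<Rightarrow> real" and \<epsilon> :: real
  assumes M: "prob_space M" and Y: "centered_gaussian_field M Y"
    and cont: "AE \<omega> in M. continuous_on UNIV (Y \<omega>)"
    and E: "bounded E" "log_modulus (l2dist M Y) E" and \<epsilon>: "\<epsilon> > 0"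
  shows "AE \<omega> in M. \<forall>\<^sub>F k in sequentially. \<forall>t\<in>E. \<forall>s\<in>E.
    \<bar>Y \<omega> t - Y \<omega> s\<bar> \<le> 2 * 2 powr (\<epsilon> * real k) * l2dist M Y t s + (1/2)^k"
proof -
  interpret prob_space M by fact
  define x where "x j = 2 powr (\<epsilon> / 2 * real j)" for j :: nat
  have x1: "1 \<le> x j" for j unfolding x_def using \<epsilon> by (intro ge_one_powr_ge_zero) auto
  have xmono: "x j \<le> x (Suc j)" for j unfolding x_def using \<epsilon> by (intro powr_mono) auto
  obtain a where a: "a \<ge> 1" and net: "\<And>\<delta>. 0 < \<delta> \<Longrightarrow> \<delta> \<le> 1 \<Longrightarrow>
    \<exists>D\<subseteq>E. finite D \<and> real (card D) \<le> (a / \<delta>) ^ DIM('a) \<and> (\<forall>t\<in>E. \<exists>u\<in>D. dist t u \<le> \<delta>)"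
    using finite_net[OF E(1)] by blast
  \<comment> \<open>The factor 1/4 keeps \<open>\<delta> j + \<delta> (Suc j)\<close> below
    \<open>exp (- x j)\<close>, so the modulus applies to consecutive links of a chain.\<close>
  define \<delta> where "\<delta> j = exp (- x j) / 4" for j
  have \<delta>: "0 < \<delta> j" "\<delta> j \<le> 1" for j
  proof -
    have "exp (- x j) \<le> 1" using x1[of j] by simp
    then show "0 < \<delta> j" "\<delta> j \<le> 1" unfolding \<delta>_def using exp_gt_zero[of "- x j"] by linarith+
  qed
  have "\<exists>D\<subseteq>E. finite D \<and> real (card D) \<le> (a / \<delta> j) ^ DIM('a) \<and> (\<forall>t\<in>E. \<exists>u\<in>D. dist t u \<le> \<delta> j)" for j
    by (rule net[OF \<delta>])
  then obtain D where D: "\<And>j. D j \<subseteq> E" "\<And>j. finite (D j)" "\<And>j. real (card (D j)) \<le> (a / \<delta> j) ^ DIM('a)"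
    and D': "\<And>j t. t \<in> E \<Longrightarrow> \<exists>u\<in>D j. dist t u \<le> \<delta> j" by metis
  define p where "p j t = (SOME u. u \<in> D j \<and> dist t u \<le> \<delta> j)" for j t
  have "p j t \<in> D j \<and> dist t (p j t) \<le> \<delta> j" if "t \<in> E" for j t
    unfolding p_def using D'[OF that, of j] by (intro someI_ex[of "\<lambda>u. u \<in> D j \<and> dist t u \<le> \<delta> j"]) blast
  then have p: "\<And>j t. t \<in> E \<Longrightarrow> p j t \<in> D j" "\<And>j t. t \<in> E \<Longrightarrow> dist t (p j t) \<le> \<delta> j" by blast+
  \<comment> \<open>Pairs within one net and pairs across consecutive nets are both needed: the
    former compare \<open>p k t\<close> with \<open>p k s\<close>, the latter form the
    chain.\<close>
  define U where "U j = (D j \<union> D (Suc j)) \<times> (D j \<union> D (Suc j))" for j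
  have finU: "finite (U j)" for j using D(2) by (simp add: U_def)
  define bad where "bad j w = {\<omega>\<in>space M. 2 powr (\<epsilon> * real j) * l2dist M Y (fst w) (snd w) < \<bar>Y \<omega> (fst w) - Y \<omega> (snd w)\<bar>}" for j w
  have badm [measurable]: "bad j w \<in> sets M" for j w
  proof -
    have [measurable]: "(\<lambda>\<omega>. Y \<omega> (fst w) - Y \<omega> (snd w)) \<in> borel_measurable M"
      using increment_gaussian[OF Y] by (simp add: centered_gaussian_rv_def)
    show ?thesis unfolding bad_def by measurable
  qed
  define A where "A j = (\<Union>w\<in>U j. bad j w)" for j
  have Am [measurable]: "A j \<in> sets M" for j unfolding A_def using finU by (intro sets.finite_UN) auto
  define n where "n = real DIM('a)"
  have n: "n > 0" by (simp add: n_def)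
  define B where "B = 2 * (4 * a) ^ DIM('a)"
  have B: "B > 0" using a by (simp add: B_def)
  have probA: "prob (A j) \<le> (B * exp (n * x (Suc j)))\<^sup>2 * (4 * exp (- (2 powr (\<epsilon> * real j))))" for j
  proof -
    have cD: "real (card (D i)) \<le> (4 * a) ^ DIM('a) * exp (n * x (Suc j))" if "i = j \<or> i = Suc j" for i
    proof -
      have "x i \<le> x (Suc j)" using that xmono by auto
      have "a / \<delta> i = 4 * a * exp (x i)" by (simp add: \<delta>_def exp_minus field_simps)
      then have "real (card (D i)) \<le> (4 * a) ^ DIM('a) * exp (x i) ^ DIM('a)" using D(3)[of i] by (simp add: power_mult_distrib)
      also have "\<dots> \<le> (4 * a) ^ DIM('a) * exp (x (Suc j)) ^ DIM('a)"
        using \<open>x i \<le> x (Suc j)\<close> a by (intro mult_left_mono power_mono) auto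
      also have "exp (x (Suc j)) ^ DIM('a) = exp (n * x (Suc j))" by (simp add: n_def exp_of_nat_mult)
      finally show ?thesis .
    qed
    have "real (card (D j \<union> D (Suc j))) \<le> real (card (D j)) + real (card (D (Suc j)))"
      using card_Un_le[of "D j" "D (Suc j)"] by linarith
    also have "\<dots> \<le> B * exp (n * x (Suc j))" using cD[of j] cD[of "Suc j"] by (simp add: B_def)
    finally have cU: "real (card (U j)) \<le> (B * exp (n * x (Suc j)))\<^sup>2"
      unfolding U_def by (simp add: card_cartesian_product power2_eq_square mult_mono)
    have "prob (A j) \<le> (\<Sum>w\<in>U j. prob (bad j w))" unfolding A_def using finU by (intro finite_measure_subadditive_finite) auto
    also have "\<dots> \<le> (\<Sum>w\<in>U j. 4 * exp (- (2 powr (\<epsilon> * real j))))"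
      unfolding bad_def l2dist_def by (intro sum_mono gaussian_tail[OF M increment_gaussian[OF Y]])
    also have "\<dots> \<le> (B * exp (n * x (Suc j)))\<^sup>2 * (4 * exp (- (2 powr (\<epsilon> * real j))))"
      using cU by (simp add: mult_right_mono)
    finally show ?thesis .
  qed
  have "summable (\<lambda>j. prob (A j))"
  proof (rule summable_comparison_test')
    \<comment> \<open>The tail exponent \<open>2 powr (\<epsilon> * j)\<close> is the square of
      \<open>x j\<close>, while the number of pairs is exponential only in a constant multiple of
      \<open>x j\<close>.\<close>
    have o: "(\<lambda>j. (B * exp (n * x (Suc j)))\<^sup>2 * (4 * exp (- (2 powr (\<epsilon> * real j))))) \<in> O(\<lambda>j. (1/2)^j)"
      unfolding x_def using \<epsilon> B n by real_asymp
    show "summable (\<lambda>j. (B * exp (n * x (Suc j)))\<^sup>2 * (4 * exp (- (2 powr (\<epsilon> * real j)))))"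
      by (rule summable_comparison_test_bigo[OF _ o]) (simp add: norm_power summable_geometric)
    show "norm (prob (A j)) \<le> (B * exp (n * x (Suc j)))\<^sup>2 * (4 * exp (- (2 powr (\<epsilon> * real j))))" if "j \<ge> 0" for j
      using probA[of j] by simp
  qed
  then have AEA: "AE \<omega> in M. \<forall>\<^sub>F j in sequentially. \<omega> \<in> space M - A j"
    by (intro borel_cantelli_AE1) (auto simp: emeasure_eq_measure less_top[symmetric])
  \<comment> \<open>With this power of the logarithm, \<open>x j ^ N\<close> dominates
    \<open>2 powr ((2 + \<epsilon>) * j)\<close>; after multiplication by the deviation factor a
    decay of \<open>(1/4)^j\<close> is left.\<close>
  define N where "N = nat \<lceil>2 * (2 + \<epsilon>) / \<epsilon>\<rceil>"
  have N: "2 + \<epsilon> \<le> real N * (\<epsilon> / 2)"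
  proof -
    have "2 * (2 + \<epsilon>) / \<epsilon> \<le> real N" unfolding N_def by (rule real_nat_ceiling_ge)
    then show ?thesis using \<epsilon> by (simp add: field_simps)
  qed
  have N1: "1 \<le> N"
  proof (rule ccontr)
    assume "\<not> 1 \<le> N"
    then have "N = 0" by simp
    then show False using N \<epsilon> by simp
  qed
  obtain c0 where c0: "\<And>t s L. t \<in> E \<Longrightarrow> s \<in> E \<Longrightarrow> 0 < L \<Longrightarrow> dist t s < exp (- L) \<Longrightarrow> l2dist M Y t s \<le> c0 / L ^ N"
    using E(2)[unfolded log_modulus_def, rule_format, OF N1] by metis
  define c where "c = max c0 0"
  have cc: "0 \<le> c" by (simp add: c_def)
  have near: "2 powr (\<epsilon> * real j) * l2dist M Y t s \<le> c * (1/4)^j" if "t \<in> E" "s \<in> E" "dist t s < exp (- x j)" for t s j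
  proof -
    have "l2dist M Y t s \<le> c0 / x j ^ N" using c0[OF that(1,2) _ that(3)] x1[of j] by linarith
    also have "\<dots> \<le> c / x j ^ N" using x1[of j] by (intro divide_right_mono) (auto simp: c_def)
    also have "x j ^ N = 2 powr (\<epsilon> / 2 * real j * real N)"
      unfolding x_def by (simp add: powr_realpow[symmetric] powr_powr)
    also have "c / 2 powr (\<epsilon> / 2 * real j * real N) \<le> c / 2 powr ((2 + \<epsilon>) * real j)"
    proof -
      have "(2 + \<epsilon>) * real j \<le> real N * (\<epsilon> / 2) * real j" using N by (intro mult_right_mono) auto
      then have "2 powr ((2 + \<epsilon>) * real j) \<le> 2 powr (\<epsilon> / 2 * real j * real N)" by (intro powr_mono) (auto simp: mult_ac)
      then show ?thesis using cc by (intro divide_left_mono) auto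
    qed
    finally have "2 powr (\<epsilon> * real j) * l2dist M Y t s \<le> 2 powr (\<epsilon> * real j) * (c / 2 powr ((2 + \<epsilon>) * real j))"
      by (intro mult_left_mono) auto
    also have "\<dots> = c * 2 powr (\<epsilon> * real j - (2 + \<epsilon>) * real j)" by (simp add: powr_diff)
    also have "\<epsilon> * real j - (2 + \<epsilon>) * real j = - (2 * real j)" by (simp add: algebra_simps)
    also have "2 powr (- (2 * real j)) = (1/4::real)^j"
    proof -
      have "2 powr (- (2 * real j)) = (2 powr (- 2)) powr real j" by (simp only: powr_powr) simp
      also have "\<dots> = (2 powr (- 2)) ^ j" by (rule powr_realpow) simp
      also have "2 powr (- 2 :: real) = 1/4" by (simp add: powr_minus)
      finally show ?thesis .
    qed
    finally show ?thesis .
  qed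
  from AEA cont show ?thesis
  proof eventually_elim
    case (elim \<omega>)
    obtain j0 where j0: "\<And>j. j \<ge> j0 \<Longrightarrow> \<omega> \<in> space M - A j" using elim(1) unfolding eventually_sequentially by blast
    have inc: "\<bar>Y \<omega> u - Y \<omega> v\<bar> \<le> 2 powr (\<epsilon> * real j) * l2dist M Y u v"
      if "j \<ge> j0" "u \<in> D j \<union> D (Suc j)" "v \<in> D j \<union> D (Suc j)" for j u v
    proof -
      have "(u, v) \<in> U j" using that by (simp add: U_def)
      then have "\<omega> \<notin> bad j (u, v)" using j0[OF that(1)] by (auto simp: A_def)
      then show ?thesis using j0[OF that(1)] by (auto simp: bad_def not_less)
    qed
    have step: "\<bar>Y \<omega> (p (Suc j) t) - Y \<omega> (p j t)\<bar> \<le> c * (1/4)^j" if "j \<ge> j0" "t \<in> E" for j t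
    proof -
      have "\<bar>Y \<omega> (p (Suc j) t) - Y \<omega> (p j t)\<bar> \<le> 2 powr (\<epsilon> * real j) * l2dist M Y (p (Suc j) t) (p j t)"
        using p(1)[OF that(2)] by (intro inc that(1)) auto
      also have "\<dots> \<le> c * (1/4)^j"
      proof (rule near)
        show "p (Suc j) t \<in> E" "p j t \<in> E" using p(1)[OF that(2)] D(1) by blast+
        have "exp (- x (Suc j)) \<le> exp (- x j)" using xmono[of j] by simp
        then have "\<delta> (Suc j) + \<delta> j < exp (- x j)" using exp_gt_zero[of "- x j"] unfolding \<delta>_def by linarith
        moreover have "dist (p (Suc j) t) (p j t) \<le> dist t (p (Suc j) t) + dist t (p j t)" by (rule dist_triangle3)
        ultimately show "dist (p (Suc j) t) (p j t) < exp (- x j)"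
          using p(2)[OF that(2), of j] p(2)[OF that(2), of "Suc j"] by linarith
      qed
      finally show ?thesis .
    qed
    \<comment> \<open>The subtracted term makes the geometric bound inductive.\<close>
    have chain: "\<bar>Y \<omega> (p (k + m) t) - Y \<omega> (p k t)\<bar> \<le> 2 * c * (1/4)^k - 2 * c * (1/4)^(k+m)" if "k \<ge> j0" "t \<in> E" for k m t
    proof (induction m)
      case (Suc m)
      have "\<bar>Y \<omega> (p (Suc (k + m)) t) - Y \<omega> (p (k + m) t)\<bar> \<le> c * (1/4)^(k+m)" using that by (intro step) auto
      moreover have "0 \<le> c * (1/4)^(k+m)" using cc by simp
      ultimately show ?case using Suc by simp
    qed simp
    \<comment> \<open>Probability controls only the countably many net points; continuity of the
      path extends the bound to all of \<open>E\<close>.\<close>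
    have lim: "\<bar>Y \<omega> t - Y \<omega> (p k t)\<bar> \<le> 2 * c * (1/4)^k" if "k \<ge> j0" "t \<in> E" for k t
    proof (rule LIMSEQ_le_const2)
      have "\<delta> \<longlonglongrightarrow> 0"
      proof -
        have "(\<lambda>j. exp (- (2 powr (\<epsilon> / 2 * real j))) / 4) \<longlonglongrightarrow> 0" using \<epsilon> by real_asymp
        then show ?thesis unfolding \<delta>_def x_def .
      qed
      then have "(\<lambda>j. dist (p j t) t) \<longlonglongrightarrow> 0"
        by (rule tendsto_sandwich[OF _ _ tendsto_const, rotated 2]) (use p(2)[OF that(2)] in \<open>auto simp: dist_commute\<close>)
      then have "(\<lambda>j. p j t) \<longlonglongrightarrow> t" by (subst tendsto_dist_iff)
      then have "(\<lambda>j. p (j + k) t) \<longlonglongrightarrow> t" by (rule LIMSEQ_ignore_initial_segment)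
      then have "(\<lambda>j. Y \<omega> (p (j + k) t)) \<longlonglongrightarrow> Y \<omega> t"
        using elim(2) by (intro continuous_on_tendsto_compose[OF elim(2)]) auto
      then show "(\<lambda>j. \<bar>Y \<omega> (p (j + k) t) - Y \<omega> (p k t)\<bar>) \<longlonglongrightarrow> \<bar>Y \<omega> t - Y \<omega> (p k t)\<bar>" by (intro tendsto_intros)
      have "\<bar>Y \<omega> (p (m + k) t) - Y \<omega> (p k t)\<bar> \<le> 2 * c * (1/4)^k" for m
      proof -
        have "0 \<le> 2 * c * (1/4)^(k+m)" using cc by simp
        then show ?thesis using chain[OF that, of m] by (simp add: add.commute)
      qed
      then show "\<exists>N. \<forall>n\<ge>N. \<bar>Y \<omega> (p (n + k) t) - Y \<omega> (p k t)\<bar> \<le> 2 * c * (1/4)^k" by blast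
    qed
    \<comment> \<open>Two chains cost \<open>2 * c\<close> each, and replacing \<open>t\<close> and
      \<open>s\<close> by their net points in the L2 distance costs \<open>4 * c\<close>
      more.\<close>
    have "\<forall>\<^sub>F k in sequentially. 8 * c * (1/4)^k \<le> (1/2)^k" by real_asymp
    moreover have "\<forall>\<^sub>F k in sequentially. k \<ge> j0" by (rule eventually_ge_at_top)
    ultimately show ?case
    proof eventually_elim
      case (elim k)
      show ?case
      proof (intro ballI)
        fix t s assume ts: "t \<in> E" "s \<in> E"
        let ?e = "2 powr (\<epsilon> * real k)" and ?\<rho> = "l2dist M Y"
        have nr: "?e * ?\<rho> (p k u) u \<le> c * (1/4)^k" if "u \<in> E" for u
        proof (rule near)
          show "p k u \<in> E" using p(1)[OF that] D(1) by blast
          show "dist (p k u) u < exp (- x k)" using p(2)[OF that, of k] exp_gt_zero[of "- x k"] dist_commute[of u "p k u"] unfolding \<delta>_def by linarith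
        qed (rule that)
        have "\<bar>Y \<omega> (p k t) - Y \<omega> (p k s)\<bar> \<le> ?e * ?\<rho> (p k t) (p k s)"
          using p(1)[OF ts(1)] p(1)[OF ts(2)] elim(2) by (intro inc) auto
        also have "\<dots> \<le> ?e * (2 * (?\<rho> (p k t) t + ?\<rho> t s + ?\<rho> s (p k s)))"
          by (intro mult_left_mono l2dist_quadrangle[OF M Y]) auto
        also have "\<dots> = 2 * (?e * ?\<rho> (p k t) t) + 2 * ?e * ?\<rho> t s + 2 * (?e * ?\<rho> (p k s) s)"
          by (simp add: algebra_simps l2dist_commute[of M Y s])
        finally have "\<bar>Y \<omega> (p k t) - Y \<omega> (p k s)\<bar> \<le> 2 * ?e * ?\<rho> t s + 4 * (c * (1/4)^k)"
          using nr[OF ts(1)] nr[OF ts(2)] by linarith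
        then show "\<bar>Y \<omega> t - Y \<omega> s\<bar> \<le> 2 * ?e * ?\<rho> t s + (1/2)^k"
          using lim[OF elim(2) ts(1)] lim[OF elim(2) ts(2)] elim(1) by linarith
      qed
    qed
  qed
qed

section \<open>Images and graphs of regular Gaussian fields\<close>

lemma prod_kernel_vec:
  "prod_kernel r x y = (\<Prod>i\<in>UNIV. r / (r + \<bar>x $ i - y $ i\<bar>))" for x y :: "real^'d"
proof -
  have "(Basis :: (real^'d) set) = range (\<lambda>i. axis i 1)" by (auto simp: Basis_vec_def)
  moreover have "inj (\<lambda>i::'d. axis i (1::real))" by (auto simp: inj_on_def axis_eq_axis)
  ultimately have "prod_kernel r x y = (\<Prod>i\<in>UNIV. r / (r + \<bar>(x - y) \<bullet> axis (i::'d) 1\<bar>))"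
    unfolding prod_kernel_def by (subst \<open>Basis = _\<close>, subst prod.reindex) (simp_all add: o_def)
  then show ?thesis by (simp add: inner_axis)
qed

lemma prod_kernel_Pair:
  "prod_kernel r (x, y) (x', y') = prod_kernel r x x' * prod_kernel r y y'"
  for x x' :: "'a::euclidean_space" and y y' :: "'b::euclidean_space"
proof -
  let ?A = "(\<lambda>u::'a. (u, 0::'b)) ` Basis" and ?B = "(\<lambda>v::'b. (0::'a, v)) ` Basis"
  let ?g = "\<lambda>b. r / (r + \<bar>((x, y) - (x', y')) \<bullet> b\<bar>)"
  have "prod_kernel r (x, y) (x', y') = (\<Prod>b\<in>?A \<union> ?B. ?g b)" unfolding prod_kernel_def Basis_prod_def ..
  also have "\<dots> = (\<Prod>b\<in>?A. ?g b) * (\<Prod>b\<in>?B. ?g b)" by (rule prod.union_disjoint) (auto dest: nonzero_Basis)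
  also have "(\<Prod>b\<in>?A. ?g b) = prod_kernel r x x'"
    unfolding prod_kernel_def by (subst prod.reindex) (auto simp: inj_on_def)
  also have "(\<Prod>b\<in>?B. ?g b) = prod_kernel r y y'"
    unfolding prod_kernel_def by (subst prod.reindex) (auto simp: inj_on_def)
  finally show ?thesis .
qed

lemma prod_kernel_ge:
  fixes x y :: "'a::euclidean_space"
  assumes "0 < r" "dist x y \<le> r" shows "(1/2) ^ DIM('a) \<le> prod_kernel r x y"
proof -
  have "(\<Prod>b\<in>(Basis::'a set). 1/2) \<le> prod_kernel r x y" unfolding prod_kernel_def
  proof (intro prod_mono conjI)
    fix b :: 'a assume "b \<in> Basis"
    then have "\<bar>(x - y) \<bullet> b\<bar> \<le> r" using Basis_le_norm[of b "x - y"] assms(2) by (simp add: dist_norm)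
    then show "1/2 \<le> r / (r + \<bar>(x - y) \<bullet> b\<bar>)" using assms(1) by (simp add: field_simps)
  qed simp
  then show ?thesis by simp
qed

text \<open>The ball lies in a cube, whose probability factorizes by independence. In each factor
  the observed increment \<open>x $ i - y $ i\<close> is the typical value and
  \<open>a $ i - b $ i\<close> the shift for \<open>gaussian_shifted_ball\<close>.\<close>

lemma field_ball_le_prod_kernel:
  fixes X :: "'w \<Rightarrow> 'a \<Rightarrow> real^'d" and x y a b :: "real^'d"
  assumes M: "prob_space M" and X: "\<And>i. centered_gaussian_field M (\<lambda>\<omega> t. X \<omega> t $ i)"
    and ind: "prob_space.indep_vars M (\<lambda>_. Pi\<^sub>M UNIV (\<lambda>_. borel)) (\<lambda>i \<omega> t. X \<omega> t $ i) UNIV"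
    and S: "\<And>i. l2dist M (\<lambda>\<omega> t. X \<omega> t $ i) t s \<le> S" "0 < S" and r: "0 < r" and L: "1 \<le> L" "exp (- L / 2) \<le> r"
    and xy: "\<And>i. \<bar>x $ i - y $ i\<bar> \<le> L * l2dist M (\<lambda>\<omega> t. X \<omega> t $ i) t s + r"
  shows "measure M {\<omega>\<in>space M. dist (X \<omega> t + a) (X \<omega> s + b) \<le> r}
    \<le> ((5 + 40 * S) * L) ^ CARD('d) * prod_kernel r (x + a) (y + b)"
proof -
  interpret prob_space M by fact
  define Y where "Y i \<omega> = X \<omega> t $ i - X \<omega> s $ i" for i \<omega>
  have Yg: "centered_gaussian_rv M (Y i)" for i unfolding Y_def using increment_gaussian[OF X[of i], of t s] .
  then have Ym [measurable]: "Y i \<in> borel_measurable M" for i by (simp add: centered_gaussian_rv_def)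
  have "indep_vars (\<lambda>_. borel) (\<lambda>i \<omega>. (\<lambda>g. g t - g s) ((\<lambda>t. X \<omega> t $ i))) UNIV"
    by (rule indep_vars_compose2[OF ind]) measurable
  then have Yi: "indep_vars (\<lambda>_. borel) Y UNIV" unfolding Y_def by simp
  let ?J = "\<lambda>i. {u. \<bar>u + (a $ i - b $ i)\<bar> \<le> r}"
  have J: "?J i \<in> sets borel" for i by measurable
  have "measure M {\<omega>\<in>space M. dist (X \<omega> t + a) (X \<omega> s + b) \<le> r} \<le> prob (\<Inter>i\<in>UNIV. Y i -` ?J i \<inter> space M)"
  proof (rule finite_measure_mono)
    show "{\<omega>\<in>space M. dist (X \<omega> t + a) (X \<omega> s + b) \<le> r} \<subseteq> (\<Inter>i\<in>UNIV. Y i -` ?J i \<inter> space M)"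
    proof (intro subsetI INT_I IntI vimageI2 CollectI)
      fix \<omega> i assume "\<omega> \<in> {\<omega>\<in>space M. dist (X \<omega> t + a) (X \<omega> s + b) \<le> r}"
      then have "dist (X \<omega> t + a) (X \<omega> s + b) \<le> r" by simp
      moreover have "\<bar>((X \<omega> t + a) - (X \<omega> s + b)) $ i\<bar> \<le> dist (X \<omega> t + a) (X \<omega> s + b)"
        unfolding dist_norm by (rule component_le_norm_cart)
      ultimately show "\<bar>Y i \<omega> + (a $ i - b $ i)\<bar> \<le> r" by (simp add: Y_def algebra_simps)
    qed simp
    show "(\<Inter>i\<in>UNIV. Y i -` ?J i \<inter> space M) \<in> sets M" by (intro sets.finite_INT measurable_sets[OF Ym J]) auto
  qed
  also have "\<dots> = (\<Prod>i\<in>UNIV. prob (Y i -` ?J i \<inter> space M))"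
    using indep_varsD[OF Yi, of UNIV ?J] J by auto
  also have "\<dots> \<le> (\<Prod>i\<in>UNIV. (5 + 40 * S) * L * (r / (r + \<bar>(x + a) $ i - (y + b) $ i\<bar>)))"
  proof (intro prod_mono conjI measure_nonneg)
    fix i
    have l: "sqrt (\<integral>\<omega>. (Y i \<omega>)\<^sup>2 \<partial>M) = l2dist M (\<lambda>\<omega> t. X \<omega> t $ i) t s" by (simp add: Y_def l2dist_def)
    have "Y i -` ?J i \<inter> space M = {\<omega>\<in>space M. \<bar>Y i \<omega> + (a $ i - b $ i)\<bar> \<le> r}" by auto
    then have "prob (Y i -` ?J i \<inter> space M) = prob {\<omega>\<in>space M. \<bar>Y i \<omega> + (a $ i - b $ i)\<bar> \<le> r}" by simp
    also have "\<dots> \<le> (5 + 40 * S) * L * (r / (r + \<bar>x $ i - y $ i + (a $ i - b $ i)\<bar>))"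
      using gaussian_shifted_ball[OF M Yg[of i], unfolded l, OF S r L xy[of i]] .
    also have "x $ i - y $ i + (a $ i - b $ i) = (x + a) $ i - (y + b) $ i" by simp
    finally show "prob (Y i -` ?J i \<inter> space M) \<le> (5 + 40 * S) * L * (r / (r + \<bar>(x + a) $ i - (y + b) $ i\<bar>))" .
  qed
  also have "\<dots> = ((5 + 40 * S) * L) ^ CARD('d) * prod_kernel r (x + a) (y + b)"
    unfolding prod_kernel_vec by (subst prod.distrib) simp
  finally show ?thesis .
qed

text \<open>Lower semicontinuity of the L2 distance, by Fatou's lemma along continuous
  paths.\<close>

lemma l2dist_le_closure:
  fixes Y :: "'w \<Rightarrow> 'a::metric_space \<Rightarrow> real"
  assumes M: "prob_space M" and Y: "centered_gaussian_field M Y" and cont: "AE \<omega> in M. continuous_on UNIV (Y \<omega>)"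
    and t: "u \<longlonglongrightarrow> t" and s: "v \<longlonglongrightarrow> s" and B: "\<forall>\<^sub>F m in sequentially. l2dist M Y (u m) (v m) \<le> B"
  shows "l2dist M Y t s \<le> B"
proof -
  interpret prob_space M by fact
  have ms: "(\<lambda>\<omega>. (Y \<omega> p - Y \<omega> q)\<^sup>2) \<in> borel_measurable M" for p q
    using gaussian_square(1)[OF M increment_gaussian[OF Y, of p q]] by auto
  obtain m where "l2dist M Y (u m) (v m) \<le> B" using eventually_happens'[OF _ B] sequentially_bot by blast
  then have B0: "0 \<le> B" using l2dist_nonneg[of M Y "u m" "v m"] by linarith
  have sq: "(\<integral>\<^sup>+\<omega>. ennreal ((Y \<omega> p - Y \<omega> q)\<^sup>2) \<partial>M) = ennreal ((l2dist M Y p q)\<^sup>2)" for p q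
    unfolding l2dist_def by (subst nn_integral_eq_integral[OF gaussian_square(1)[OF M increment_gaussian[OF Y]]]) auto
  have "ennreal ((l2dist M Y t s)\<^sup>2) = (\<integral>\<^sup>+\<omega>. ennreal ((Y \<omega> t - Y \<omega> s)\<^sup>2) \<partial>M)" by (rule sq[symmetric])
  also have "\<dots> = (\<integral>\<^sup>+\<omega>. liminf (\<lambda>m. ennreal ((Y \<omega> (u m) - Y \<omega> (v m))\<^sup>2)) \<partial>M)"
  proof (rule nn_integral_cong_AE, use cont in eventually_elim)
    case (elim \<omega>)
    have "(\<lambda>m. Y \<omega> (u m)) \<longlonglongrightarrow> Y \<omega> t" "(\<lambda>m. Y \<omega> (v m)) \<longlonglongrightarrow> Y \<omega> s"
      using t s by (auto intro: continuous_on_tendsto_compose[OF elim])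
    then have "(\<lambda>m. ennreal ((Y \<omega> (u m) - Y \<omega> (v m))\<^sup>2)) \<longlonglongrightarrow> ennreal ((Y \<omega> t - Y \<omega> s)\<^sup>2)"
      by (intro tendsto_ennrealI tendsto_intros)
    from lim_imp_Liminf[OF _ this] show ?case by simp
  qed
  also have "\<dots> \<le> liminf (\<lambda>m. \<integral>\<^sup>+\<omega>. ennreal ((Y \<omega> (u m) - Y \<omega> (v m))\<^sup>2) \<partial>M)"
    using ms by (intro nn_integral_liminf) auto
  also have "\<dots> \<le> liminf (\<lambda>m. ennreal (B\<^sup>2))"
    using B by (intro Liminf_mono) (auto simp: sq elim!: eventually_mono intro!: ennreal_leI power_mono l2dist_nonneg)
  also have "\<dots> = ennreal (B\<^sup>2)" by (rule Liminf_const) simp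
  finally have "(l2dist M Y t s)\<^sup>2 \<le> B\<^sup>2" by simp
  then show ?thesis using B0 by (rule power2_le_imp_le)
qed

text \<open>The pieces in the definition of regularity are arbitrary sets. Closing them keeps the
  modulus and makes their intersections with an analytic set Souslin.\<close>

lemma log_modulus_closure:
  fixes Y :: "'w \<Rightarrow> 'a::metric_space \<Rightarrow> real"
  assumes M: "prob_space M" and Y: "centered_gaussian_field M Y" and cont: "AE \<omega> in M. continuous_on UNIV (Y \<omega>)"
    and mod: "log_modulus (l2dist M Y) E"
  shows "log_modulus (l2dist M Y) (closure E)"
  unfolding log_modulus_def
proof (intro allI impI)
  fix N :: nat assume "1 \<le> N"
  then obtain c where c: "\<And>t s L. t \<in> E \<Longrightarrow> s \<in> E \<Longrightarrow> 0 < L \<Longrightarrow> dist t s < exp (- L) \<Longrightarrow> l2dist M Y t s \<le> c / L ^ N"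
    using mod unfolding log_modulus_def by metis
  have "l2dist M Y t s \<le> c / L ^ N" if "t \<in> closure E" "s \<in> closure E" "0 < L" "dist t s < exp (- L)" for t s L
  proof -
    obtain u v where u: "\<And>m. u m \<in> E" "u \<longlonglongrightarrow> t" and v: "\<And>m. v m \<in> E" "v \<longlonglongrightarrow> s"
      using \<open>t \<in> closure E\<close> \<open>s \<in> closure E\<close> unfolding closure_sequential by blast
    have "(\<lambda>m. dist (u m) (v m)) \<longlonglongrightarrow> dist t s" using u v by (intro tendsto_intros)
    then have "\<forall>\<^sub>F m in sequentially. dist (u m) (v m) < exp (- L)" using that(4) by (rule order_tendstoD)
    then have "\<forall>\<^sub>F m in sequentially. l2dist M Y (u m) (v m) \<le> c / L ^ N"
      by (rule eventually_mono) (use c u v that in auto)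
    then show ?thesis by (rule l2dist_le_closure[OF M Y cont u(2) v(2)])
  qed
  then show "\<exists>c. \<forall>t\<in>closure E. \<forall>s\<in>closure E. \<forall>L>0. dist t s < exp (- L) \<longrightarrow> l2dist M Y t s \<le> c / L ^ N" by blast
qed

lemma rho_eq_l2dist: "rho M X i t s = l2dist M (\<lambda>\<omega> t. X \<omega> t $ i) t s"
  by (simp add: rho_def l2dist_def)

text \<open>At distances above 1 the logarithm is negative, so the bound with exponent 1 would be
  negative too; a regular piece therefore has diameter at most 1.\<close>

lemma regular_piece:
  fixes E :: "(real^'n) set" and X :: "'w \<Rightarrow> real^'n \<Rightarrow> real^'d"
  assumes reg: "\<And>N::nat. N \<ge> 1 \<Longrightarrow> \<exists>c>0. \<forall>t\<in>E. \<forall>s\<in>E. \<forall>i. rho M X i t s \<le> c / (ln (1 / dist t s)) ^ N"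
  shows "bounded E" "log_modulus (l2dist M (\<lambda>\<omega> t. X \<omega> t $ i)) E"
proof -
  obtain c where c: "c > 0" "\<And>t s i. t \<in> E \<Longrightarrow> s \<in> E \<Longrightarrow> rho M X i t s \<le> c / ln (1 / dist t s)"
    using reg[of 1] by auto
  have "dist t s \<le> 1" if "t \<in> E" "s \<in> E" for t s
  proof (rule ccontr)
    assume "\<not> ?thesis"
    then have "ln (1 / dist t s) < 0" by (intro ln_less_zero) (auto simp: divide_less_eq intro: less_trans[of 0 1])
    then have "c / ln (1 / dist t s) < 0" using c(1) by (simp add: divide_pos_neg)
    moreover have "0 \<le> rho M X i t s" by (simp add: rho_def)
    ultimately show False using c(2)[OF that, of i] by linarith
  qed
  then show "bounded E" by (cases "E = {}") (auto simp: bounded_def, blast)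
  show "log_modulus (l2dist M (\<lambda>\<omega> t. X \<omega> t $ i)) E"
    unfolding log_modulus_def
  proof (intro allI impI)
    fix N :: nat assume "1 \<le> N"
      obtain c where c: "c > 0" "\<And>t s i. t \<in> E \<Longrightarrow> s \<in> E \<Longrightarrow> rho M X i t s \<le> c / ln (1 / dist t s) ^ N"
        using reg[OF \<open>N \<ge> 1\<close>] by blast
      have "rho M X i t s \<le> c / L ^ N" if ts: "t \<in> E" "s \<in> E" and L: "L > 0" "dist t s < exp (- L)" for t s L
      proof (cases "t = s")
        case True
        then show ?thesis using c(1) L by (simp add: rho_def)
      next
        case False
        have "ln (dist t s) < ln (exp (- L))" using False L(2) by (subst ln_less_cancel_iff) auto
        then have "L \<le> ln (1 / dist t s)" using False by (simp add: ln_div)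
        then have "c / ln (1 / dist t s) ^ N \<le> c / L ^ N" using L c(1)
          by (intro divide_left_mono power_mono mult_pos_pos zero_less_power) auto
        then show ?thesis using c(2)[OF ts, of i] by linarith
      qed
      then show "\<exists>c. \<forall>t\<in>E. \<forall>s\<in>E. \<forall>L>0. dist t s < exp (- L) \<longrightarrow> l2dist M (\<lambda>\<omega> t. X \<omega> t $ i) t s \<le> c / L ^ N"
        unfolding rho_eq_l2dist by blast
  qed
qed

lemma cyl_cont_add:
  fixes h g :: "(nat \<Rightarrow> nat) \<Rightarrow> 'a::real_normed_vector"
  assumes "cyl_cont F h" "cyl_cont F g" shows "cyl_cont F (\<lambda>x. h x + g x)"
proof -
  have "continuous_on UNIV (\<lambda>p :: 'a \<times> 'a. fst p + snd p)" by (intro continuous_intros)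
  from cyl_cont_compose[OF cyl_cont_Pair[OF assms] this] show ?thesis by simp
qed

text \<open>Here \<open>x\<close> is one path with controlled increments. The control is assumed for
  the exponents \<open>inverse (Suc q)\<close> only, so that countably many null sets suffice for
  every \<epsilon>.\<close>

lemma regular_field_ball_le:
  fixes X :: "'w \<Rightarrow> real^'n \<Rightarrow> real^'d" and f :: "real^'n \<Rightarrow> real^'d" and \<epsilon> :: real
  assumes M: "prob_space M" and X: "\<And>i. centered_gaussian_field M (\<lambda>\<omega> t. X \<omega> t $ i)"
    and ind: "prob_space.indep_vars M (\<lambda>_. Pi\<^sub>M UNIV (\<lambda>_. borel)) (\<lambda>i \<omega> t. X \<omega> t $ i) UNIV"
    and T: "bounded T" "\<And>i. log_modulus (l2dist M (\<lambda>\<omega> t. X \<omega> t $ i)) T"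
    and inc: "\<And>i q. \<forall>\<^sub>F k in sequentially. \<forall>t\<in>T. \<forall>s\<in>T.
      \<bar>x t $ i - x s $ i\<bar> \<le> 2 * 2 powr (inverse (Suc q) * real k) * l2dist M (\<lambda>\<omega> t. X \<omega> t $ i) t s + (1/2)^k"
    and \<epsilon>: "\<epsilon> > 0"
  shows "\<exists>C. \<forall>\<^sub>F k in sequentially. \<forall>t\<in>T. \<forall>s\<in>T. measure M {\<omega>\<in>space M. dist (X \<omega> t + f t) (X \<omega> s + f s) \<le> (1/2)^k}
    \<le> C * 2 powr (\<epsilon> * real k) * prod_kernel ((1/2)^k) (x t + f t) (x s + f s)"
proof -
  define d where "d = CARD('d)"
  have d: "d > 0" by (simp add: d_def)
  \<comment> \<open>Each of the \<open>d\<close> coordinates loses the increment factor once, so its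
    exponent must be below \<open>\<epsilon> / d\<close>.\<close>
  obtain q where q: "inverse (real (Suc q)) < \<epsilon> / d" using reals_Archimedean[of "\<epsilon> / d"] \<epsilon> d by auto
  have "\<exists>S>0. \<forall>t\<in>T. \<forall>s\<in>T. l2dist M (\<lambda>\<omega> t. X \<omega> t $ i) t s \<le> S" for i
    by (rule log_modulus_bounded[OF M X T])
  then obtain S0 where S0: "\<And>i. S0 i > 0" "\<And>i t s. t \<in> T \<Longrightarrow> s \<in> T \<Longrightarrow> l2dist M (\<lambda>\<omega> t. X \<omega> t $ i) t s \<le> S0 i" by metis
  define S where "S = Max (range S0)"
  have S0S: "S0 i \<le> S" for i unfolding S_def by (rule Max_ge) auto
  have S: "l2dist M (\<lambda>\<omega> t. X \<omega> t $ i) t s \<le> S" if "t \<in> T" "s \<in> T" for i t s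
    using S0(2)[OF that, of i] S0S[of i] by linarith
  have Spos: "S > 0" using S0(1)[of undefined] S0S[of undefined] by linarith
  define C where "C = ((5 + 40 * S) * 2) ^ d"
  have "\<forall>\<^sub>F k in sequentially. \<forall>i. \<forall>t\<in>T. \<forall>s\<in>T.
      \<bar>x t $ i - x s $ i\<bar> \<le> 2 * 2 powr (inverse (Suc q) * real k) * l2dist M (\<lambda>\<omega> t. X \<omega> t $ i) t s + (1/2)^k"
    using inc by (intro eventually_all_finite)
  \<comment> \<open>With \<open>?L\<close> twice this power, this is the condition
    \<open>exp (- L / 2) \<le> r\<close> at \<open>r = (1/2)^k\<close>.\<close>
  moreover have "\<forall>\<^sub>F k in sequentially. exp (- (2 powr (inverse (Suc q) * real k))) \<le> (1/2)^k"
    by real_asymp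
  ultimately have "\<forall>\<^sub>F k in sequentially. \<forall>t\<in>T. \<forall>s\<in>T. measure M {\<omega>\<in>space M. dist (X \<omega> t + f t) (X \<omega> s + f s) \<le> (1/2)^k}
    \<le> C * 2 powr (\<epsilon> * real k) * prod_kernel ((1/2)^k) (x t + f t) (x s + f s)"
  proof eventually_elim
    case (elim k)
    show ?case
    proof (intro ballI)
      fix t s assume ts: "t \<in> T" "s \<in> T"
      let ?L = "2 * 2 powr (inverse (Suc q) * real k)"
      have "1 \<le> 2 powr (inverse (Suc q) * real k)" by (intro ge_one_powr_ge_zero) auto
      then have L: "1 \<le> ?L" by linarith
      have "measure M {\<omega>\<in>space M. dist (X \<omega> t + f t) (X \<omega> s + f s) \<le> (1/2)^k}
        \<le> ((5 + 40 * S) * ?L) ^ CARD('d) * prod_kernel ((1/2)^k) (x t + f t) (x s + f s)"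
        using elim ts by (intro field_ball_le_prod_kernel[OF M X ind S[OF ts] Spos _ L]) auto
      also have "((5 + 40 * S) * ?L) ^ CARD('d) = C * (2 powr (inverse (Suc q) * real k)) ^ d"
        unfolding C_def d_def power_mult_distrib by (simp only: mult_ac)
      also have "(2 powr (inverse (Suc q) * real k)) ^ d = 2 powr (inverse (Suc q) * real k * real d)"
      proof -
        have "(2 powr (inverse (Suc q) * real k)) ^ d = (2 powr (inverse (Suc q) * real k)) powr real d"
          by (rule powr_realpow[symmetric]) simp
        then show ?thesis by (simp only: powr_powr)
      qed
      also have "C * 2 powr (inverse (Suc q) * real k * real d) * prod_kernel ((1/2)^k) (x t + f t) (x s + f s)
        \<le> C * 2 powr (\<epsilon> * real k) * prod_kernel ((1/2)^k) (x t + f t) (x s + f s)"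
      proof (intro mult_right_mono mult_left_mono powr_mono prod_kernel_nonneg)
        have "inverse (real (Suc q)) * d \<le> \<epsilon>" using q d by (simp add: field_simps)
        then have "inverse (real (Suc q)) * d * k \<le> \<epsilon> * k" by (intro mult_right_mono) auto
        then show "inverse (real (Suc q)) * real k * real d \<le> \<epsilon> * real k" by (simp only: mult_ac)
      qed (use Spos in \<open>auto simp: C_def\<close>)
      finally show "measure M {\<omega>\<in>space M. dist (X \<omega> t + f t) (X \<omega> s + f s) \<le> (1/2)^k}
        \<le> C * 2 powr (\<epsilon> * real k) * prod_kernel ((1/2)^k) (x t + f t) (x s + f s)" .
    qed
  qed
  then show ?thesis by blast
qed

text \<open>The parameter is not random: for \<open>dist t s > r\<close> the event is empty, and
  otherwise the kernel of the first component is at least \<open>(1/2) ^ DIM('a)\<close>, so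
  inserting it costs a constant.\<close>

lemma graph_ball_le:
  fixes Z :: "'w \<Rightarrow> 'a::euclidean_space \<Rightarrow> 'b::euclidean_space"
  assumes M: "prob_space M" and Z: "\<And>t. (\<lambda>\<omega>. Z \<omega> t) \<in> borel_measurable M" and r: "0 < r"
    and le: "measure M {\<omega>\<in>space M. dist (Z \<omega> t) (Z \<omega> s) \<le> r} \<le> B * prod_kernel r z z'"
  shows "measure M {\<omega>\<in>space M. dist (t, Z \<omega> t) (s, Z \<omega> s) \<le> r} \<le> 2 ^ DIM('a) * B * prod_kernel r (t, z) (s, z')"
proof -
  interpret prob_space M by fact
  have "0 < prod_kernel r z z'" unfolding prod_kernel_def using r by (intro prod_pos) (auto intro!: divide_pos_pos add_pos_nonneg)
  moreover have "0 \<le> B * prod_kernel r z z'" using le measure_nonneg order_trans by blast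
  ultimately have B: "0 \<le> B" by (simp add: zero_le_mult_iff)
  show ?thesis
  proof (cases "dist t s \<le> r")
    case False
    have "dist t s \<le> dist (t, Z \<omega> t) (s, Z \<omega> s)" for \<omega> by (rule order_trans[OF _ dist_fst_le]) simp
    then have "{\<omega>\<in>space M. dist (t, Z \<omega> t) (s, Z \<omega> s) \<le> r} = {}" using False by (auto intro: order_trans)
    then have "measure M {\<omega>\<in>space M. dist (t, Z \<omega> t) (s, Z \<omega> s) \<le> r} = 0" by (simp only: measure_empty)
    then show ?thesis using B r by (simp add: prod_kernel_nonneg)
  next
    case True
    have snd_le: "dist (Z \<omega> t) (Z \<omega> s) \<le> dist (t, Z \<omega> t) (s, Z \<omega> s)" for \<omega> by (rule order_trans[OF _ dist_snd_le]) simp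
    have "measure M {\<omega>\<in>space M. dist (t, Z \<omega> t) (s, Z \<omega> s) \<le> r} \<le> measure M {\<omega>\<in>space M. dist (Z \<omega> t) (Z \<omega> s) \<le> r}"
    proof (rule finite_measure_mono)
      note [measurable] = Z
      show "{\<omega>\<in>space M. dist (Z \<omega> t) (Z \<omega> s) \<le> r} \<in> sets M" by measurable
    qed (use snd_le in \<open>auto intro: order_trans\<close>)
    also note le
    also have "B * prod_kernel r z z' = B * prod_kernel r z z' * (2 ^ DIM('a) * (1/2) ^ DIM('a))"
      by (simp add: power_mult_distrib[symmetric])
    also have "\<dots> \<le> B * prod_kernel r z z' * (2 ^ DIM('a) * prod_kernel r t s)"
      using B r prod_kernel_ge[OF r True] by (intro mult_left_mono mult_nonneg_nonneg prod_kernel_nonneg) auto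
    also have "\<dots> = 2 ^ DIM('a) * B * prod_kernel r (t, z) (s, z')" by (simp add: prod_kernel_Pair)
    finally show ?thesis .
  qed
qed

theorem theorem3p6:
  fixes M :: "'w measure" and X :: "'w \<Rightarrow> real^'n \<Rightarrow> real^'d"
    and f :: "real^'n \<Rightarrow> real^'d" and A :: "(real^'n) set"
  assumes "prob_space M"
    and "\<forall>i. centered_gaussian_field M (\<lambda>\<omega> t. X \<omega> t $ i)"
    and "prob_space.indep_vars M (\<lambda>_. Pi\<^sub>M UNIV (\<lambda>_. borel)) (\<lambda>i \<omega> t. X \<omega> t $ i) UNIV"
    and "AE \<omega> in M. continuous_on UNIV (X \<omega>)"
    and "(\<lambda>(\<omega>, t). X \<omega> t) \<in> borel_measurable (M \<Otimes>\<^sub>M borel)"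
    and "f \<in> borel_measurable borel"
    and "analytic A"
    and "regular_on M X A"
  shows "(AE \<omega> in M. dimP ((\<lambda>t. X \<omega> t + f t) ` A) \<le> dimPZ M (\<lambda>\<omega> t. X \<omega> t + f t) A)
       \<and> (AE \<omega> in M. dimP ((\<lambda>t. (t, X \<omega> t + f t)) ` A) \<le> dimPZ M (\<lambda>\<omega> t. (t, X \<omega> t + f t)) A)"
proof -
  have X: "centered_gaussian_field M (\<lambda>\<omega> t. X \<omega> t $ i)" for i using assms(2) by blast
  have Xc: "AE \<omega> in M. continuous_on UNIV (\<lambda>t. X \<omega> t $ i)" for i
    using assms(4) by (rule AE_mp) (auto intro!: AE_I2 continuous_intros)
  obtain Ak :: "nat \<Rightarrow> (real^'n) set" where Ak: "A = (\<Union>k. Ak k)"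
    and reg: "\<And>k N. (N::nat) \<ge> 1 \<Longrightarrow> \<exists>c>0. \<forall>t\<in>Ak k. \<forall>s\<in>Ak k. \<forall>i. rho M X i t s \<le> c / (ln (1 / dist t s)) ^ N"
    using assms(8) unfolding regular_on_def by blast
  \<comment> \<open>Intersecting \<open>A\<close> with the closures replaces the possibly wild
    pieces by Souslin ones that still cover \<open>A\<close>.\<close>
  define T where "T k = closure (Ak k)" for k
  have T: "bounded (T k)" "log_modulus (l2dist M (\<lambda>\<omega> t. X \<omega> t $ i)) (T k)" for k i
    unfolding T_def using regular_piece[OF reg[where k=k]] log_modulus_closure[OF assms(1) X Xc] by auto
  define E where "E k = A \<inter> T k" for k
  have "Ak k \<subseteq> T k" for k unfolding T_def by (rule closure_subset)
  then have A: "A = (\<Union>k. E k)" unfolding E_def Ak by blast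
  \<comment> \<open>These parametrizations depend on \<open>f\<close> but not on \<omega>; along
    them the image is continuous for every continuous path.\<close>
  have "\<exists>F G. cyl_closed F \<and> cyl_cont F G \<and> G ` F = E k \<and> cyl_cont F (\<lambda>x. f (G x))" for k
    unfolding E_def T_def
    by (intro souslin_borel_map_parametrization souslin_Int_closed analytic_imp_souslin assms closed_closure)
  then obtain F G where F: "\<And>k. cyl_closed (F k)" "\<And>k. cyl_cont (F k) (G k)" "\<And>k. G k ` F k = E k"
    "\<And>k. cyl_cont (F k) (\<lambda>x. f (G k x))" by metis
  note [measurable (raw)] = measurable_random_map_compose[OF assms(5)]
  note [measurable] = assms(6)
  have joint1: "(\<lambda>(\<omega>, t). X \<omega> t + f t) \<in> borel_measurable (M \<Otimes>\<^sub>M borel)" by measurable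
  have joint2: "(\<lambda>(\<omega>, t). (t, X \<omega> t + f t)) \<in> borel_measurable (M \<Otimes>\<^sub>M borel)"
    unfolding borel_prod[symmetric] by measurable
  have Zm: "(\<lambda>\<omega>. X \<omega> t + f t) \<in> borel_measurable M" for t by measurable
  have "AE \<omega> in M. \<forall>\<^sub>F m in sequentially. \<forall>t\<in>T k. \<forall>s\<in>T k.
      \<bar>X \<omega> t $ i - X \<omega> s $ i\<bar> \<le> 2 * 2 powr (inverse (Suc q) * real m) * l2dist M (\<lambda>\<omega> t. X \<omega> t $ i) t s + (1/2)^m" for k i q
    by (rule gaussian_uniform_increments[OF assms(1) X Xc T]) simp
  \<comment> \<open>A single null set serves all pieces, coordinates and exponents; from here on the
    path is fixed.\<close>
  then have "AE \<omega> in M. \<forall>k i q. \<forall>\<^sub>F m in sequentially. \<forall>t\<in>T k. \<forall>s\<in>T k.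
      \<bar>X \<omega> t $ i - X \<omega> s $ i\<bar> \<le> 2 * 2 powr (inverse (Suc q) * real m) * l2dist M (\<lambda>\<omega> t. X \<omega> t $ i) t s + (1/2)^m"
    by (simp add: AE_all_countable)
  with assms(4) have "AE \<omega> in M. dimP ((\<lambda>t. X \<omega> t + f t) ` A) \<le> dimPZ M (\<lambda>\<omega> t. X \<omega> t + f t) A
      \<and> dimP ((\<lambda>t. (t, X \<omega> t + f t)) ` A) \<le> dimPZ M (\<lambda>\<omega> t. (t, X \<omega> t + f t)) A"
  proof eventually_elim
    case (elim \<omega>)
    have XG: "cyl_cont (F k) (\<lambda>x. X \<omega> (G k x) + f (G k x))" for k
      by (intro cyl_cont_add cyl_cont_compose[OF F(2) elim(1)] F(4))
    have ET: "E k \<subseteq> T k" "E k \<subseteq> A" for k by (auto simp: E_def)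
    have ker: "\<exists>C. \<forall>\<^sub>F m in sequentially. \<forall>t\<in>E k. \<forall>s\<in>E k. measure M {\<omega>\<in>space M. dist (X \<omega> t + f t) (X \<omega> s + f s) \<le> (1/2)^m}
      \<le> C * 2 powr (\<epsilon> * real m) * prod_kernel ((1/2)^m) (X \<omega> t + f t) (X \<omega> s + f s)" if \<epsilon>: "\<epsilon> > 0" for k \<epsilon>
    proof -
      obtain C where "\<forall>\<^sub>F m in sequentially. \<forall>t\<in>T k. \<forall>s\<in>T k. measure M {\<omega>\<in>space M. dist (X \<omega> t + f t) (X \<omega> s + f s) \<le> (1/2)^m}
        \<le> C * 2 powr (\<epsilon> * real m) * prod_kernel ((1/2)^m) (X \<omega> t + f t) (X \<omega> s + f s)"
        using regular_field_ball_le[OF assms(1) X assms(3) T(1)[of k] T(2)[of _ k] _ \<epsilon>, of "X \<omega>" f] elim(2) by blast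
      then have "\<forall>\<^sub>F m in sequentially. \<forall>t\<in>E k. \<forall>s\<in>E k. measure M {\<omega>\<in>space M. dist (X \<omega> t + f t) (X \<omega> s + f s) \<le> (1/2)^m}
        \<le> C * 2 powr (\<epsilon> * real m) * prod_kernel ((1/2)^m) (X \<omega> t + f t) (X \<omega> s + f s)"
        by (rule eventually_mono) (use ET(1)[of k] in blast)
      then show ?thesis by blast
    qed
    have ker2: "\<exists>C. \<forall>\<^sub>F m in sequentially. \<forall>t\<in>E k. \<forall>s\<in>E k. measure M {\<omega>\<in>space M. dist (t, X \<omega> t + f t) (s, X \<omega> s + f s) \<le> (1/2)^m}
      \<le> C * 2 powr (\<epsilon> * real m) * prod_kernel ((1/2)^m) (t, X \<omega> t + f t) (s, X \<omega> s + f s)" if \<epsilon>: "\<epsilon> > 0" for k \<epsilon>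
    proof -
      obtain C where C: "\<forall>\<^sub>F m in sequentially. \<forall>t\<in>E k. \<forall>s\<in>E k. measure M {\<omega>\<in>space M. dist (X \<omega> t + f t) (X \<omega> s + f s) \<le> (1/2)^m}
        \<le> C * 2 powr (\<epsilon> * real m) * prod_kernel ((1/2)^m) (X \<omega> t + f t) (X \<omega> s + f s)" using ker[OF \<epsilon>] by blast
      have "\<forall>\<^sub>F m in sequentially. \<forall>t\<in>E k. \<forall>s\<in>E k. measure M {\<omega>\<in>space M. dist (t, X \<omega> t + f t) (s, X \<omega> s + f s) \<le> (1/2)^m}
        \<le> 2 ^ DIM(real^'n) * (C * 2 powr (\<epsilon> * real m)) * prod_kernel ((1/2)^m) (t, X \<omega> t + f t) (s, X \<omega> s + f s)"
        using C by (rule eventually_mono) (intro ballI graph_ball_le[OF assms(1) Zm], auto)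
      then show ?thesis unfolding mult.assoc[symmetric] by blast
    qed
    have "dimP (\<Union>k. (\<lambda>t. X \<omega> t + f t) ` E k) \<le> dimPZ M (\<lambda>\<omega> t. X \<omega> t + f t) A"
      by (intro dimP_UN_le dimP_image_le_dimPZ[OF assms(1) joint1 F(1,2) XG F(3) ET(2) ker]) auto
    moreover have "dimP (\<Union>k. (\<lambda>t. (t, X \<omega> t + f t)) ` E k) \<le> dimPZ M (\<lambda>\<omega> t. (t, X \<omega> t + f t)) A"
      by (intro dimP_UN_le dimP_image_le_dimPZ[OF assms(1) joint2 F(1,2) cyl_cont_Pair[OF F(2) XG] F(3) ET(2) ker2]) auto
    ultimately show ?case unfolding image_UN[symmetric] A[symmetric] by blast
  qed
  then show ?thesis by (simp add: AE_conj_iff)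
qed

end
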